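(* Let $H$ be a commutative bialgebra over a commutative ring $k$, let $A$ be a commutative right $H$-comodule algebra, and let $B=A^{\mathrm{co}H}$. Then there is an exact sequence of abelian groups $$1\to \mathbb{G}_m(B)\to\mathbb{G}_m(A)\xrightarrow{\ d\ }G^i(A\otimes H)\xrightarrow{\ g\ } \mathrm{Pic}^H(A)\to \mathrm{Pic}(A),$$ where the first map is the inclusion, $d(a)=a^{-1}a_{[0]}\otimes a_{[1]}$, $g(X)=\{A^X\}$, and the last map is induced by the functor forgetting the $H$-coaction.
   Context: Notation: $\rho(a)=a_{[0]}\otimes a_{[1]}\in A\otimes H$ is the coaction on $A$ (an algebra map), and $\Delta(h)=h_{(1)}\otimes h_{(2)}$, $\varepsilon$ are the comultiplication and counit of $H$. $A^{\mathrm{co}H}=\{a\in A\mid \rho(a)=a\otimes 1\}$. $\mathbb{G}_m(R)$ is the unit group of a commutative ring $R$, and $\mathrm{Pic}(R)$ its Picard group. A relative Hopf module is an $A$-module $M$ with a right $H$-coaction $\rho_M(m)=m_{[0]}\otimes m_{[1]}$ such that $\rho_M(ma)=m_{[0]}a_{[0]}\otimes m_{[1]}a_{[1]}$ for all $a\in A$, $m\in M$. Relative Hopf modules with $A$-linear $H$-colinear maps form a category $\mathcal{M}^H_A$. It is symmetric monoidal under $\otimes_A$ with unit object $A$, where the coaction on $M\otimes_A N$ is $m\otimes_A n\mapsto m_{[0]}\otimes_A n_{[0]}\otimes m_{[1]}n_{[1]}$. The relative Picard group $\mathrm{Pic}^H(A)$ is the group of isomorphism classes $\{M\}$ of invertible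 objects of $(\mathcal{M}^H_A,\otimes_A,A)$. View $A\otimes H$ as a commutative algebra with product $(a\otimes h)(b\otimes k)=ab\otimes hk$. An element $X=\sum_i a_i\otimes h_i\in A\otimes H$ is called grouplike if $$\sum_i a_i\otimes h_{i(1)}\otimes h_{i(2)}=\sum_{i,j}a_i a_{j[0]}\otimes h_i a_{j[1]}\otimes h_j\quad\text{and}\quad \sum_i a_i\varepsilon(h_i)=1.$$ $G^i(A\otimes H)$ is the abelian group (under multiplication in $A\otimes H$) of grouplike elements that are invertible in $A\otimes H$. For a grouplike $X=\sum_i a_i\otimes h_i$, $A^X$ denotes the relative Hopf module with underlying $A$-module $A$ and coaction $\rho_X(a)=X\rho(a)=\sum_i a_i a_{[0]}\otimes h_i a_{[1]}$. *)

theory Defs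
  imports "HOL-Algebra.Module" "HOL-Algebra.Free_Abelian_Groups"
begin

section \<open>Tensor products of modules over a commutative ring\<close>

text \<open>
  All modules live on carriers, and all rings are commutative, so a right action is written as the
  scalar multiplication of the library's modules. The tensor product of two modules is the free
  abelian group on pairs modulo the bilinearity relations; its elements are cosets.
\<close>

type_synonym ('m, 'n) tensor = "(('m \<times> 'n) \<Rightarrow>\<^sub>0 int) set"

definition module_hom ::
  "('r, 'x) ring_scheme \<Rightarrow> ('r, 'm, 'y) module_scheme \<Rightarrow> ('r, 'n, 'z) module_scheme \<Rightarrow> ('m \<Rightarrow> 'n) set"
  where "module_hom R M N = {f \<in> carrier M \<rightarrow> carrier N.
    (\<forall>x \<in> carrier M. \<forall>y \<in> carrier M. f (x \<oplus>\<^bsub>M\<^esub> y) = f x \<oplus>\<^bsub>N\<^esub> f y) \<and>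
    (\<forall>r \<in> carrier R. \<forall>x \<in> carrier M. f (r \<odot>\<^bsub>M\<^esub> x) = r \<odot>\<^bsub>N\<^esub> f x)}"

definition regular_module :: "('a, 'x) ring_scheme \<Rightarrow> ('a, 'a) module"
  where "regular_module A = \<lparr>carrier = carrier A, monoid.mult = monoid.mult A, one = one A,
    ring.zero = ring.zero A, add = add A, smult = monoid.mult A\<rparr>"

text \<open>An \<open>A\<close>-module regarded as a \<open>k\<close>-module along the structure map \<open>c \<mapsto> c 1\<close> of the algebra \<open>A\<close>.\<close>

definition restrict_scalars ::
  "('k, 'a, 'x) module_scheme \<Rightarrow> ('a, 'm, 'y) module_scheme \<Rightarrow> ('k, 'm) module"
  where "restrict_scalars A M = \<lparr>carrier = carrier M, monoid.mult = monoid.mult M, one = one M,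
    ring.zero = ring.zero M, add = add M, smult = (\<lambda>c m. (c \<odot>\<^bsub>A\<^esub> \<one>\<^bsub>A\<^esub>) \<odot>\<^bsub>M\<^esub> m)\<rparr>"

definition tensor_free ::
  "('r, 'm, 'y) module_scheme \<Rightarrow> ('r, 'n, 'z) module_scheme \<Rightarrow> ('m \<times> 'n \<Rightarrow>\<^sub>0 int) monoid"
  where "tensor_free M N = free_Abelian_group (carrier M \<times> carrier N)"

definition tensor_relations ::
  "('r, 'x) ring_scheme \<Rightarrow> ('r, 'm, 'y) module_scheme \<Rightarrow> ('r, 'n, 'z) module_scheme \<Rightarrow> ('m, 'n) tensor"
  where "tensor_relations R M N =
    {frag_of (m \<oplus>\<^bsub>M\<^esub> m', n) - frag_of (m, n) - frag_of (m', n) | m m' n.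
       m \<in> carrier M \<and> m' \<in> carrier M \<and> n \<in> carrier N} \<union>
    {frag_of (m, n \<oplus>\<^bsub>N\<^esub> n') - frag_of (m, n) - frag_of (m, n') | m n n'.
       m \<in> carrier M \<and> n \<in> carrier N \<and> n' \<in> carrier N} \<union>
    {frag_of (r \<odot>\<^bsub>M\<^esub> m, n) - frag_of (m, r \<odot>\<^bsub>N\<^esub> n) | r m n.
       r \<in> carrier R \<and> m \<in> carrier M \<and> n \<in> carrier N}"

definition tensor_kernel ::
  "('r, 'x) ring_scheme \<Rightarrow> ('r, 'm, 'y) module_scheme \<Rightarrow> ('r, 'n, 'z) module_scheme \<Rightarrow> ('m, 'n) tensor"
  where "tensor_kernel R M N = generate (tensor_free M N) (tensor_relations R M N)"

definition pure_tensor ::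
  "('r, 'x) ring_scheme \<Rightarrow> ('r, 'm, 'y) module_scheme \<Rightarrow> ('r, 'n, 'z) module_scheme \<Rightarrow>
   'm \<Rightarrow> 'n \<Rightarrow> ('m, 'n) tensor"
  where "pure_tensor R M N m n = tensor_kernel R M N #>\<^bsub>tensor_free M N\<^esub> frag_of (m, n)"

text \<open>
  The additive map out of a tensor product determined by a balanced biadditive map \<open>f\<close>, namely
  \<open>\<Sum> m\<^sub>i \<otimes> n\<^sub>i \<mapsto> \<Sum> f m\<^sub>i n\<^sub>i\<close>. It is evaluated on the representatives of the coset, which all give
  the same value when \<open>f\<close> is balanced; for other \<open>f\<close> it is meaningless.
\<close>

definition lift_to_group ::
  "('p, 'x) monoid_scheme \<Rightarrow> ('m \<Rightarrow> 'n \<Rightarrow> 'p) \<Rightarrow> ('m, 'n) tensor \<Rightarrow> 'p"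
  where "lift_to_group G f X = the_elem ((\<lambda>p.
    \<Otimes>\<^bsub>G\<^esub> z \<in> Poly_Mapping.keys p. f (fst z) (snd z) [^]\<^bsub>G\<^esub> Poly_Mapping.lookup p z) ` X)"

definition tensor_lift ::
  "('p, 'x) ring_scheme \<Rightarrow> ('m \<Rightarrow> 'n \<Rightarrow> 'p) \<Rightarrow> ('m, 'n) tensor \<Rightarrow> 'p"
  where "tensor_lift P = lift_to_group (add_monoid P)"

text \<open>
  The library's module records carry ring multiplication fields, which are irrelevant for modules;
  for two algebras they are supplied by \<open>tensor_algebra\<close> below.
\<close>

definition tensor ::
  "('r, 'x) ring_scheme \<Rightarrow> ('r, 'm, 'y) module_scheme \<Rightarrow> ('r, 'n, 'z) module_scheme \<Rightarrow>
   ('r, ('m, 'n) tensor) module"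
  where "tensor R M N = (let T = tensor_free M N Mod tensor_kernel R M N in
    \<lparr>carrier = carrier T, monoid.mult = undefined, one = undefined,
     ring.zero = one T, add = monoid.mult T,
     smult = (\<lambda>r. lift_to_group T (\<lambda>m n. pure_tensor R M N (r \<odot>\<^bsub>M\<^esub> m) n))\<rparr>)"

text \<open>\<open>f \<otimes> g\<close>, with values in \<open>M' \<otimes> N'\<close>.\<close>

definition tensor_map ::
  "('r, 'x) ring_scheme \<Rightarrow> ('r, 'p, 'y) module_scheme \<Rightarrow> ('r, 'q, 'z) module_scheme \<Rightarrow>
   ('m \<Rightarrow> 'p) \<Rightarrow> ('n \<Rightarrow> 'q) \<Rightarrow> ('m, 'n) tensor \<Rightarrow> ('p, 'q) tensor"
  where "tensor_map R M' N' f g =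
    tensor_lift (tensor R M' N') (\<lambda>m n. pure_tensor R M' N' (f m) (g n))"

text \<open>The isomorphism \<open>(L \<otimes> M) \<otimes> N \<cong> L \<otimes> (M \<otimes> N)\<close>.\<close>

definition tensor_assoc ::
  "('r, 'w) ring_scheme \<Rightarrow> ('r, 'l, 'x) module_scheme \<Rightarrow> ('r, 'm, 'y) module_scheme \<Rightarrow>
   ('r, 'n, 'z) module_scheme \<Rightarrow> (('l, 'm) tensor, 'n) tensor \<Rightarrow> ('l, ('m, 'n) tensor) tensor"
  where "tensor_assoc R L M N = (let T = tensor R L (tensor R M N) in
    tensor_lift T (\<lambda>u n. tensor_lift T (\<lambda>l m.
      pure_tensor R L (tensor R M N) l (pure_tensor R M N m n)) u))"

text \<open>
  The pairing \<open>(m \<otimes> n, m' \<otimes> n') \<mapsto> f m m' \<otimes> g n n'\<close>, with values in \<open>P \<otimes> Q\<close>.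
\<close>

definition tensor_pairing ::
  "('r, 'x) ring_scheme \<Rightarrow> ('r, 'p, 'y) module_scheme \<Rightarrow> ('r, 'q, 'z) module_scheme \<Rightarrow>
   ('m \<Rightarrow> 'm1 \<Rightarrow> 'p) \<Rightarrow> ('n \<Rightarrow> 'n1 \<Rightarrow> 'q) \<Rightarrow> ('m, 'n) tensor \<Rightarrow> ('m1, 'n1) tensor \<Rightarrow> ('p, 'q) tensor"
  where "tensor_pairing R P Q f g X Y =
    tensor_lift (tensor R P Q) (\<lambda>m n.
      tensor_lift (tensor R P Q) (\<lambda>m' n'. pure_tensor R P Q (f m m') (g n n')) Y) X"

definition tensor_algebra ::
  "('r, 'x) ring_scheme \<Rightarrow> ('r, 'm, 'y) module_scheme \<Rightarrow> ('r, 'n, 'z) module_scheme \<Rightarrow>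
   ('r, ('m, 'n) tensor) module"
  where "tensor_algebra R A B = (tensor R A B)
    \<lparr>monoid.mult := tensor_pairing R A B (monoid.mult A) (monoid.mult B),
     one := pure_tensor R A B \<one>\<^bsub>A\<^esub> \<one>\<^bsub>B\<^esub>\<rparr>"


section \<open>Bialgebras, comodule algebras and relative Hopf modules\<close>

record ('k, 'h) bialgebra = "('k, 'h) module" +
  comult :: "'h \<Rightarrow> ('h, 'h) tensor"
  counit :: "'h \<Rightarrow> 'k"

locale comm_bialgebra = algebra k H
  for k :: "'k ring" and H :: "('k, 'h) bialgebra" +
  assumes comult_ring_hom: "comult H \<in> ring_hom H (tensor_algebra k H H)"
    and comult_linear: "comult H \<in> module_hom k H (tensor k H H)"
    and counit_ring_hom: "counit H \<in> ring_hom H k"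
    and counit_linear: "counit H \<in> module_hom k H (regular_module k)"
    and coassoc: "h \<in> carrier H \<Longrightarrow>
      tensor_assoc k H H H (tensor_map k (tensor k H H) H (comult H) (\<lambda>x. x) (comult H h)) =
      tensor_map k H (tensor k H H) (\<lambda>x. x) (comult H) (comult H h)"
    and counit_left: "h \<in> carrier H \<Longrightarrow> tensor_lift H (\<lambda>x y. counit H x \<odot>\<^bsub>H\<^esub> y) (comult H h) = h"
    and counit_right: "h \<in> carrier H \<Longrightarrow> tensor_lift H (\<lambda>x y. counit H y \<odot>\<^bsub>H\<^esub> x) (comult H h) = h"

definition right_coaction ::
  "'k ring \<Rightarrow> ('k, 'h) bialgebra \<Rightarrow> ('k, 'v, 'z) module_scheme \<Rightarrow> ('v \<Rightarrow> ('v, 'h) tensor) \<Rightarrow> bool"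
  where "right_coaction k H V \<rho> \<longleftrightarrow>
    \<rho> \<in> module_hom k V (tensor k V H) \<and>
    (\<forall>v \<in> carrier V.
      tensor_assoc k V H H (tensor_map k (tensor k V H) H \<rho> (\<lambda>h. h) (\<rho> v)) =
      tensor_map k V (tensor k H H) (\<lambda>v. v) (comult H) (\<rho> v)) \<and>
    (\<forall>v \<in> carrier V. tensor_lift V (\<lambda>v h. counit H h \<odot>\<^bsub>V\<^esub> v) (\<rho> v) = v)"

text \<open>
  An \<open>R\<close>-module with a coaction. It serves for the comodule algebra \<open>A\<close> (with \<open>R = k\<close>) and for
  relative Hopf modules (with \<open>R = A\<close>).
\<close>

record ('r, 'm, 'h) comod = "('r, 'm) module" +
  coact :: "'m \<Rightarrow> ('m, 'h) tensor"

definition with_coaction :: "('r, 'm) module \<Rightarrow> ('m \<Rightarrow> ('m, 'h) tensor) \<Rightarrow> ('r, 'm, 'h) comod"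
  where "with_coaction M \<rho> = module.extend M (comod.fields \<rho>)"

definition comodule_algebra :: "'k ring \<Rightarrow> ('k, 'h) bialgebra \<Rightarrow> ('k, 'a, 'h) comod \<Rightarrow> bool"
  where "comodule_algebra k H A \<longleftrightarrow>
    algebra k A \<and> right_coaction k H A (coact A) \<and> coact A \<in> ring_hom A (tensor_algebra k A H)"

definition coinvariant_ring :: "'k ring \<Rightarrow> ('k, 'h) bialgebra \<Rightarrow> ('k, 'a, 'h) comod \<Rightarrow> ('k, 'a, 'h) comod"
  where "coinvariant_ring k H A =
    A\<lparr>carrier := {a \<in> carrier A. coact A a = pure_tensor k A H a \<one>\<^bsub>H\<^esub>}\<rparr>"

text \<open>The last condition is \<open>\<rho> (m a) = \<Sum> m\<^sub>0 a\<^sub>0 \<otimes> m\<^sub>1 a\<^sub>1\<close>.\<close>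

definition relative_Hopf_module ::
  "'k ring \<Rightarrow> ('k, 'h) bialgebra \<Rightarrow> ('k, 'a, 'h) comod \<Rightarrow> ('a, 'm, 'h) comod \<Rightarrow> bool"
  where "relative_Hopf_module k H A M \<longleftrightarrow>
    module A M \<and> right_coaction k H (restrict_scalars A M) (coact M) \<and>
    (\<forall>m \<in> carrier M. \<forall>a \<in> carrier A. coact M (a \<odot>\<^bsub>M\<^esub> m) =
      tensor_pairing k (restrict_scalars A M) H (\<lambda>m a. a \<odot>\<^bsub>M\<^esub> m) (monoid.mult H) (coact M m) (coact A a))"

definition relative_Hopf_hom ::
  "'k ring \<Rightarrow> ('k, 'h) bialgebra \<Rightarrow> ('k, 'a, 'h) comod \<Rightarrow> ('a, 'm, 'h) comod \<Rightarrow> ('a, 'n, 'h) comod \<Rightarrow>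
   ('m \<Rightarrow> 'n) set"
  where "relative_Hopf_hom k H A M N = {f \<in> module_hom A M N. \<forall>m \<in> carrier M.
    coact N (f m) = tensor_map k (restrict_scalars A N) H f (\<lambda>h. h) (coact M m)}"

definition relative_Hopf_iso ::
  "'k ring \<Rightarrow> ('k, 'h) bialgebra \<Rightarrow> ('k, 'a, 'h) comod \<Rightarrow> ('a, 'm, 'h) comod \<Rightarrow> ('a, 'n, 'h) comod \<Rightarrow> bool"
  where "relative_Hopf_iso k H A M N \<longleftrightarrow>
    (\<exists>f \<in> relative_Hopf_hom k H A M N. \<exists>g \<in> relative_Hopf_hom k H A N M.
      (\<forall>x \<in> carrier M. g (f x) = x) \<and> (\<forall>y \<in> carrier N. f (g y) = y))"

definition relative_Hopf_unit :: "('k, 'a, 'h) comod \<Rightarrow> ('a, 'a, 'h) comod"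
  where "relative_Hopf_unit A = with_coaction (regular_module A) (coact A)"

definition relative_Hopf_tensor ::
  "'k ring \<Rightarrow> ('k, 'h) bialgebra \<Rightarrow> ('k, 'a, 'h) comod \<Rightarrow> ('a, 'm, 'h) comod \<Rightarrow> ('a, 'n, 'h) comod \<Rightarrow>
   ('a, ('m, 'n) tensor, 'h) comod"
  where "relative_Hopf_tensor k H A M N = (let T = restrict_scalars A (tensor A M N) in
    with_coaction (tensor A M N)
      (tensor_lift (tensor k T H) (\<lambda>m n.
        tensor_pairing k T H (pure_tensor A M N) (monoid.mult H) (coact M m) (coact N n))))"

definition module_iso ::
  "('r, 'x) ring_scheme \<Rightarrow> ('r, 'm, 'y) module_scheme \<Rightarrow> ('r, 'n, 'z) module_scheme \<Rightarrow> bool"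
  where "module_iso R M N \<longleftrightarrow>
    (\<exists>f \<in> module_hom R M N. \<exists>g \<in> module_hom R N M.
      (\<forall>x \<in> carrier M. g (f x) = x) \<and> (\<forall>y \<in> carrier N. f (g y) = y))"


section \<open>Picard groups and grouplike elements\<close>

text \<open>
  Isomorphism classes are formed among the objects whose carrier is a set of elements of a type
  \<open>'u\<close>, which plays the role of a universe. An object over any other type, such as a tensor product
  or the unit object, has a class, consisting of its isomorphic copies on \<open>'u\<close>. Invertible objects are
  finitely generated over \<open>A\<close>, so a universe into which the finite lists over \<open>A\<close> inject contains
  a copy of every one of them, and of every inverse; \<open>'a list\<close> is such a universe.
\<close>

definition relative_class ::
  "'k ring \<Rightarrow> ('k, 'h) bialgebra \<Rightarrow> ('k, 'a, 'h) comod \<Rightarrow> ('a, 'm, 'h) comod \<Rightarrow> ('a, 'u, 'h) comod set"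
  where "relative_class k H A M = {P. relative_Hopf_module k H A P \<and> relative_Hopf_iso k H A M P}"

definition relative_invertible ::
  "'u itself \<Rightarrow> 'k ring \<Rightarrow> ('k, 'h) bialgebra \<Rightarrow> ('k, 'a, 'h) comod \<Rightarrow> ('a, 'm, 'h) comod \<Rightarrow> bool"
  where "relative_invertible U k H A M \<longleftrightarrow> relative_Hopf_module k H A M \<and>
    (\<exists>N :: ('a, 'u, 'h) comod. relative_Hopf_module k H A N \<and>
      relative_Hopf_iso k H A (relative_Hopf_tensor k H A M N) (relative_Hopf_unit A))"

definition relative_Pic ::
  "'u itself \<Rightarrow> 'k ring \<Rightarrow> ('k, 'h) bialgebra \<Rightarrow> ('k, 'a, 'h) comod \<Rightarrow> ('a, 'u, 'h) comod set monoid"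
  where "relative_Pic U k H A = \<lparr>
    carrier = {relative_class k H A M | M :: ('a, 'u, 'h) comod. relative_invertible U k H A M},
    monoid.mult = (\<lambda>C D. \<Union>M \<in> C. \<Union>N \<in> D. relative_class k H A (relative_Hopf_tensor k H A M N)),
    one = relative_class k H A (relative_Hopf_unit A)\<rparr>"

definition module_class ::
  "('a, 'x) ring_scheme \<Rightarrow> ('a, 'm, 'y) module_scheme \<Rightarrow> ('a, 'u) module set"
  where "module_class A M = {P. module A P \<and> module_iso A M P}"

definition module_invertible ::
  "'u itself \<Rightarrow> ('a, 'x) ring_scheme \<Rightarrow> ('a, 'm, 'y) module_scheme \<Rightarrow> bool"
  where "module_invertible U A M \<longleftrightarrow> module A M \<and>
    (\<exists>N :: ('a, 'u) module. module A N \<and> module_iso A (tensor A M N) (regular_module A))"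

definition Pic :: "'u itself \<Rightarrow> ('a, 'x) ring_scheme \<Rightarrow> ('a, 'u) module set monoid"
  where "Pic U A = \<lparr>
    carrier = {module_class A M | M :: ('a, 'u) module. module_invertible U A M},
    monoid.mult = (\<lambda>C D. \<Union>M \<in> C. \<Union>N \<in> D. module_class A (tensor A M N)),
    one = module_class A (regular_module A)\<rparr>"

text \<open>\<open>{M} \<mapsto> {M}\<close>, forgetting the coaction: every member of a class has the same underlying class.\<close>

definition forget_coaction ::
  "('k, 'a, 'h) comod \<Rightarrow> ('a, 'u, 'h) comod set \<Rightarrow> ('a, 'u) module set"
  where "forget_coaction A C = (\<Union>M \<in> C. module_class A M)"

text \<open>
  For \<open>X = \<Sum> a\<^sub>i \<otimes> h\<^sub>i\<close> the right-hand side of the first condition is \<open>\<Sum>\<^sub>j X \<rho>(a\<^sub>j) \<otimes> h\<^sub>j\<close>, rebracketed.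
\<close>

definition grouplike ::
  "'k ring \<Rightarrow> ('k, 'h) bialgebra \<Rightarrow> ('k, 'a, 'h) comod \<Rightarrow> ('a, 'h) tensor \<Rightarrow> bool"
  where "grouplike k H A X \<longleftrightarrow> X \<in> carrier (tensor_algebra k A H) \<and>
    tensor_map k A (tensor k H H) (\<lambda>a. a) (comult H) X =
      tensor_assoc k A H H
        (tensor_map k (tensor k A H) H (\<lambda>a. X \<otimes>\<^bsub>tensor_algebra k A H\<^esub> coact A a) (\<lambda>h. h) X) \<and>
    tensor_lift A (\<lambda>a h. counit H h \<odot>\<^bsub>A\<^esub> a) X = \<one>\<^bsub>A\<^esub>"

definition invertible_grouplikes ::
  "'k ring \<Rightarrow> ('k, 'h) bialgebra \<Rightarrow> ('k, 'a, 'h) comod \<Rightarrow> ('a, 'h) tensor monoid"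
  where "invertible_grouplikes k H A = (units_of (tensor_algebra k A H))
    \<lparr>carrier := {X \<in> Units (tensor_algebra k A H). grouplike k H A X}\<rparr>"

definition twist ::
  "'k ring \<Rightarrow> ('k, 'h) bialgebra \<Rightarrow> ('k, 'a, 'h) comod \<Rightarrow> ('a, 'h) tensor \<Rightarrow> ('a, 'a, 'h) comod"
  where "twist k H A X =
    with_coaction (regular_module A) (\<lambda>a. X \<otimes>\<^bsub>tensor_algebra k A H\<^esub> coact A a)"

definition unit_to_grouplike ::
  "'k ring \<Rightarrow> ('k, 'h) bialgebra \<Rightarrow> ('k, 'a, 'h) comod \<Rightarrow> 'a \<Rightarrow> ('a, 'h) tensor"
  where "unit_to_grouplike k H A a =
    pure_tensor k A H (inv\<^bsub>A\<^esub> a) \<one>\<^bsub>H\<^esub> \<otimes>\<^bsub>tensor_algebra k A H\<^esub> coact A a"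

definition grouplike_to_Pic ::
  "'k ring \<Rightarrow> ('k, 'h) bialgebra \<Rightarrow> ('k, 'a, 'h) comod \<Rightarrow> ('a, 'h) tensor \<Rightarrow> ('a, 'u, 'h) comod set"
  where "grouplike_to_Pic k H A X = relative_class k H A (twist k H A X)"

text \<open>
  Exactness at the middle group. The library's exact sequences require all groups to have elements
  of one type.
\<close>

definition exact_at ::
  "('a, 'x) monoid_scheme \<Rightarrow> ('a \<Rightarrow> 'b) \<Rightarrow> ('b, 'y) monoid_scheme \<Rightarrow> ('b \<Rightarrow> 'c) \<Rightarrow> ('c, 'z) monoid_scheme \<Rightarrow> bool"
  where "exact_at G f H g K \<longleftrightarrow> f \<in> hom G H \<and> g \<in> hom H K \<and> f ` carrier G = kernel H K g"

end

theory Submission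
  imports Defs
begin

text \<open>
  A bilinear map \<open>f : U \<times> V \<rightarrow> W\<close> of \<open>k\<close>-modules induces \<open>(U \<otimes> H) \<times> (V \<otimes> H) \<rightarrow> W \<otimes> H\<close> by means of the product
  of \<open>H\<close>. If \<open>f\<close> respects given maps \<open>\<rho>\<close>, \<open>\<sigma>\<close>, \<open>\<tau>\<close> of \<open>U\<close>, \<open>V\<close>, \<open>W\<close> into their tensor products with
  \<open>H\<close>, then coassociativity and counitality of \<open>\<rho>\<close> at \<open>u\<close> and of \<open>\<sigma>\<close> at \<open>v\<close> give those of \<open>\<tau>\<close> at \<open>f u v\<close>,
  because \<open>\<Delta>\<close> and \<open>\<epsilon>\<close> are multiplicative. This one principle makes \<open>M \<otimes>\<^sub>A N\<close> a relative Hopf module, makes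
  \<open>A\<^sup>X\<close> one for grouplike \<open>X\<close> (take \<open>u = 1\<close>, where the two conditions say that \<open>X\<close> is grouplike), and
  shows that products of grouplike elements are grouplike. Conversely, a relative Hopf module
  structure \<open>\<rho>\<close> on the module \<open>A\<close> satisfies \<open>\<rho> a = \<rho> 1 \<cdot> \<rho>\<^sub>A a\<close>, so it is the twist by the grouplike element
  \<open>\<rho> 1\<close>.

  An isomorphism \<open>A \<cong> A\<^sup>X\<close> is multiplication by a unit, and colinearity says \<open>X = d (v)\<close>. If the class of
  \<open>M\<close> goes to the trivial class, transport of structure gives \<open>M \<cong> A\<^sup>X\<close>, and an inverse \<open>N\<close> of \<open>M\<close> is then
  also isomorphic to some \<open>A\<^sup>Y\<close>; so \<open>A\<^sup>X\<^sup>Y \<cong> A\<close>, hence \<open>X Y = d (v)\<close> is invertible, and so is \<open>X\<close>.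
\<close>

section \<open>Tensor products\<close>

text \<open>Both Picard groups live on one universe \<open>'u\<close>, while M \<otimes> N lives on
  another type, so a product of classes is nonempty only if M \<otimes> N has a copy on
  \<open>'u\<close>. For invertible objects it has one: finitely many functionals separate the
  points of an invertible module and embed it into the lists over the ring. The group axioms are
  proved once for both groups, with the product as a relation that holds for every copy.

  The coaction of M \<otimes>_A N takes values in a module over k only, and a scalar a of A turns
  into multiplication by \<rho>(a). It is induced by a map that is A-balanced without being
  A-bilinear; hence the lifts into bare abelian groups next to the linear ones.

  Structures that ought to be equal, such as A and its regular module with scalars restricted to k,
  agree only on carriers. Congruence lemmas bridge this gap.

  That the inverse of an invertible grouplike X is grouplike is not an instance of the bilinear
  principle; it follows by cancelling (id \<otimes> \<Delta>)(X) in A \<otimes> H \<otimes>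
  H.\<close>

definition balanced_map ::
  "('r, 'x) ring_scheme \<Rightarrow> ('r, 'm, 'y) module_scheme \<Rightarrow> ('r, 'n, 'z) module_scheme \<Rightarrow>
   ('p, 'w) ring_scheme \<Rightarrow> ('m \<Rightarrow> 'n \<Rightarrow> 'p) \<Rightarrow> bool"
  where "balanced_map R M N P f \<longleftrightarrow>
    (\<forall>m \<in> carrier M. \<forall>n \<in> carrier N. f m n \<in> carrier P) \<and>
    (\<forall>m \<in> carrier M. \<forall>m' \<in> carrier M. \<forall>n \<in> carrier N. f (m \<oplus>\<^bsub>M\<^esub> m') n = f m n \<oplus>\<^bsub>P\<^esub> f m' n) \<and>
    (\<forall>m \<in> carrier M. \<forall>n \<in> carrier N. \<forall>n' \<in> carrier N. f m (n \<oplus>\<^bsub>N\<^esub> n') = f m n \<oplus>\<^bsub>P\<^esub> f m n') \<and>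
    (\<forall>r \<in> carrier R. \<forall>m \<in> carrier M. \<forall>n \<in> carrier N. f (r \<odot>\<^bsub>M\<^esub> m) n = f m (r \<odot>\<^bsub>N\<^esub> n))"

definition bilinear_map ::
  "('r, 'x) ring_scheme \<Rightarrow> ('r, 'm, 'y) module_scheme \<Rightarrow> ('r, 'n, 'z) module_scheme \<Rightarrow>
   ('r, 'p, 'w) module_scheme \<Rightarrow> ('m \<Rightarrow> 'n \<Rightarrow> 'p) \<Rightarrow> bool"
  where "bilinear_map R M N P f \<longleftrightarrow>
    (\<forall>m \<in> carrier M. \<forall>n \<in> carrier N. f m n \<in> carrier P) \<and>
    (\<forall>m \<in> carrier M. \<forall>m' \<in> carrier M. \<forall>n \<in> carrier N. f (m \<oplus>\<^bsub>M\<^esub> m') n = f m n \<oplus>\<^bsub>P\<^esub> f m' n) \<and>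
    (\<forall>m \<in> carrier M. \<forall>n \<in> carrier N. \<forall>n' \<in> carrier N. f m (n \<oplus>\<^bsub>N\<^esub> n') = f m n \<oplus>\<^bsub>P\<^esub> f m n') \<and>
    (\<forall>r \<in> carrier R. \<forall>m \<in> carrier M. \<forall>n \<in> carrier N. f (r \<odot>\<^bsub>M\<^esub> m) n = r \<odot>\<^bsub>P\<^esub> f m n) \<and>
    (\<forall>r \<in> carrier R. \<forall>m \<in> carrier M. \<forall>n \<in> carrier N. f m (r \<odot>\<^bsub>N\<^esub> n) = r \<odot>\<^bsub>P\<^esub> f m n)"

lemma balanced_mapD:
  assumes "balanced_map R M N P f"
  shows "\<And>m n. m \<in> carrier M \<Longrightarrow> n \<in> carrier N \<Longrightarrow> f m n \<in> carrier P"
    and "\<And>m m' n. m \<in> carrier M \<Longrightarrow> m' \<in> carrier M \<Longrightarrow> n \<in> carrier N \<Longrightarrow>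
      f (m \<oplus>\<^bsub>M\<^esub> m') n = f m n \<oplus>\<^bsub>P\<^esub> f m' n"
    and "\<And>m n n'. m \<in> carrier M \<Longrightarrow> n \<in> carrier N \<Longrightarrow> n' \<in> carrier N \<Longrightarrow>
      f m (n \<oplus>\<^bsub>N\<^esub> n') = f m n \<oplus>\<^bsub>P\<^esub> f m n'"
    and "\<And>r m n. r \<in> carrier R \<Longrightarrow> m \<in> carrier M \<Longrightarrow> n \<in> carrier N \<Longrightarrow>
      f (r \<odot>\<^bsub>M\<^esub> m) n = f m (r \<odot>\<^bsub>N\<^esub> n)"
  using assms unfolding balanced_map_def by blast+

lemma bilinear_mapD:
  assumes "bilinear_map R M N P f"
  shows "\<And>m n. m \<in> carrier M \<Longrightarrow> n \<in> carrier N \<Longrightarrow> f m n \<in> carrier P"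
    and "\<And>m m' n. m \<in> carrier M \<Longrightarrow> m' \<in> carrier M \<Longrightarrow> n \<in> carrier N \<Longrightarrow>
      f (m \<oplus>\<^bsub>M\<^esub> m') n = f m n \<oplus>\<^bsub>P\<^esub> f m' n"
    and "\<And>m n n'. m \<in> carrier M \<Longrightarrow> n \<in> carrier N \<Longrightarrow> n' \<in> carrier N \<Longrightarrow>
      f m (n \<oplus>\<^bsub>N\<^esub> n') = f m n \<oplus>\<^bsub>P\<^esub> f m n'"
    and "\<And>r m n. r \<in> carrier R \<Longrightarrow> m \<in> carrier M \<Longrightarrow> n \<in> carrier N \<Longrightarrow>
      f (r \<odot>\<^bsub>M\<^esub> m) n = r \<odot>\<^bsub>P\<^esub> f m n"
    and "\<And>r m n. r \<in> carrier R \<Longrightarrow> m \<in> carrier M \<Longrightarrow> n \<in> carrier N \<Longrightarrow>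
      f m (r \<odot>\<^bsub>N\<^esub> n) = r \<odot>\<^bsub>P\<^esub> f m n"
  using assms unfolding bilinear_map_def by blast+

lemma bilinear_map_imp_balanced: "bilinear_map R M N P f \<Longrightarrow> balanced_map R M N P f"
  unfolding bilinear_map_def balanced_map_def by simp

lemma module_homD:
  assumes "f \<in> module_hom R M N"
  shows "\<And>x. x \<in> carrier M \<Longrightarrow> f x \<in> carrier N"
    and "\<And>x y. x \<in> carrier M \<Longrightarrow> y \<in> carrier M \<Longrightarrow> f (x \<oplus>\<^bsub>M\<^esub> y) = f x \<oplus>\<^bsub>N\<^esub> f y"
    and "\<And>r x. r \<in> carrier R \<Longrightarrow> x \<in> carrier M \<Longrightarrow> f (r \<odot>\<^bsub>M\<^esub> x) = r \<odot>\<^bsub>N\<^esub> f x"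
  using assms unfolding module_hom_def by auto

lemma module_homI:
  assumes "\<And>x. x \<in> carrier M \<Longrightarrow> f x \<in> carrier N"
    and "\<And>x y. x \<in> carrier M \<Longrightarrow> y \<in> carrier M \<Longrightarrow> f (x \<oplus>\<^bsub>M\<^esub> y) = f x \<oplus>\<^bsub>N\<^esub> f y"
    and "\<And>r x. r \<in> carrier R \<Longrightarrow> x \<in> carrier M \<Longrightarrow> f (r \<odot>\<^bsub>M\<^esub> x) = r \<odot>\<^bsub>N\<^esub> f x"
  shows "f \<in> module_hom R M N"
  using assms unfolding module_hom_def by auto

lemma module_hom_id: "(\<lambda>x. x) \<in> module_hom R M M"
  by (auto intro: module_homI)

lemma module_hom_comp:
  "f \<in> module_hom R M N \<Longrightarrow> g \<in> module_hom R N P \<Longrightarrow> (\<lambda>x. g (f x)) \<in> module_hom R M P"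
  by (rule module_homI) (simp_all add: module_homD)

lemma module_imp_abelian_group: "module R M \<Longrightarrow> abelian_group M"
  by (rule module.axioms(2))

lemma comm_group_add_monoid: "abelian_group P \<Longrightarrow> comm_group (add_monoid P)"
  by (rule abelian_group.a_comm_group)

section \<open>Module structure and universal property of the tensor product\<close>

definition tensor_group ::
  "('r, 'x) ring_scheme \<Rightarrow> ('r, 'm, 'y) module_scheme \<Rightarrow> ('r, 'n, 'z) module_scheme \<Rightarrow>
   ('m, 'n) tensor monoid"
  where "tensor_group R M N = tensor_free M N Mod tensor_kernel R M N"

text \<open>The additive record \<open>tensor\<close> hides a multiplicative quotient group.
  Unfolding to \<open>tensor_group\<close> makes the facts about quotients and homomorphisms of
  groups applicable.\<close>

lemma tensor_simps:
  "carrier (tensor R M N) = carrier (tensor_group R M N)"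
  "x \<oplus>\<^bsub>tensor R M N\<^esub> y = x \<otimes>\<^bsub>tensor_group R M N\<^esub> y"
  "\<zero>\<^bsub>tensor R M N\<^esub> = \<one>\<^bsub>tensor_group R M N\<^esub>"
  "r \<odot>\<^bsub>tensor R M N\<^esub> x =
    lift_to_group (tensor_group R M N) (\<lambda>m n. pure_tensor R M N (r \<odot>\<^bsub>M\<^esub> m) n) x"
  by (simp_all add: tensor_def tensor_group_def Let_def)

context
  fixes G :: "('p, 'x) monoid_scheme" and f :: "'c \<Rightarrow> 'p" and S :: "'c set"
  assumes G: "comm_group G" and f: "\<And>z. z \<in> S \<Longrightarrow> f z \<in> carrier G"
begin

interpretation comm_group G by (rule G)

text \<open>Cancellation can make the support of p + q smaller than the union of the two supports,
  so products over supports cannot be multiplied directly. Over a common finite set \<open>K\<close>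
  the additional factors have exponent 0 and are trivial.\<close>

lemma frag_extend_superset:
  fixes p :: "'c \<Rightarrow>\<^sub>0 int"
  assumes "Poly_Mapping.keys p \<subseteq> K" "K \<subseteq> S" "finite K"
  shows "(\<Otimes>\<^bsub>G\<^esub> z \<in> Poly_Mapping.keys p. f z [^]\<^bsub>G\<^esub> Poly_Mapping.lookup p z) =
    (\<Otimes>\<^bsub>G\<^esub> z \<in> K. f z [^]\<^bsub>G\<^esub> Poly_Mapping.lookup p z)"
  by (rule finprod_mono_neutral_cong_left)
    (use assms f in \<open>auto simp: in_keys_iff subset_iff Pi_iff\<close>)

lemma frag_extend_hom:
  "(\<lambda>p. \<Otimes>\<^bsub>G\<^esub> z \<in> Poly_Mapping.keys p. f z [^]\<^bsub>G\<^esub> Poly_Mapping.lookup p z)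
    \<in> hom (free_Abelian_group S) G"
proof (rule homI)
  fix p assume "p \<in> carrier (free_Abelian_group S)"
  then show "(\<Otimes>\<^bsub>G\<^esub> z \<in> Poly_Mapping.keys p. f z [^]\<^bsub>G\<^esub> Poly_Mapping.lookup p z) \<in> carrier G"
    using f by (auto intro!: finprod_closed)
next
  fix p q assume pq: "p \<in> carrier (free_Abelian_group S)" "q \<in> carrier (free_Abelian_group S)"
  define K where "K = Poly_Mapping.keys p \<union> Poly_Mapping.keys q"
  have K: "K \<subseteq> S" "finite K" using pq by (auto simp: K_def)
  have "Poly_Mapping.keys (p + q) \<subseteq> K" using keys_add[of p q] by (simp add: K_def)
  moreover have "Poly_Mapping.keys p \<subseteq> K" "Poly_Mapping.keys q \<subseteq> K" by (auto simp: K_def)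
  moreover have Pi: "(\<lambda>z. f z [^]\<^bsub>G\<^esub> Poly_Mapping.lookup p z) \<in> K \<rightarrow> carrier G"
    "(\<lambda>z. f z [^]\<^bsub>G\<^esub> Poly_Mapping.lookup q z) \<in> K \<rightarrow> carrier G"
    using K f by auto
  moreover have "(\<Otimes>\<^bsub>G\<^esub> z \<in> K. f z [^]\<^bsub>G\<^esub> Poly_Mapping.lookup (p + q) z) =
      (\<Otimes>\<^bsub>G\<^esub> z \<in> K. f z [^]\<^bsub>G\<^esub> Poly_Mapping.lookup p z \<otimes>\<^bsub>G\<^esub> f z [^]\<^bsub>G\<^esub> Poly_Mapping.lookup q z)"
    using K f Pi by (intro finprod_cong') (auto simp: lookup_add int_pow_mult subset_iff)
  ultimately show "(\<Otimes>\<^bsub>G\<^esub> z \<in> Poly_Mapping.keys (p \<otimes>\<^bsub>free_Abelian_group S\<^esub> q).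
        f z [^]\<^bsub>G\<^esub> Poly_Mapping.lookup (p \<otimes>\<^bsub>free_Abelian_group S\<^esub> q) z) =
      (\<Otimes>\<^bsub>G\<^esub> z \<in> Poly_Mapping.keys p. f z [^]\<^bsub>G\<^esub> Poly_Mapping.lookup p z) \<otimes>\<^bsub>G\<^esub>
      (\<Otimes>\<^bsub>G\<^esub> z \<in> Poly_Mapping.keys q. f z [^]\<^bsub>G\<^esub> Poly_Mapping.lookup q z)"
    using K by (simp add: frag_extend_superset[of _ K])
qed

lemma frag_extend_frag_of:
  "z \<in> S \<Longrightarrow> (\<Otimes>\<^bsub>G\<^esub> y \<in> Poly_Mapping.keys (frag_of z).
    f y [^]\<^bsub>G\<^esub> Poly_Mapping.lookup (frag_of z) y) = f z"
  using f[of z] by (simp add: int_pow_1)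

end

context
  fixes R :: "('r, 'x) ring_scheme" and M :: "('r, 'm, 'y) module_scheme"
    and N :: "('r, 'n, 'z) module_scheme"
  assumes M: "module R M" and N: "module R N"
begin

private abbreviation T where "T \<equiv> tensor R M N"
private abbreviation TG where "TG \<equiv> tensor_group R M N"
private abbreviation F where "F \<equiv> tensor_free M N"
private abbreviation K where "K \<equiv> tensor_kernel R M N"
private abbreviation pure where "pure \<equiv> pure_tensor R M N"

interpretation M: module R M by (rule M)
interpretation N: module R N by (rule N)

private lemma comm_group_free: "comm_group F"
  unfolding tensor_free_def by (rule abelian_free_Abelian_group)

interpretation F: comm_group F by (rule comm_group_free)

private lemma mem_free: "p \<in> carrier F \<longleftrightarrow>
    Poly_Mapping.keys p \<subseteq> carrier M \<times> carrier N"
  by (simp add: tensor_free_def)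

private lemma frag_of_mem:
  "m \<in> carrier M \<Longrightarrow> n \<in> carrier N \<Longrightarrow> frag_of (m, n) \<in> carrier F"
  by (simp add: mem_free)

private lemma diff_mem:
  "p \<in> carrier F \<Longrightarrow> q \<in> carrier F \<Longrightarrow>
    p - q \<in> carrier F"
  using keys_diff[of p q] by (auto simp: mem_free)

private lemma relations_subset: "tensor_relations R M N \<subseteq> carrier F"
  unfolding tensor_relations_def
  by (auto simp del: carrier_free_Abelian_group_iff intro!: diff_mem frag_of_mem)

private lemma subgroup_kernel: "subgroup (K) F"
  unfolding tensor_kernel_def by (rule F.generate_is_subgroup[OF relations_subset])

private lemma normal_kernel: "K \<lhd> F"
  by (rule F.subgroup_imp_normal[OF subgroup_kernel])

interpretation K: normal K F
  by (rule normal_kernel)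

private abbreviation (input) cls where
  "cls p \<equiv> K #>\<^bsub>F\<^esub> p"

private lemma comm_group_T: "comm_group TG"
  unfolding tensor_group_def by (rule F.abelian_FactGroup[OF subgroup_kernel])

interpretation T: comm_group TG by (rule comm_group_T)

private lemma cls_mult: "p \<in> carrier F \<Longrightarrow> q \<in> carrier F \<Longrightarrow>
    cls p \<otimes>\<^bsub>TG\<^esub> cls q = cls (p + q)"
  using K.rcos_sum[of p q] by (simp add: tensor_group_def tensor_free_def)

private lemma carrier_T: "carrier TG = cls ` carrier F"
  by (simp add: tensor_group_def carrier_FactGroup)

private lemma cls_one: "p \<in> K \<Longrightarrow> cls p = \<one>\<^bsub>TG\<^esub>"
  by (metis F.coset_join2 one_FactGroup subgroup_kernel subgroup.mem_carrier tensor_group_def)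

private lemma diff_eq: "p \<in> carrier F \<Longrightarrow> q \<in> carrier F \<Longrightarrow>
    p - q \<in> K \<Longrightarrow> cls p = cls q"
proof -
  assume p: "p \<in> carrier F" and q: "q \<in> carrier F"
    and d: "p - q \<in> K"
  have "cls p = cls (p - q) \<otimes>\<^bsub>TG\<^esub> cls q"
    using cls_mult[OF diff_mem[OF p q] q] by simp
  also have "\<dots> = cls q" using cls_one[OF d] q by (simp add: carrier_T)
  finally show ?thesis .
qed

lemma pure_tensor_closed:
  "m \<in> carrier M \<Longrightarrow> n \<in> carrier N \<Longrightarrow> pure m n \<in> carrier T"
  unfolding pure_tensor_def tensor_simps carrier_T using frag_of_mem by blast

lemma pure_tensor_add_left:
  assumes "m \<in> carrier M" "m' \<in> carrier M" "n \<in> carrier N"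
  shows "pure (m \<oplus>\<^bsub>M\<^esub> m') n =
    pure m n \<oplus>\<^bsub>T\<^esub> pure m' n"
proof -
  have "frag_of (m \<oplus>\<^bsub>M\<^esub> m', n) - (frag_of (m, n) + frag_of (m', n)) \<in> tensor_relations R M N"
    using assms unfolding tensor_relations_def by (auto simp: diff_diff_eq[symmetric])
  then have "frag_of (m \<oplus>\<^bsub>M\<^esub> m', n) - (frag_of (m, n) + frag_of (m', n)) \<in> K"
    unfolding tensor_kernel_def by (rule generate.incl)
  then have "cls (frag_of (m \<oplus>\<^bsub>M\<^esub> m', n)) = cls (frag_of (m, n) + frag_of (m', n))"
    using assms F.m_closed[OF frag_of_mem frag_of_mem]
    by (intro diff_eq) (auto simp: frag_of_mem tensor_free_def simp del: carrier_free_Abelian_group_iff)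
  then show ?thesis
    using assms by (simp add: pure_tensor_def tensor_simps cls_mult frag_of_mem)
qed

lemma pure_tensor_add_right:
  assumes "m \<in> carrier M" "n \<in> carrier N" "n' \<in> carrier N"
  shows "pure m (n \<oplus>\<^bsub>N\<^esub> n') =
    pure m n \<oplus>\<^bsub>T\<^esub> pure m n'"
proof -
  have "frag_of (m, n \<oplus>\<^bsub>N\<^esub> n') - (frag_of (m, n) + frag_of (m, n')) \<in> tensor_relations R M N"
    using assms unfolding tensor_relations_def by (auto simp: diff_diff_eq[symmetric])
  then have "frag_of (m, n \<oplus>\<^bsub>N\<^esub> n') - (frag_of (m, n) + frag_of (m, n')) \<in> K"
    unfolding tensor_kernel_def by (rule generate.incl)
  then have "cls (frag_of (m, n \<oplus>\<^bsub>N\<^esub> n')) = cls (frag_of (m, n) + frag_of (m, n'))"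
    using assms F.m_closed[OF frag_of_mem frag_of_mem]
    by (intro diff_eq) (auto simp: frag_of_mem tensor_free_def simp del: carrier_free_Abelian_group_iff)
  then show ?thesis
    using assms by (simp add: pure_tensor_def tensor_simps cls_mult frag_of_mem)
qed

lemma pure_tensor_balanced:
  assumes "r \<in> carrier R" "m \<in> carrier M" "n \<in> carrier N"
  shows "pure (r \<odot>\<^bsub>M\<^esub> m) n = pure m (r \<odot>\<^bsub>N\<^esub> n)"
proof -
  have "frag_of (r \<odot>\<^bsub>M\<^esub> m, n) - frag_of (m, r \<odot>\<^bsub>N\<^esub> n) \<in> tensor_relations R M N"
    using assms unfolding tensor_relations_def by blast
  then have "frag_of (r \<odot>\<^bsub>M\<^esub> m, n) - frag_of (m, r \<odot>\<^bsub>N\<^esub> n) \<in> K"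
    unfolding tensor_kernel_def by (rule generate.incl)
  then show ?thesis
    using assms unfolding pure_tensor_def by (intro diff_eq) (auto simp: frag_of_mem)
qed

lemma abelian_group_tensor: "abelian_group T"
proof (rule abelian_groupI)
  fix x assume "x \<in> carrier T"
  then show "\<exists>y \<in> carrier T. y \<oplus>\<^bsub>T\<^esub> x = \<zero>\<^bsub>T\<^esub>"
    unfolding tensor_simps using T.l_inv_ex by blast
next
  fix x y assume "x \<in> carrier T" "y \<in> carrier T"
  then show "x \<oplus>\<^bsub>T\<^esub> y = y \<oplus>\<^bsub>T\<^esub> x"
    unfolding tensor_simps by (rule T.m_comm)
qed (simp_all add: tensor_simps T.m_assoc)

interpretation TA: abelian_group T by (rule abelian_group_tensor)

text \<open>This is why every tensor is a sum of pure tensors without signs, and why the induction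
  rule has no case for negatives.\<close>

private lemma pure_neg:
  assumes "m \<in> carrier M" "n \<in> carrier N"
  shows "\<ominus>\<^bsub>T\<^esub> pure m n = pure (\<ominus>\<^bsub>M\<^esub> m) n"
proof -
  have z: "pure \<zero>\<^bsub>M\<^esub> n = \<zero>\<^bsub>T\<^esub>"
    using pure_tensor_add_left[of "\<zero>\<^bsub>M\<^esub>" "\<zero>\<^bsub>M\<^esub>" n] pure_tensor_closed[of "\<zero>\<^bsub>M\<^esub>" n] assms
    by (metis M.M.l_zero M.M.zero_closed TA.add.l_cancel_one')
  have "pure (\<ominus>\<^bsub>M\<^esub> m) n \<oplus>\<^bsub>T\<^esub> pure m n = \<zero>\<^bsub>T\<^esub>"
    using assms z by (simp add: pure_tensor_add_left[symmetric] M.M.l_neg)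
  then show ?thesis
    using assms by (intro TA.minus_equality) (auto intro: pure_tensor_closed)
qed

private lemma tensor_induct_aux [consumes 1, case_names pure add]:
  assumes x: "x \<in> carrier T"
    and pure: "\<And>m n. m \<in> carrier M \<Longrightarrow> n \<in> carrier N \<Longrightarrow> P (pure m n)"
    and add: "\<And>x y. x \<in> carrier T \<Longrightarrow> y \<in> carrier T \<Longrightarrow>
      P x \<Longrightarrow> P y \<Longrightarrow> P (x \<oplus>\<^bsub>T\<^esub> y)"
  shows "P x"
proof -
  \<comment> \<open>Induction on the free abelian group passes through differences, so the property
    is carried along for the negative as well. Zero is reached as a pure tensor minus
    itself.\<close>
  define Q where "Q y \<longleftrightarrow> y \<in> carrier T \<and> P y \<and> P (\<ominus>\<^bsub>T\<^esub> y)" for y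
  have Qpure: "Q (pure m n)" if "m \<in> carrier M" "n \<in> carrier N" for m n
    unfolding Q_def using that by (auto simp: pure_neg intro: pure_tensor_closed pure)
  have Qadd: "Q (y \<oplus>\<^bsub>T\<^esub> z)" if "Q y" "Q z" for y z
    using that unfolding Q_def by (auto simp: TA.minus_add intro!: add)
  have Qneg: "Q (\<ominus>\<^bsub>T\<^esub> y)" if "Q y" for y
    using that unfolding Q_def by auto
  have Q0: "Q \<zero>\<^bsub>T\<^esub>"
    using Qadd[OF Qpure Qneg[OF Qpure], of "\<zero>\<^bsub>M\<^esub>" "\<zero>\<^bsub>N\<^esub>" "\<zero>\<^bsub>M\<^esub>" "\<zero>\<^bsub>N\<^esub>"]
    by (simp add: TA.r_neg pure_tensor_closed)
  from x obtain p where p: "Poly_Mapping.keys p \<subseteq> carrier M \<times> carrier N" and xp: "x = cls p"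
    by (auto simp: tensor_simps carrier_T mem_free)
  from p have "Q (cls p)"
  proof (induction p rule: free_Abelian_group_induct[consumes 1, case_names zero diff one])
    case zero
    have "cls 0 = \<zero>\<^bsub>T\<^esub>"
      using cls_one[of 0] subgroup.one_closed[OF subgroup_kernel]
      by (simp add: tensor_simps tensor_free_def)
    then show ?case using Q0 by simp
  next
    case (diff p q)
    then have pq: "p \<in> carrier F" "q \<in> carrier F"
      by (simp_all add: mem_free)
    have "cls (p - q) \<oplus>\<^bsub>T\<^esub> cls q = cls p"
      using cls_mult[OF diff_mem[OF pq] pq(2)] by (simp add: tensor_simps)
    moreover have "cls (p - q) \<in> carrier T"
      using diff_mem[OF pq] by (simp add: tensor_simps carrier_T)
    moreover have "cls q \<in> carrier T"
      using pq by (simp add: tensor_simps carrier_T)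
    ultimately have "cls (p - q) = cls p \<oplus>\<^bsub>T\<^esub> (\<ominus>\<^bsub>T\<^esub> cls q)"
      by (metis TA.a_assoc TA.a_inv_closed TA.r_neg TA.r_zero)
    then show ?case using Qadd Qneg diff by simp
  next
    case (one a)
    then show ?case using Qpure by (auto simp: pure_tensor_def)
  qed
  then show ?thesis by (simp add: Q_def xp)
qed

text \<open>The extension of \<open>f\<close> to the free abelian group kills the relations, hence
  the subgroup they generate, hence is constant on each coset; so the \<open>the_elem\<close> inside
  \<open>lift_to_group\<close> picks a genuine value. The target is a bare commutative group because
  scalar multiplication on the tensor product, not yet known to be a module, is itself such a
  lift.\<close>

private lemma lift_to_group_aux:
  fixes G :: "('p, 'w) monoid_scheme"
  assumes G: "comm_group G"
    and f: "\<And>m n. m \<in> carrier M \<Longrightarrow> n \<in> carrier N \<Longrightarrow> f m n \<in> carrier G"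
    and fl: "\<And>m m' n. m \<in> carrier M \<Longrightarrow> m' \<in> carrier M \<Longrightarrow> n \<in> carrier N \<Longrightarrow>
      f (m \<oplus>\<^bsub>M\<^esub> m') n = f m n \<otimes>\<^bsub>G\<^esub> f m' n"
    and fr: "\<And>m n n'. m \<in> carrier M \<Longrightarrow> n \<in> carrier N \<Longrightarrow> n' \<in> carrier N \<Longrightarrow>
      f m (n \<oplus>\<^bsub>N\<^esub> n') = f m n \<otimes>\<^bsub>G\<^esub> f m n'"
    and fb: "\<And>r m n. r \<in> carrier R \<Longrightarrow> m \<in> carrier M \<Longrightarrow> n \<in> carrier N \<Longrightarrow>
      f (r \<odot>\<^bsub>M\<^esub> m) n = f m (r \<odot>\<^bsub>N\<^esub> n)"
  shows "lift_to_group G f \<in> hom TG G"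
    and "m \<in> carrier M \<Longrightarrow> n \<in> carrier N \<Longrightarrow> lift_to_group G f (pure m n) = f m n"
proof -
  interpret G: comm_group G by (rule G)
  define h :: "('m \<times> 'n \<Rightarrow>\<^sub>0 int) \<Rightarrow> 'p" where "h p = (\<Otimes>\<^bsub>G\<^esub> z \<in> Poly_Mapping.keys p.
    f (fst z) (snd z) [^]\<^bsub>G\<^esub> Poly_Mapping.lookup p z)" for p
  have fS: "f (fst z) (snd z) \<in> carrier G" if "z \<in> carrier M \<times> carrier N" for z
    using that f by auto
  have h_hom: "h \<in> hom F G"
    using frag_extend_hom[of G "carrier M \<times> carrier N" "\<lambda>z. f (fst z) (snd z)", OF G fS]
    unfolding tensor_free_def h_def by simp
  have h_frag: "h (frag_of (m, n)) = f m n" if "m \<in> carrier M" "n \<in> carrier N" for m n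
    using frag_extend_frag_of[of G "carrier M \<times> carrier N" "\<lambda>z. f (fst z) (snd z)" "(m, n)", OF G fS] that
    unfolding h_def by simp
  interpret h: group_hom F G h
    by unfold_locales (rule h_hom)
  have h_add: "h (p + q) = h p \<otimes>\<^bsub>G\<^esub> h q"
    if "p \<in> carrier F" "q \<in> carrier F" for p q
    using h.hom_mult[OF that] by (simp add: tensor_free_def)
  have h_diff: "h (p - q) \<otimes>\<^bsub>G\<^esub> h q = h p"
    if "p \<in> carrier F" "q \<in> carrier F" for p q
    using h_add[OF diff_mem[OF that] that(2)] by simp
  have h_diff_one: "h (p - q) = \<one>\<^bsub>G\<^esub>"
    if "p \<in> carrier F" "q \<in> carrier F" "h p = h q" for p q
    using h_diff[OF that(1,2)] that diff_mem[OF that(1,2)] by (simp add: G.r_cancel_one)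
  have fc: "p + q \<in> carrier F"
    if "p \<in> carrier F" "q \<in> carrier F" for p q
    using F.m_closed[OF that] by (simp add: tensor_free_def)
  \<comment> \<open>Additivity in each variable and balancedness enter here, one for each of the
    three families of relations.\<close>
  have "tensor_relations R M N \<subseteq> kernel F G h"
  proof
    fix p assume p: "p \<in> tensor_relations R M N"
    then have pc: "p \<in> carrier F" using relations_subset by blast
    from p have "h p = \<one>\<^bsub>G\<^esub>"
      unfolding tensor_relations_def
      by (auto simp: diff_diff_eq h_add h_frag fl fr fb frag_of_mem fc intro!: h_diff_one)
    with pc show "p \<in> kernel F G h" by (simp add: kernel_def)
  qed
  then have ker: "K \<subseteq> kernel F G h"
    unfolding tensor_kernel_def by (rule F.generate_subgroup_incl[OF _ h.subgroup_kernel])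
  have lift: "lift_to_group G f (cls p) = h p" if p: "p \<in> carrier F" for p
  proof -
    have "h q = h p" if q: "q \<in> cls p" for q
    proof -
      obtain k where "k \<in> K" "q = k + p"
        using q by (auto simp: r_coset_def tensor_free_def)
      moreover have "k \<in> carrier F" "h k = \<one>\<^bsub>G\<^esub>"
        using \<open>k \<in> _\<close> ker by (auto simp: kernel_def)
      ultimately show ?thesis using p by (simp add: h_add)
    qed
    moreover have "p \<in> cls p" using p subgroup_kernel by (rule F.rcos_self)
    ultimately have "h ` cls p = {h p}" by blast
    then show ?thesis unfolding lift_to_group_def h_def[symmetric] by simp
  qed
  show "lift_to_group G f (pure m n) = f m n" if "m \<in> carrier M" "n \<in> carrier N"
    using that by (simp add: pure_tensor_def lift frag_of_mem h_frag)
  show "lift_to_group G f \<in> hom TG G"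
    by (rule homI) (auto simp: carrier_T lift cls_mult fc h_add)
qed

private lemma smult_pure_aux:
  assumes r: "r \<in> carrier R"
  shows "\<And>x. x \<in> carrier T \<Longrightarrow> r \<odot>\<^bsub>T\<^esub> x \<in> carrier T"
    "\<And>x y. x \<in> carrier T \<Longrightarrow> y \<in> carrier T \<Longrightarrow>
      r \<odot>\<^bsub>T\<^esub> (x \<oplus>\<^bsub>T\<^esub> y) =
      r \<odot>\<^bsub>T\<^esub> x \<oplus>\<^bsub>T\<^esub> r \<odot>\<^bsub>T\<^esub> y"
    "\<And>m n. m \<in> carrier M \<Longrightarrow> n \<in> carrier N \<Longrightarrow>
      r \<odot>\<^bsub>T\<^esub> pure m n = pure (r \<odot>\<^bsub>M\<^esub> m) n"
proof -
  \<comment> \<open>By commutativity of \<open>R\<close>, which makes (m, n) \<mapsto> (r m)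
    \<otimes> n balanced.\<close>
  have *: "r \<odot>\<^bsub>M\<^esub> (s \<odot>\<^bsub>M\<^esub> m) = s \<odot>\<^bsub>M\<^esub> (r \<odot>\<^bsub>M\<^esub> m)" if "s \<in> carrier R" "m \<in> carrier M" for s m
    using that r by (metis M.R.m_comm M.smult_assoc1)
  note aux = lift_to_group_aux[OF comm_group_T,
      where f = "\<lambda>m n. pure (r \<odot>\<^bsub>M\<^esub> m) n"]
  have "(\<lambda>x. r \<odot>\<^bsub>T\<^esub> x) \<in> hom TG TG"
    unfolding tensor_simps(4)
    by (rule aux(1)) (simp_all add: r pure_tensor_closed M.smult_r_distr pure_tensor_add_left
        pure_tensor_add_right pure_tensor_balanced * flip: tensor_simps(1,2))
  then show
    "\<And>x. x \<in> carrier T \<Longrightarrow> r \<odot>\<^bsub>T\<^esub> x \<in> carrier T"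
    "\<And>x y. x \<in> carrier T \<Longrightarrow> y \<in> carrier T \<Longrightarrow>
      r \<odot>\<^bsub>T\<^esub> (x \<oplus>\<^bsub>T\<^esub> y) =
      r \<odot>\<^bsub>T\<^esub> x \<oplus>\<^bsub>T\<^esub> r \<odot>\<^bsub>T\<^esub> y"
    by (auto simp: tensor_simps(1,2) hom_def)
  show "\<And>m n. m \<in> carrier M \<Longrightarrow> n \<in> carrier N \<Longrightarrow>
      r \<odot>\<^bsub>T\<^esub> pure m n = pure (r \<odot>\<^bsub>M\<^esub> m) n"
    unfolding tensor_simps(4)
    by (rule aux(2)) (simp_all add: r pure_tensor_closed M.smult_r_distr pure_tensor_add_left
        pure_tensor_add_right pure_tensor_balanced * flip: tensor_simps(1,2))
qed

lemma smult_pure_tensor: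
  assumes "r \<in> carrier R" "m \<in> carrier M" "n \<in> carrier N"
  shows "r \<odot>\<^bsub>T\<^esub> pure m n = pure (r \<odot>\<^bsub>M\<^esub> m) n"
  using assms by (rule smult_pure_aux(3))

lemma module_tensor: "module R T"
proof (rule moduleI[OF _ abelian_group_tensor])
  show "cring R" by (rule M.R.is_cring)
  note s = smult_pure_aux
  fix a x assume a: "a \<in> carrier R" and x: "x \<in> carrier T"
  show "a \<odot>\<^bsub>T\<^esub> x \<in> carrier T" using a x by (rule s(1))
  show "\<And>y. y \<in> carrier T \<Longrightarrow> a \<odot>\<^bsub>T\<^esub> (x \<oplus>\<^bsub>T\<^esub> y) =
      a \<odot>\<^bsub>T\<^esub> x \<oplus>\<^bsub>T\<^esub> a \<odot>\<^bsub>T\<^esub> y"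
    using a x by (rule s(2))
  fix b assume b: "b \<in> carrier R"
  show "(a \<oplus>\<^bsub>R\<^esub> b) \<odot>\<^bsub>T\<^esub> x = a \<odot>\<^bsub>T\<^esub> x \<oplus>\<^bsub>T\<^esub> b \<odot>\<^bsub>T\<^esub> x"
    using x by (induction x rule: tensor_induct_aux)
      (use a b in \<open>simp_all add: s M.smult_l_distr pure_tensor_add_left TA.a_ac\<close>)
  show "(a \<otimes>\<^bsub>R\<^esub> b) \<odot>\<^bsub>T\<^esub> x = a \<odot>\<^bsub>T\<^esub> (b \<odot>\<^bsub>T\<^esub> x)"
    using x by (induction x rule: tensor_induct_aux)
      (use a b in \<open>simp_all add: s M.smult_assoc1\<close>)
next
  fix x assume "x \<in> carrier T"
  then show "\<one>\<^bsub>R\<^esub> \<odot>\<^bsub>T\<^esub> x = x"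
    by (induction x rule: tensor_induct_aux) (simp_all add: smult_pure_aux)
qed

lemma bilinear_pure_tensor: "bilinear_map R M N T (pure)"
  unfolding bilinear_map_def
  by (auto simp: smult_pure_tensor pure_tensor_closed pure_tensor_add_left
      pure_tensor_add_right simp flip: pure_tensor_balanced)

context
  fixes P :: "('p, 'w) ring_scheme" and f
  assumes P: "abelian_group P" and f: "balanced_map R M N P f"
begin

private lemma tensor_lift_aux:
  shows "tensor_lift P f \<in> hom TG (add_monoid P)"
    and "m \<in> carrier M \<Longrightarrow> n \<in> carrier N \<Longrightarrow> tensor_lift P f (pure m n) = f m n"
  unfolding tensor_lift_def
  by (rule lift_to_group_aux[OF comm_group_add_monoid[OF P]];
      use balanced_mapD[OF f] in simp)+

lemma tensor_lift_pure:
  "m \<in> carrier M \<Longrightarrow> n \<in> carrier N \<Longrightarrow> tensor_lift P f (pure m n) = f m n"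
  by (rule tensor_lift_aux(2))

lemma tensor_lift_closed:
  "x \<in> carrier T \<Longrightarrow> tensor_lift P f x \<in> carrier P"
  using tensor_lift_aux(1) by (simp add: hom_def tensor_simps Pi_iff)

lemma tensor_lift_add:
  "x \<in> carrier T \<Longrightarrow> y \<in> carrier T \<Longrightarrow>
    tensor_lift P f (x \<oplus>\<^bsub>T\<^esub> y) = tensor_lift P f x \<oplus>\<^bsub>P\<^esub> tensor_lift P f y"
  using tensor_lift_aux(1) by (simp add: hom_def tensor_simps)

end

lemmas tensor_induct_modules = tensor_induct_aux

end

lemma tensor_induct [consumes 3, case_names pure add]:
  assumes "module R M" "module R N" "x \<in> carrier (tensor R M N)"
    and "\<And>m n. m \<in> carrier M \<Longrightarrow> n \<in> carrier N \<Longrightarrow> P (pure_tensor R M N m n)"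
    and "\<And>x y. x \<in> carrier (tensor R M N) \<Longrightarrow> y \<in> carrier (tensor R M N) \<Longrightarrow>
      P x \<Longrightarrow> P y \<Longrightarrow> P (x \<oplus>\<^bsub>tensor R M N\<^esub> y)"
  shows "P x"
  using tensor_induct_modules[OF assms(1,2,3)] assms(4,5) by blast

lemma tensor_lift_linear:
  assumes M: "module R M" and N: "module R N" and P: "module R P" and f: "bilinear_map R M N P f"
  shows "tensor_lift P f \<in> module_hom R (tensor R M N) P"
proof -
  interpret T: module R "tensor R M N" by (rule module_tensor[OF M N])
  interpret M: module R M by (rule M)
  interpret P: module R P by (rule P)
  have b: "balanced_map R M N P f" by (rule bilinear_map_imp_balanced[OF f])
  note P' = module_imp_abelian_group[OF P]
  note lift = tensor_lift_pure[OF M N P' b] tensor_lift_closed[OF M N P' b] tensor_lift_add[OF M N P' b]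
  show ?thesis
  proof (rule module_homI)
    fix r x assume r: "r \<in> carrier R" and x: "x \<in> carrier (tensor R M N)"
    show "tensor_lift P f (r \<odot>\<^bsub>tensor R M N\<^esub> x) = r \<odot>\<^bsub>P\<^esub> tensor_lift P f x"
      using M N x by (induction x rule: tensor_induct)
        (use r in \<open>simp_all add: lift smult_pure_tensor[OF M N] bilinear_mapD[OF f] T.smult_r_distr P.smult_r_distr\<close>)
  qed (simp_all add: lift)
qed

section \<open>Dependence on the data over the carriers only\<close>

lemma module_cong:
  fixes M :: "('r, 'm, 'y) module_scheme" and M' :: "('r, 'm, 'z) module_scheme"
  assumes M: "module R M"
    and eq: "carrier M' = carrier M" "add M' = add M" "\<zero>\<^bsub>M'\<^esub> = \<zero>\<^bsub>M\<^esub>"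
    and smult: "\<And>r x. r \<in> carrier R \<Longrightarrow> x \<in> carrier M \<Longrightarrow> r \<odot>\<^bsub>M'\<^esub> x = r \<odot>\<^bsub>M\<^esub> x"
  shows "module R M'"
proof -
  interpret M: module R M by (rule M)
  show ?thesis
  proof (rule moduleI)
    show "cring R" by (rule M.R.is_cring)
    show "abelian_group M'"
    proof (rule abelian_groupI)
      fix x assume "x \<in> carrier M'"
      then show "\<exists>y \<in> carrier M'. y \<oplus>\<^bsub>M'\<^esub> x = \<zero>\<^bsub>M'\<^esub>"
        unfolding eq using M.M.l_neg by blast
    next
      fix x y assume "x \<in> carrier M'" "y \<in> carrier M'"
      then show "x \<oplus>\<^bsub>M'\<^esub> y = y \<oplus>\<^bsub>M'\<^esub> x"
        unfolding eq by (rule M.M.a_comm)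
    qed (simp_all add: eq M.M.a_assoc)
  qed (simp_all add: eq smult M.smult_l_distr M.smult_r_distr M.smult_assoc1)
qed

text \<open>Generators and relations mention elements of the carriers only, so the two kernels are
  equal as sets and not just isomorphic: the tensors over one record are literally those over the
  other.\<close>

lemma tensor_kernel_cong:
  assumes "carrier M' = carrier M" "add M' = add M"
    and "\<And>r x. r \<in> carrier R \<Longrightarrow> x \<in> carrier M \<Longrightarrow> r \<odot>\<^bsub>M'\<^esub> x = r \<odot>\<^bsub>M\<^esub> x"
    and "carrier N' = carrier N" "add N' = add N"
    and "\<And>r x. r \<in> carrier R \<Longrightarrow> x \<in> carrier N \<Longrightarrow> r \<odot>\<^bsub>N'\<^esub> x = r \<odot>\<^bsub>N\<^esub> x"
  shows "tensor_free M' N' = tensor_free M N" "tensor_kernel R M' N' = tensor_kernel R M N"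
proof -
  show 1: "tensor_free M' N' = tensor_free M N" by (simp add: tensor_free_def assms)
  have "{frag_of (r \<odot>\<^bsub>M'\<^esub> m, n) - frag_of (m, r \<odot>\<^bsub>N'\<^esub> n) | r m n.
       r \<in> carrier R \<and> m \<in> carrier M \<and> n \<in> carrier N} =
     {frag_of (r \<odot>\<^bsub>M\<^esub> m, n) - frag_of (m, r \<odot>\<^bsub>N\<^esub> n) | r m n.
       r \<in> carrier R \<and> m \<in> carrier M \<and> n \<in> carrier N}"
    using assms(3,6) by (intro Collect_cong) (metis (no_types, lifting))
  then have "tensor_relations R M' N' = tensor_relations R M N"
    by (simp add: tensor_relations_def assms)
  with 1 show "tensor_kernel R M' N' = tensor_kernel R M N"
    by (simp add: tensor_kernel_def)
qed

lemma tensor_hom_eqI: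
  assumes M: "module R M" and N: "module R N"
    and F: "F \<in> module_hom R (tensor R M N) P" and G: "G \<in> module_hom R (tensor R M N) P"
    and eq: "\<And>m n. m \<in> carrier M \<Longrightarrow> n \<in> carrier N \<Longrightarrow>
      F (pure_tensor R M N m n) = G (pure_tensor R M N m n)"
    and X: "X \<in> carrier (tensor R M N)"
  shows "F X = G X"
  using M N X by (induction rule: tensor_induct) (simp_all add: eq module_homD[OF F] module_homD[OF G])

section \<open>Bilinear maps and functoriality of the tensor product\<close>

lemma bilinear_map_comp:
  assumes "bilinear_map R M N P f" "\<phi> \<in> module_hom R M' M" "\<psi> \<in> module_hom R N' N"
    "\<theta> \<in> module_hom R P P'"
  shows "bilinear_map R M' N' P' (\<lambda>m n. \<theta> (f (\<phi> m) (\<psi> n)))"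
  unfolding bilinear_map_def
  by (simp add: bilinear_mapD[OF assms(1)] module_homD[OF assms(2)] module_homD[OF assms(3)]
      module_homD[OF assms(4)])

lemma bilinear_map_cong:
  assumes M: "module R M" and N: "module R N" and f: "bilinear_map R M N P f"
    and eq: "\<And>m n. m \<in> carrier M \<Longrightarrow> n \<in> carrier N \<Longrightarrow> f m n = f' m n"
  shows "bilinear_map R M N P f'"
proof -
  interpret M: module R M by (rule M)
  interpret N: module R N by (rule N)
  show ?thesis
    unfolding bilinear_map_def by (simp add: bilinear_mapD[OF f] flip: eq)
qed

lemma bilinear_map_left: "bilinear_map R M N P f \<Longrightarrow> n \<in> carrier N \<Longrightarrow> (\<lambda>m. f m n) \<in> module_hom R M P"
  by (rule module_homI) (simp_all add: bilinear_mapD)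

lemma bilinear_map_right: "bilinear_map R M N P f \<Longrightarrow> m \<in> carrier M \<Longrightarrow> f m \<in> module_hom R N P"
  by (rule module_homI) (simp_all add: bilinear_mapD)

lemma tensor_lift_bilinear_pure:
  assumes M: "module R M" and N: "module R N" and P: "module R P" and f: "bilinear_map R M N P f"
    and "m \<in> carrier M" "n \<in> carrier N"
  shows "tensor_lift P f (pure_tensor R M N m n) = f m n"
  by (rule tensor_lift_pure[OF M N module_imp_abelian_group[OF P] bilinear_map_imp_balanced[OF f]]) fact+

context
  fixes R :: "('r, 'x) ring_scheme" and M :: "('r, 'm, 'm1) module_scheme"
    and N :: "('r, 'n, 'n1) module_scheme" and P :: "('r, 'p, 'p1) module_scheme"
    and Q :: "('r, 'q, 'q1) module_scheme"
  assumes M: "module R M" and N: "module R N" and P: "module R P" and Q: "module R Q"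
begin

context
  fixes f :: "'m \<Rightarrow> 'p" and g :: "'n \<Rightarrow> 'q"
  assumes f: "f \<in> module_hom R M P" and g: "g \<in> module_hom R N Q"
begin

private lemma bil: "bilinear_map R M N (tensor R P Q) (\<lambda>m n. pure_tensor R P Q (f m) (g n))"
  by (rule bilinear_map_comp[OF bilinear_pure_tensor[OF P Q] f g module_hom_id])

lemma tensor_map_hom: "tensor_map R P Q f g \<in> module_hom R (tensor R M N) (tensor R P Q)"
  unfolding tensor_map_def by (rule tensor_lift_linear[OF M N module_tensor[OF P Q] bil])

lemma tensor_map_pure:
  "m \<in> carrier M \<Longrightarrow> n \<in> carrier N \<Longrightarrow>
    tensor_map R P Q f g (pure_tensor R M N m n) = pure_tensor R P Q (f m) (g n)"
  unfolding tensor_map_def by (rule tensor_lift_bilinear_pure[OF M N module_tensor[OF P Q] bil])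

end

lemma tensor_map_cong:
  assumes f: "f \<in> module_hom R M P" and g: "g \<in> module_hom R N Q"
    and eq: "\<And>m. m \<in> carrier M \<Longrightarrow> f m = f' m" "\<And>n. n \<in> carrier N \<Longrightarrow> g n = g' n"
    and X: "X \<in> carrier (tensor R M N)"
  shows "tensor_map R P Q f g X = tensor_map R P Q f' g' X"
proof -
  interpret M: module R M by (rule M)
  interpret N: module R N by (rule N)
  have f': "f' \<in> module_hom R M P"
    by (rule module_homI) (use module_homD[OF f] in \<open>simp_all flip: eq\<close>)
  have g': "g' \<in> module_hom R N Q"
    by (rule module_homI) (use module_homD[OF g] in \<open>simp_all flip: eq\<close>)
  show ?thesis
    by (rule tensor_hom_eqI[OF M N tensor_map_hom[OF f g] tensor_map_hom[OF f' g'] _ X])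
      (simp add: tensor_map_pure[OF f g] tensor_map_pure[OF f' g'] eq)
qed

lemma tensor_map_id:
  assumes X: "X \<in> carrier (tensor R M N)"
  shows "tensor_map R M N (\<lambda>x. x) (\<lambda>x. x) X = X"
proof -
  have h: "tensor_map R M N (\<lambda>x. x) (\<lambda>x. x) \<in> module_hom R (tensor R M N) (tensor R M N)"
    unfolding tensor_map_def
    by (rule tensor_lift_linear[OF M N module_tensor[OF M N] bilinear_pure_tensor[OF M N]])
  show ?thesis
    by (rule tensor_hom_eqI[OF M N h module_hom_id _ X])
      (simp add: tensor_map_def tensor_lift_bilinear_pure[OF M N module_tensor[OF M N] bilinear_pure_tensor[OF M N]])
qed

end

lemma tensor_map_comp:
  assumes M: "module R M" and N: "module R N" and P: "module R P" and Q: "module R Q"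
    and S: "module R S" and T: "module R T"
    and f: "f \<in> module_hom R M P" and g: "g \<in> module_hom R N Q"
    and f': "f' \<in> module_hom R P S" and g': "g' \<in> module_hom R Q T"
    and X: "X \<in> carrier (tensor R M N)"
  shows "tensor_map R S T f' g' (tensor_map R P Q f g X) =
    tensor_map R S T (\<lambda>x. f' (f x)) (\<lambda>x. g' (g x)) X"
proof -
  note ff = module_hom_comp[OF f f'] and gg = module_hom_comp[OF g g']
  show ?thesis
    by (rule tensor_hom_eqI[OF M N module_hom_comp[OF tensor_map_hom[OF M N P Q f g]
          tensor_map_hom[OF P Q S T f' g']] tensor_map_hom[OF M N S T ff gg] _ X])
      (simp add: tensor_map_pure[OF M N P Q f g] tensor_map_pure[OF P Q S T f' g']
        tensor_map_pure[OF M N S T ff gg] module_homD[OF f] module_homD[OF g])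
qed

section \<open>Rebracketing of triple tensor products\<close>

context
  fixes R :: "('r, 'x) ring_scheme" and L :: "('r, 'l, 'l1) module_scheme"
    and M :: "('r, 'm, 'm1) module_scheme" and N :: "('r, 'n, 'n1) module_scheme"
  assumes L: "module R L" and M: "module R M" and N: "module R N"
begin

interpretation T: module R "tensor R L (tensor R M N)"
  by (rule module_tensor[OF L module_tensor[OF M N]])

private lemma assoc_aux:
  assumes n: "n \<in> carrier N"
  shows "bilinear_map R L M (tensor R L (tensor R M N))
    (\<lambda>l m. pure_tensor R L (tensor R M N) l (pure_tensor R M N m n))"
  by (rule bilinear_map_comp[OF bilinear_pure_tensor[OF L module_tensor[OF M N]] module_hom_id
        bilinear_map_left[OF bilinear_pure_tensor[OF M N] n] module_hom_id])

text \<open>Linearity in \<open>u\<close> is that of the inner lift. But \<open>n\<close> enters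
  through the map that is lifted, so linearity in \<open>n\<close> is not formal and is checked by
  induction on \<open>u\<close>.\<close>

private lemma assoc_bilinear:
  "bilinear_map R (tensor R L M) N (tensor R L (tensor R M N))
    (\<lambda>u n. tensor_lift (tensor R L (tensor R M N))
      (\<lambda>l m. pure_tensor R L (tensor R M N) l (pure_tensor R M N m n)) u)"
proof -
  note h = module_homD[OF tensor_lift_linear[OF L M T.module_axioms assoc_aux]]
  note p = tensor_lift_bilinear_pure[OF L M T.module_axioms assoc_aux]
  note b = bilinear_mapD[OF bilinear_pure_tensor[OF M N]]
    bilinear_mapD[OF bilinear_pure_tensor[OF L module_tensor[OF M N]]]
  interpret N: module R N by (rule N)
  have add: "tensor_lift (tensor R L (tensor R M N))
        (\<lambda>l m. pure_tensor R L (tensor R M N) l (pure_tensor R M N m (n \<oplus>\<^bsub>N\<^esub> n'))) u =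
      tensor_lift (tensor R L (tensor R M N))
        (\<lambda>l m. pure_tensor R L (tensor R M N) l (pure_tensor R M N m n)) u
      \<oplus>\<^bsub>tensor R L (tensor R M N)\<^esub> tensor_lift (tensor R L (tensor R M N))
        (\<lambda>l m. pure_tensor R L (tensor R M N) l (pure_tensor R M N m n')) u"
    if n: "n \<in> carrier N" "n' \<in> carrier N" and u: "u \<in> carrier (tensor R L M)" for n n' u
    using L M u by (induction u rule: tensor_induct) (use n in \<open>simp_all add: h p b T.a_ac\<close>)
  have smult: "tensor_lift (tensor R L (tensor R M N))
        (\<lambda>l m. pure_tensor R L (tensor R M N) l (pure_tensor R M N m (r \<odot>\<^bsub>N\<^esub> n))) u =
      r \<odot>\<^bsub>tensor R L (tensor R M N)\<^esub> tensor_lift (tensor R L (tensor R M N))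
        (\<lambda>l m. pure_tensor R L (tensor R M N) l (pure_tensor R M N m n)) u"
    if n: "n \<in> carrier N" "r \<in> carrier R" and u: "u \<in> carrier (tensor R L M)" for n r u
    using L M u by (induction u rule: tensor_induct) (use n in \<open>simp_all add: h p b T.smult_r_distr\<close>)
  show ?thesis
    unfolding bilinear_map_def by (simp add: h add smult)
qed

lemma tensor_assoc_hom:
  "tensor_assoc R L M N \<in> module_hom R (tensor R (tensor R L M) N) (tensor R L (tensor R M N))"
  unfolding tensor_assoc_def Let_def
  by (rule tensor_lift_linear[OF module_tensor[OF L M] N T.module_axioms assoc_bilinear])

lemma tensor_assoc_pure:
  "l \<in> carrier L \<Longrightarrow> m \<in> carrier M \<Longrightarrow> n \<in> carrier N \<Longrightarrow>
    tensor_assoc R L M N (pure_tensor R (tensor R L M) N (pure_tensor R L M l m) n) =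
    pure_tensor R L (tensor R M N) l (pure_tensor R M N m n)"
  by (simp add: tensor_assoc_def Let_def pure_tensor_closed[OF L M]
      tensor_lift_bilinear_pure[OF module_tensor[OF L M] N T.module_axioms assoc_bilinear]
      tensor_lift_bilinear_pure[OF L M T.module_axioms assoc_aux])

end

section \<open>Pairings of tensor products\<close>

context
  fixes R :: "('r, 'x) ring_scheme" and M :: "('r, 'm, 'm1) module_scheme"
    and N :: "('r, 'n, 'n1) module_scheme" and M' :: "('r, 'k, 'k1) module_scheme"
    and N' :: "('r, 'l, 'l1) module_scheme" and P :: "('r, 'p, 'p1) module_scheme"
    and Q :: "('r, 'q, 'q1) module_scheme" and f g
  assumes M: "module R M" and N: "module R N" and M': "module R M'" and N': "module R N'"
    and P: "module R P" and Q: "module R Q"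
    and f: "bilinear_map R M M' P f" and g: "bilinear_map R N N' Q g"
begin

interpretation T: module R "tensor R P Q"
  by (rule module_tensor[OF P Q])

private lemma pairing_aux:
  assumes m: "m \<in> carrier M" and n: "n \<in> carrier N"
  shows "bilinear_map R M' N' (tensor R P Q) (\<lambda>m' n'. pure_tensor R P Q (f m m') (g n n'))"
  by (rule bilinear_map_comp[OF bilinear_pure_tensor[OF P Q] bilinear_map_right[OF f m]
        bilinear_map_right[OF g n] module_hom_id])

text \<open>The variables \<open>m\<close> and \<open>n\<close> sit inside the map that the inner
  lift extends, so linearity in each of them is checked on pure tensors \<open>Y\<close> and carried
  over to sums.\<close>

private lemma pairing_left:
  assumes Y: "Y \<in> carrier (tensor R M' N')"
  shows "bilinear_map R M N (tensor R P Q)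
    (\<lambda>m n. tensor_lift (tensor R P Q) (\<lambda>m' n'. pure_tensor R P Q (f m m') (g n n')) Y)"
proof -
  note h = module_homD[OF tensor_lift_linear[OF M' N' T.module_axioms pairing_aux]]
  note p = tensor_lift_bilinear_pure[OF M' N' T.module_axioms pairing_aux]
  note b = bilinear_mapD[OF bilinear_pure_tensor[OF P Q]] bilinear_mapD[OF f] bilinear_mapD[OF g]
  interpret M: module R M by (rule M)
  interpret N: module R N by (rule N)
  show ?thesis
    unfolding bilinear_map_def
  proof (intro conjI ballI)
    fix m n m' assume mn: "m \<in> carrier M" "m' \<in> carrier M" "n \<in> carrier N"
    show "tensor_lift (tensor R P Q) (\<lambda>k l. pure_tensor R P Q (f (m \<oplus>\<^bsub>M\<^esub> m') k) (g n l)) Y =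
      tensor_lift (tensor R P Q) (\<lambda>k l. pure_tensor R P Q (f m k) (g n l)) Y \<oplus>\<^bsub>tensor R P Q\<^esub>
      tensor_lift (tensor R P Q) (\<lambda>k l. pure_tensor R P Q (f m' k) (g n l)) Y"
      using M' N' Y by (induction Y rule: tensor_induct) (use mn in \<open>simp_all add: h p b T.a_ac\<close>)
  next
    fix m n n' assume mn: "m \<in> carrier M" "n' \<in> carrier N" "n \<in> carrier N"
    show "tensor_lift (tensor R P Q) (\<lambda>k l. pure_tensor R P Q (f m k) (g (n \<oplus>\<^bsub>N\<^esub> n') l)) Y =
      tensor_lift (tensor R P Q) (\<lambda>k l. pure_tensor R P Q (f m k) (g n l)) Y \<oplus>\<^bsub>tensor R P Q\<^esub>
      tensor_lift (tensor R P Q) (\<lambda>k l. pure_tensor R P Q (f m k) (g n' l)) Y"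
      using M' N' Y by (induction Y rule: tensor_induct) (use mn in \<open>simp_all add: h p b T.a_ac\<close>)
  next
    fix r m n assume mn: "m \<in> carrier M" "n \<in> carrier N" "r \<in> carrier R"
    show "tensor_lift (tensor R P Q) (\<lambda>k l. pure_tensor R P Q (f (r \<odot>\<^bsub>M\<^esub> m) k) (g n l)) Y =
      r \<odot>\<^bsub>tensor R P Q\<^esub> tensor_lift (tensor R P Q) (\<lambda>k l. pure_tensor R P Q (f m k) (g n l)) Y"
      using M' N' Y by (induction Y rule: tensor_induct) (use mn in \<open>simp_all add: h p b T.smult_r_distr\<close>)
    show "tensor_lift (tensor R P Q) (\<lambda>k l. pure_tensor R P Q (f m k) (g (r \<odot>\<^bsub>N\<^esub> n) l)) Y =
      r \<odot>\<^bsub>tensor R P Q\<^esub> tensor_lift (tensor R P Q) (\<lambda>k l. pure_tensor R P Q (f m k) (g n l)) Y"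
      using M' N' Y by (induction Y rule: tensor_induct) (use mn in \<open>simp_all add: h p b T.smult_r_distr\<close>)
  qed (use Y in \<open>simp add: h\<close>)
qed

text \<open>Linearity in the first argument is that of the outer lift. The second argument is a
  parameter of the map being lifted; its linearity is that of the inner lift, propagated by
  induction on \<open>X\<close>.\<close>

lemma tensor_pairing_bilinear:
  "bilinear_map R (tensor R M N) (tensor R M' N') (tensor R P Q) (tensor_pairing R P Q f g)"
proof -
  note i = module_homD[OF tensor_lift_linear[OF M' N' T.module_axioms pairing_aux]]
  note h = module_homD[OF tensor_lift_linear[OF M N T.module_axioms pairing_left]]
  note p = tensor_lift_bilinear_pure[OF M N T.module_axioms pairing_left]
  interpret S: module R "tensor R M' N'" by (rule module_tensor[OF M' N'])
  have add: "tensor_pairing R P Q f g X (Y \<oplus>\<^bsub>tensor R M' N'\<^esub> Y') =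
      tensor_pairing R P Q f g X Y \<oplus>\<^bsub>tensor R P Q\<^esub> tensor_pairing R P Q f g X Y'"
    if Y: "Y \<in> carrier (tensor R M' N')" "Y' \<in> carrier (tensor R M' N')"
      and X: "X \<in> carrier (tensor R M N)" for X Y Y'
    unfolding tensor_pairing_def
    using M N X by (induction X rule: tensor_induct) (use Y in \<open>simp_all add: h p i T.a_ac\<close>)
  have smult: "tensor_pairing R P Q f g X (r \<odot>\<^bsub>tensor R M' N'\<^esub> Y) =
      r \<odot>\<^bsub>tensor R P Q\<^esub> tensor_pairing R P Q f g X Y"
    if Y: "Y \<in> carrier (tensor R M' N')" "r \<in> carrier R"
      and X: "X \<in> carrier (tensor R M N)" for X Y r
    unfolding tensor_pairing_def
    using M N X by (induction X rule: tensor_induct) (use Y in \<open>simp_all add: h p i T.smult_r_distr\<close>)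
  show ?thesis
    unfolding bilinear_map_def by (simp add: add smult) (simp add: tensor_pairing_def h)
qed

lemma tensor_pairing_pure:
  assumes "m \<in> carrier M" "n \<in> carrier N" "m' \<in> carrier M'" "n' \<in> carrier N'"
  shows "tensor_pairing R P Q f g (pure_tensor R M N m n) (pure_tensor R M' N' m' n') =
    pure_tensor R P Q (f m m') (g n n')"
  using assms pure_tensor_closed[OF M' N']
  by (simp add: tensor_pairing_def tensor_lift_bilinear_pure[OF M N T.module_axioms pairing_left]
      tensor_lift_bilinear_pure[OF M' N' T.module_axioms pairing_aux])

end

section \<open>The tensor product of two commutative algebras\<close>

lemma tensor_algebra_simps:
  "carrier (tensor_algebra R A B) = carrier (tensor R A B)"
  "add (tensor_algebra R A B) = add (tensor R A B)"
  "\<zero>\<^bsub>tensor_algebra R A B\<^esub> = \<zero>\<^bsub>tensor R A B\<^esub>"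
  "smult (tensor_algebra R A B) = smult (tensor R A B)"
  "monoid.mult (tensor_algebra R A B) = tensor_pairing R A B (monoid.mult A) (monoid.mult B)"
  "\<one>\<^bsub>tensor_algebra R A B\<^esub> = pure_tensor R A B \<one>\<^bsub>A\<^esub> \<one>\<^bsub>B\<^esub>"
  by (simp_all add: tensor_algebra_def)

lemma bilinear_mult:
  assumes "algebra R A"
  shows "bilinear_map R A A A (monoid.mult A)"
proof -
  interpret algebra R A by fact
  note A = cring.cring_simprules[OF M_cring]
  show ?thesis
    unfolding bilinear_map_def
    by (simp add: smult_assoc2 A(13,25)) (metis A(14) smult_assoc2 smult_closed)
qed

text \<open>Commutativity, associativity and the unit law are additive in each variable, so they
  need only be seen on pure tensors, where they hold in each factor. Distributivity is bilinearity
  of the pairing.\<close>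

lemma algebra_tensor_algebra:
  assumes A: "algebra R A" and B: "algebra R B"
  shows "algebra R (tensor_algebra R A B)"
proof -
  interpret A: algebra R A by (rule A)
  interpret B: algebra R B by (rule B)
  note assoc_comm = cring.cring_simprules(11,14)[OF A.M_cring] cring.cring_simprules(11,14)[OF B.M_cring]
  note mA = A.module and mB = B.module
  note bil = tensor_pairing_bilinear[OF mA mB mA mB mA mB bilinear_mult[OF A] bilinear_mult[OF B]]
  note pure = tensor_pairing_pure[OF mA mB mA mB mA mB bilinear_mult[OF A] bilinear_mult[OF B]]
  note s = bilinear_mapD[OF bil] pure pure_tensor_closed[OF mA mB]
  interpret T: module R "tensor R A B" by (rule module_tensor[OF mA mB])
  let ?p = "tensor_pairing R A B (monoid.mult A) (monoid.mult B)"
  have comm: "?p X Y = ?p Y X"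
    if X: "X \<in> carrier (tensor R A B)" and Y: "Y \<in> carrier (tensor R A B)" for X Y
    using mA mB X
  proof (induction X rule: tensor_induct)
    case (pure a b)
    show ?case
      using mA mB Y
      by (induction Y rule: tensor_induct) (use pure in \<open>simp_all add: s assoc_comm\<close>)
  qed (use Y in \<open>simp_all add: s\<close>)
  have assoc: "?p (?p X Y) Z = ?p X (?p Y Z)"
    if X: "X \<in> carrier (tensor R A B)" and Y: "Y \<in> carrier (tensor R A B)"
      and Z: "Z \<in> carrier (tensor R A B)" for X Y Z
    using mA mB X
  proof (induction X rule: tensor_induct)
    case X: (pure a b)
    show ?case
      using mA mB Y
    proof (induction Y rule: tensor_induct)
      case (pure c d)
      show ?case
        using mA mB Z
        by (induction Z rule: tensor_induct) (use X pure in \<open>simp_all add: s assoc_comm(1,3)\<close>)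
    qed (use X Z in \<open>simp_all add: s\<close>)
  qed (use Y Z in \<open>simp_all add: s\<close>)
  have one: "?p (pure_tensor R A B \<one>\<^bsub>A\<^esub> \<one>\<^bsub>B\<^esub>) X = X" if "X \<in> carrier (tensor R A B)" for X
    using mA mB that by (induction X rule: tensor_induct) (simp_all add: s)
  have mod: "module R (tensor_algebra R A B)"
    by (rule module_cong[OF T.module_axioms]) (simp_all add: tensor_algebra_simps)
  interpret TA: module R "tensor_algebra R A B" by (rule mod)
  have cring: "cring (tensor_algebra R A B)"
  proof (rule cringI)
    show "abelian_group (tensor_algebra R A B)" by (rule TA.abelian_group_axioms)
    show "comm_monoid (tensor_algebra R A B)"
    proof (rule comm_monoidI)
      fix x y assume "x \<in> carrier (tensor_algebra R A B)" "y \<in> carrier (tensor_algebra R A B)"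
      then show "x \<otimes>\<^bsub>tensor_algebra R A B\<^esub> y = y \<otimes>\<^bsub>tensor_algebra R A B\<^esub> x"
        unfolding tensor_algebra_simps by (rule comm)
    qed (simp_all add: tensor_algebra_simps s assoc one)
  qed (simp add: tensor_algebra_simps s)
  show ?thesis
    by (intro algebra.intro mod cring algebra_axioms.intro)
      (simp add: tensor_algebra_simps s)
qed

section \<open>Groups of classes of invertible objects\<close>

text \<open>Here \<open>prd M N P\<close> says that \<open>P\<close> is a copy of the product of
  \<open>M\<close> and \<open>N\<close>, and \<open>unt u\<close> that \<open>u\<close> is a copy of
  the unit object. A relation is used because the tensor product itself lives on another type and
  may have no copy in the universe; \<open>prd_ex\<close> asks for one only when both factors are
  invertible. Modules and relative Hopf modules are the two instances.\<close>

locale picard_data =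
  fixes Obj :: "'p set" and eqv :: "'p \<Rightarrow> 'p \<Rightarrow> bool" and prd :: "'p \<Rightarrow> 'p \<Rightarrow> 'p \<Rightarrow> bool"
    and unt :: "'p \<Rightarrow> bool"
  assumes eqv_refl: "M \<in> Obj \<Longrightarrow> eqv M M"
    and prd_obj: "prd M N P \<Longrightarrow> M \<in> Obj \<and> N \<in> Obj \<and> P \<in> Obj"
    and prd_cong: "prd M N P \<Longrightarrow> M' \<in> Obj \<Longrightarrow> N' \<in> Obj \<Longrightarrow> eqv M M' \<Longrightarrow> eqv N N' \<Longrightarrow> prd M' N' P"
    and prd_eqv: "prd M N P \<Longrightarrow> P' \<in> Obj \<Longrightarrow> prd M N P' \<longleftrightarrow> eqv P P'"
    and prd_comm: "prd M N P \<Longrightarrow> prd N M P"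
    and prd_assoc: "prd M N P \<Longrightarrow> prd P L Q \<Longrightarrow> prd N L S \<Longrightarrow> prd M S Q"
    and unt_ex: "\<exists>u. unt u"
    and unt_obj: "unt u \<Longrightarrow> u \<in> Obj"
    and unt_eqv: "unt u \<Longrightarrow> v \<in> Obj \<Longrightarrow> unt v \<longleftrightarrow> eqv u v"
    and unt_prd: "unt u \<Longrightarrow> M \<in> Obj \<Longrightarrow> prd u M M"
    and prd_ex: "prd M M' u \<Longrightarrow> unt u \<Longrightarrow> prd N N' v \<Longrightarrow> unt v \<Longrightarrow> \<exists>P. prd M N P"
begin

definition cls where "cls M = {P \<in> Obj. eqv M P}"

definition invertible where "invertible M \<longleftrightarrow> (\<exists>N u. unt u \<and> prd M N u)"

definition pic where
  "pic = \<lparr>carrier = {cls M | M. invertible M},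
    monoid.mult = (\<lambda>C D. {P. \<exists>M \<in> C. \<exists>N \<in> D. prd M N P}), one = {u. unt u}\<rparr>"

lemma prd_cls: "prd M N P \<Longrightarrow> cls M \<otimes>\<^bsub>pic\<^esub> cls N = cls P"
proof -
  assume p: "prd M N P"
  note o = prd_obj[OF p]
  have "P' \<in> cls M \<otimes>\<^bsub>pic\<^esub> cls N \<longleftrightarrow> P' \<in> cls P" for P'
  proof
    assume "P' \<in> cls M \<otimes>\<^bsub>pic\<^esub> cls N"
    then obtain M' N' where M': "M' \<in> Obj" "eqv M M'" and N': "N' \<in> Obj" "eqv N N'"
      and p': "prd M' N' P'"
      by (auto simp: pic_def cls_def)
    have "prd M' N' P" by (rule prd_cong[OF p M'(1) N'(1) M'(2) N'(2)])
    moreover have "P' \<in> Obj" using prd_obj[OF p'] by simp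
    ultimately show "P' \<in> cls P" using p' prd_eqv by (simp add: cls_def)
  next
    assume "P' \<in> cls P"
    then have "prd M N P'" using prd_eqv[OF p] by (simp add: cls_def)
    moreover have "M \<in> cls M" "N \<in> cls N" using o eqv_refl by (auto simp: cls_def)
    ultimately show "P' \<in> cls M \<otimes>\<^bsub>pic\<^esub> cls N" by (auto simp: pic_def)
  qed
  then show ?thesis by (simp add: set_eq_iff)
qed

lemma cls_unit:
  assumes "unt u" shows "cls u = \<one>\<^bsub>pic\<^esub>"
proof -
  have "P \<in> cls u \<longleftrightarrow> unt P" for P
    using unt_obj[of P] unt_eqv[OF assms, of P] by (auto simp: cls_def)
  then show ?thesis by (auto simp: pic_def)
qed

text \<open>The converse rebracketing is \<open>prd_assoc\<close> for the factors in reversed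
  order.\<close>

lemma prd_assoc': "prd M N P \<Longrightarrow> prd N L S \<Longrightarrow> prd M S Q \<Longrightarrow> prd P L Q"
  by (rule prd_comm, rule prd_assoc[OF prd_comm prd_comm prd_comm])

text \<open>The inverse of M N is N' M', which exists in the universe because N' and M' are
  invertible too: N (N' M') = (N N') M' = M', hence (M N)(N' M') = M M'.\<close>

lemma prd_invertible:
  assumes "prd M M' u" "unt u" "prd N N' v" "unt v"
  shows "\<exists>P Q. prd M N P \<and> prd P Q u"
proof -
  obtain P where P: "prd M N P" using prd_ex assms by blast
  obtain Q where Q: "prd N' M' Q" using prd_ex assms prd_comm by metis
  have "prd v M' M'" using unt_prd assms prd_obj by blast
  then have "prd N Q M'" by (rule prd_assoc[OF assms(3) _ Q])
  then have "prd P Q u" by (rule prd_assoc'[OF P _ assms(1)])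
  with P show ?thesis by blast
qed

theorem comm_group_pic: "comm_group pic"
proof (rule comm_groupI)
  fix C D assume "C \<in> carrier pic" "D \<in> carrier pic"
  then obtain M N M' N' u v where C: "C = cls M" and D: "D = cls N"
    and p: "prd M M' u" "unt u" "prd N N' v" "unt v"
    by (auto simp: pic_def invertible_def)
  obtain P Q where PQ: "prd M N P" "prd P Q u" using prd_invertible[OF p] by blast
  then have eq: "C \<otimes>\<^bsub>pic\<^esub> D = cls P" by (simp add: C D prd_cls[OF PQ(1)])
  moreover have "invertible P" using PQ p by (auto simp: invertible_def)
  ultimately show "C \<otimes>\<^bsub>pic\<^esub> D \<in> carrier pic" by (auto simp: pic_def)
  have "D \<otimes>\<^bsub>pic\<^esub> C = cls P" using prd_cls[OF prd_comm[OF PQ(1)]] by (simp add: C D)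
  with eq show "C \<otimes>\<^bsub>pic\<^esub> D = D \<otimes>\<^bsub>pic\<^esub> C" by simp
  fix E assume "E \<in> carrier pic"
  then obtain L L' w where E: "E = cls L" and q: "prd L L' w" "unt w"
    by (auto simp: pic_def invertible_def)
  \<comment> \<open>Available because \<open>P\<close> has just been shown invertible; products of
    arbitrary objects are not assumed to exist.\<close>
  obtain S where S: "prd P L S" using prd_ex[OF PQ(2) p(2) q] by blast
  obtain T where T: "prd N L T" using prd_ex[OF p(3,4) q] by blast
  have MTS: "prd M T S" by (rule prd_assoc[OF PQ(1) S T])
  then show "C \<otimes>\<^bsub>pic\<^esub> D \<otimes>\<^bsub>pic\<^esub> E = C \<otimes>\<^bsub>pic\<^esub> (D \<otimes>\<^bsub>pic\<^esub> E)"
    by (simp add: C D E prd_cls[OF PQ(1)] prd_cls[OF S] prd_cls[OF T] prd_cls[OF MTS])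
next
  obtain u where u: "unt u" using unt_ex by blast
  then have "prd u u u" using unt_prd unt_obj by blast
  then show "\<one>\<^bsub>pic\<^esub> \<in> carrier pic"
    using u cls_unit[OF u] by (auto simp: pic_def invertible_def)
  fix C assume "C \<in> carrier pic"
  then obtain M M' v where C: "C = cls M" and p: "prd M M' v" "unt v"
    by (auto simp: pic_def invertible_def)
  have "prd u M M" using u unt_prd prd_obj[OF p(1)] by blast
  then show "\<one>\<^bsub>pic\<^esub> \<otimes>\<^bsub>pic\<^esub> C = C"
    using prd_cls[of u M M] cls_unit[OF u] C by simp
  have "prd M' M v" by (rule prd_comm[OF p(1)])
  then have "cls M' \<otimes>\<^bsub>pic\<^esub> C = \<one>\<^bsub>pic\<^esub>" "cls M' \<in> carrier pic"
    using prd_cls[of M' M v] cls_unit[OF p(2)] C p by (auto simp: pic_def invertible_def)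
  then show "\<exists>D \<in> carrier pic. D \<otimes>\<^bsub>pic\<^esub> C = \<one>\<^bsub>pic\<^esub>" by blast
qed

end

section \<open>The symmetric monoidal structure on modules\<close>

text \<open>Writing elements of \<open>N\<close> as \<open>f (g y)\<close> turns linearity of
  \<open>f\<close> into linearity of \<open>g\<close>. So only a set-theoretic inverse has to be
  supplied in the constructions below.\<close>

lemma module_isoI:
  assumes f: "f \<in> module_hom R M N" and "module R M"
    and g: "\<And>y. y \<in> carrier N \<Longrightarrow> g y \<in> carrier M"
    and gf: "\<And>x. x \<in> carrier M \<Longrightarrow> g (f x) = x" and fg: "\<And>y. y \<in> carrier N \<Longrightarrow> f (g y) = y"
  shows "g \<in> module_hom R N M" "module_iso R M N"
proof -
  interpret M: module R M by fact
  note h = module_homD[OF f]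
  show g': "g \<in> module_hom R N M"
  proof (rule module_homI)
    fix x y assume "x \<in> carrier N" "y \<in> carrier N"
    then show "g (x \<oplus>\<^bsub>N\<^esub> y) = g x \<oplus>\<^bsub>M\<^esub> g y"
      by (metis M.M.add.m_closed g gf fg h(2))
  next
    fix r x assume "r \<in> carrier R" "x \<in> carrier N"
    then show "g (r \<odot>\<^bsub>N\<^esub> x) = r \<odot>\<^bsub>M\<^esub> g x"
      by (metis M.smult_closed g gf fg h(3))
  qed (rule g)
  then show "module_iso R M N"
    unfolding module_iso_def using f gf fg by (intro bexI[of _ f] bexI[of _ g]) simp_all
qed

lemma module_isoE:
  assumes "module_iso R M N"
  obtains f g where "f \<in> module_hom R M N" "g \<in> module_hom R N M"
    "\<And>x. x \<in> carrier M \<Longrightarrow> g (f x) = x" "\<And>y. y \<in> carrier N \<Longrightarrow> f (g y) = y"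
proof -
  from assms obtain f where f: "f \<in> module_hom R M N" and "\<exists>g \<in> module_hom R N M.
      (\<forall>x \<in> carrier M. g (f x) = x) \<and> (\<forall>y \<in> carrier N. f (g y) = y)"
    unfolding module_iso_def ..
  then obtain g where "g \<in> module_hom R N M"
    and "(\<forall>x \<in> carrier M. g (f x) = x) \<and> (\<forall>y \<in> carrier N. f (g y) = y)" by (elim bexE)
  with f show ?thesis by (intro that[of f g]) simp_all
qed

lemma module_iso_refl: "module_iso R M M"
  unfolding module_iso_def by (intro bexI[OF _ module_hom_id]) simp

lemma module_iso_sym: "module_iso R M N \<Longrightarrow> module_iso R N M"
  unfolding module_iso_def by blast

lemma module_iso_trans:
  assumes "module_iso R L M" "module_iso R M N"
  shows "module_iso R L N"
proof -
  obtain f g where f: "f \<in> module_hom R L M" "g \<in> module_hom R M L"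
    "\<And>x. x \<in> carrier L \<Longrightarrow> g (f x) = x" "\<And>x. x \<in> carrier M \<Longrightarrow> f (g x) = x"
    by (rule module_isoE[OF assms(1)], rule that)
  obtain f' g' where f': "f' \<in> module_hom R M N" "g' \<in> module_hom R N M"
    "\<And>x. x \<in> carrier M \<Longrightarrow> g' (f' x) = x" "\<And>x. x \<in> carrier N \<Longrightarrow> f' (g' x) = x"
    by (rule module_isoE[OF assms(2)], rule that)
  show ?thesis
    unfolding module_iso_def
    using module_hom_comp[OF f(1) f'(1)] module_hom_comp[OF f'(2) f(2)]
      module_homD(1)[OF f(1)] module_homD(1)[OF f'(2)] f(3,4) f'(3,4)
    by (intro bexI[of _ "\<lambda>x. f' (f x)"] bexI[of _ "\<lambda>x. g (g' x)"]) auto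
qed

lemma regular_module_simps [simp]:
  "carrier (regular_module A) = carrier A"
  "add (regular_module A) = add A"
  "\<zero>\<^bsub>regular_module A\<^esub> = \<zero>\<^bsub>A\<^esub>"
  "smult (regular_module A) = monoid.mult A"
  by (simp_all add: regular_module_def)

lemma module_regular: "cring A \<Longrightarrow> module A (regular_module A)"
proof -
  assume A: "cring A"
  interpret cring A by (rule A)
  show ?thesis
  proof (rule moduleI[OF A])
    show "abelian_group (regular_module A)"
    proof (rule abelian_groupI)
      fix x assume "x \<in> carrier (regular_module A)"
      then show "\<exists>y \<in> carrier (regular_module A). y \<oplus>\<^bsub>regular_module A\<^esub> x = \<zero>\<^bsub>regular_module A\<^esub>"
        using l_neg by auto
    next
      fix x y assume "x \<in> carrier (regular_module A)" "y \<in> carrier (regular_module A)"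
      then show "x \<oplus>\<^bsub>regular_module A\<^esub> y = y \<oplus>\<^bsub>regular_module A\<^esub> x"
        using a_comm by simp
    qed (simp_all add: a_assoc)
  qed (simp_all add: l_distr r_distr m_assoc)
qed

section \<open>Symmetry, associativity and unit isomorphisms\<close>

definition tensor_swap ::
  "('r, 'x) ring_scheme \<Rightarrow> ('r, 'm, 'y) module_scheme \<Rightarrow> ('r, 'n, 'z) module_scheme \<Rightarrow>
   ('m, 'n) tensor \<Rightarrow> ('n, 'm) tensor"
  where "tensor_swap R M N = tensor_lift (tensor R N M) (\<lambda>m n. pure_tensor R N M n m)"

text \<open>The canonical isomorphism R \<otimes> M \<cong> M. For the regular module it is the
  multiplication of the ring, which is how it is used for products of twists.\<close>

definition tensor_unit ::
  "('r, 'm, 'y) module_scheme \<Rightarrow> ('r, 'm) tensor \<Rightarrow> 'm"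
  where "tensor_unit M = tensor_lift M (\<lambda>r m. r \<odot>\<^bsub>M\<^esub> m)"

context
  fixes R :: "('r, 'x) ring_scheme" and M :: "('r, 'm, 'm1) module_scheme"
    and N :: "('r, 'n, 'n1) module_scheme"
  assumes M: "module R M" and N: "module R N"
begin

private lemma swap_bilinear: "bilinear_map R M N (tensor R N M) (\<lambda>m n. pure_tensor R N M n m)"
  using bilinear_pure_tensor[OF N M] unfolding bilinear_map_def by blast

lemma tensor_swap_hom: "tensor_swap R M N \<in> module_hom R (tensor R M N) (tensor R N M)"
  unfolding tensor_swap_def by (rule tensor_lift_linear[OF M N module_tensor[OF N M] swap_bilinear])

lemma tensor_swap_pure: "m \<in> carrier M \<Longrightarrow> n \<in> carrier N \<Longrightarrow>
    tensor_swap R M N (pure_tensor R M N m n) = pure_tensor R N M n m"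
  unfolding tensor_swap_def
  by (rule tensor_lift_bilinear_pure[OF M N module_tensor[OF N M] swap_bilinear])

end

lemma tensor_swap_swap:
  assumes M: "module R M" and N: "module R N" and X: "X \<in> carrier (tensor R M N)"
  shows "tensor_swap R N M (tensor_swap R M N X) = X"
  by (rule tensor_hom_eqI[OF M N module_hom_comp[OF tensor_swap_hom[OF M N] tensor_swap_hom[OF N M]]
        module_hom_id _ X])
    (simp add: tensor_swap_pure[OF M N] tensor_swap_pure[OF N M])

lemma module_iso_swap:
  assumes M: "module R M" and N: "module R N"
  shows "module_iso R (tensor R M N) (tensor R N M)"
  by (rule module_isoI[where g = "tensor_swap R N M", OF tensor_swap_hom[OF M N]
        module_tensor[OF M N] module_homD(1)[OF tensor_swap_hom[OF N M]]])
    (assumption | rule tensor_swap_swap[OF M N] tensor_swap_swap[OF N M])+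

text \<open>Composed of swaps and associativity isomorphisms, so that no further lift has to be constructed.\<close>

definition tensor_assoc_inv ::
  "('r, 'w) ring_scheme \<Rightarrow> ('r, 'l, 'x) module_scheme \<Rightarrow> ('r, 'm, 'y) module_scheme \<Rightarrow>
   ('r, 'n, 'z) module_scheme \<Rightarrow> ('l, ('m, 'n) tensor) tensor \<Rightarrow> (('l, 'm) tensor, 'n) tensor"
  where "tensor_assoc_inv R L M N X =
    tensor_swap R N (tensor R L M) (tensor_assoc R N L M (tensor_swap R M (tensor R N L)
      (tensor_assoc R M N L (tensor_swap R L (tensor R M N) X))))"

context
  fixes R :: "('r, 'x) ring_scheme" and L :: "('r, 'l, 'l1) module_scheme"
    and M :: "('r, 'm, 'm1) module_scheme" and N :: "('r, 'n, 'n1) module_scheme"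
  assumes L: "module R L" and M: "module R M" and N: "module R N"
begin

lemma tensor_assoc_inv_hom:
  "tensor_assoc_inv R L M N \<in> module_hom R (tensor R L (tensor R M N)) (tensor R (tensor R L M) N)"
proof -
  note t = module_tensor[OF M N] module_tensor[OF N L] module_tensor[OF L M]
  have "(\<lambda>X. tensor_swap R N (tensor R L M) (tensor_assoc R N L M (tensor_swap R M (tensor R N L)
      (tensor_assoc R M N L (tensor_swap R L (tensor R M N) X))))) \<in>
    module_hom R (tensor R L (tensor R M N)) (tensor R (tensor R L M) N)"
    by (rule module_hom_comp[OF module_hom_comp[OF module_hom_comp[OF module_hom_comp[OF
              tensor_swap_hom[OF L t(1)] tensor_assoc_hom[OF M N L]] tensor_swap_hom[OF M t(2)]]
            tensor_assoc_hom[OF N L M]] tensor_swap_hom[OF N t(3)]])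
  then show ?thesis by (simp add: tensor_assoc_inv_def[abs_def])
qed

lemma tensor_assoc_inv_pure:
  assumes "l \<in> carrier L" "m \<in> carrier M" "n \<in> carrier N"
  shows "tensor_assoc_inv R L M N (pure_tensor R L (tensor R M N) l (pure_tensor R M N m n)) =
    pure_tensor R (tensor R L M) N (pure_tensor R L M l m) n"
  using assms
  by (simp add: tensor_assoc_inv_def tensor_swap_pure tensor_assoc_pure pure_tensor_closed
      module_tensor L M N)

lemma tensor_assoc_inv_assoc:
  assumes "X \<in> carrier (tensor R (tensor R L M) N)"
  shows "tensor_assoc_inv R L M N (tensor_assoc R L M N X) = X"
  using module_tensor[OF L M] N assms
proof (induction X rule: tensor_induct)
  case (pure u n)
  from L M pure(1) show ?case
    by (induction u rule: tensor_induct)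
      (use pure(2) L M N in \<open>simp_all add: tensor_assoc_pure tensor_assoc_inv_pure
        pure_tensor_add_left pure_tensor_closed module_tensor module_homD[OF tensor_assoc_hom[OF L M N]]
        module_homD[OF tensor_assoc_inv_hom]\<close>)
qed (simp_all add: module_homD[OF tensor_assoc_hom[OF L M N]] module_homD[OF tensor_assoc_inv_hom])

lemma tensor_assoc_assoc_inv:
  assumes "X \<in> carrier (tensor R L (tensor R M N))"
  shows "tensor_assoc R L M N (tensor_assoc_inv R L M N X) = X"
  using L module_tensor[OF M N] assms
proof (induction X rule: tensor_induct)
  case (pure l u)
  from M N pure(2) show ?case
    by (induction u rule: tensor_induct)
      (use pure(1) L M N in \<open>simp_all add: tensor_assoc_pure tensor_assoc_inv_pure
        pure_tensor_add_right pure_tensor_closed module_tensor module_homD[OF tensor_assoc_hom[OF L M N]]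
        module_homD[OF tensor_assoc_inv_hom]\<close>)
qed (simp_all add: module_homD[OF tensor_assoc_hom[OF L M N]] module_homD[OF tensor_assoc_inv_hom])

lemma module_iso_assoc:
  "module_iso R (tensor R (tensor R L M) N) (tensor R L (tensor R M N))"
  by (rule module_isoI[where g = "tensor_assoc_inv R L M N",
        OF tensor_assoc_hom[OF L M N] module_tensor[OF module_tensor[OF L M] N]
        module_homD(1)[OF tensor_assoc_inv_hom]])
    (assumption | rule tensor_assoc_inv_assoc tensor_assoc_assoc_inv)+

end

context
  fixes R :: "('r, 'x) ring_scheme" and M :: "('r, 'm, 'm1) module_scheme"
  assumes M: "module R M"
begin

interpretation M: module R M by (rule M)

private lemma regular: "module R (regular_module R)"
  by (rule module_regular[OF M.R.is_cring])

private lemma smult_bilinear: "bilinear_map R (regular_module R) M M (\<lambda>r m. r \<odot>\<^bsub>M\<^esub> m)"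
  unfolding bilinear_map_def
  by (simp add: M.smult_l_distr M.smult_r_distr M.smult_assoc1)
    (metis M.R.m_comm M.smult_assoc1)

lemma tensor_unit_hom: "tensor_unit M \<in> module_hom R (tensor R (regular_module R) M) M"
  unfolding tensor_unit_def by (rule tensor_lift_linear[OF regular M M smult_bilinear])

lemma tensor_unit_pure: "r \<in> carrier R \<Longrightarrow> m \<in> carrier M \<Longrightarrow>
    tensor_unit M (pure_tensor R (regular_module R) M r m) = r \<odot>\<^bsub>M\<^esub> m"
  unfolding tensor_unit_def
  by (rule tensor_lift_bilinear_pure[OF regular M M smult_bilinear]) simp_all

lemma pure_tensor_one_tensor_unit:
  assumes "X \<in> carrier (tensor R (regular_module R) M)"
  shows "pure_tensor R (regular_module R) M \<one>\<^bsub>R\<^esub> (tensor_unit M X) = X"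
  using regular M assms
proof (induction X rule: tensor_induct)
  case (pure r m)
  then show ?case
    using pure_tensor_balanced[OF regular M, of r "\<one>\<^bsub>R\<^esub>" m] by (simp add: tensor_unit_pure)
qed (simp add: module_homD[OF tensor_unit_hom] pure_tensor_add_right[OF regular M])

lemma module_iso_unit: "module_iso R (tensor R (regular_module R) M) M"
  by (rule module_isoI[where g = "\<lambda>m. pure_tensor R (regular_module R) M \<one>\<^bsub>R\<^esub> m",
        OF tensor_unit_hom module_tensor[OF regular M]])
    (simp_all add: pure_tensor_closed[OF regular M] pure_tensor_one_tensor_unit tensor_unit_pure)

end

section \<open>Invariance of the tensor product under isomorphism\<close>

lemma module_iso_tensor_left:
  assumes M: "module R M" and M': "module R M'" and N: "module R N" and i: "module_iso R M M'"
  shows "module_iso R (tensor R M N) (tensor R M' N)"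
proof -
  obtain f g where f: "f \<in> module_hom R M M'" and g: "g \<in> module_hom R M' M"
    and gf: "\<And>x. x \<in> carrier M \<Longrightarrow> g (f x) = x" and fg: "\<And>y. y \<in> carrier M' \<Longrightarrow> f (g y) = y"
    by (rule module_isoE[OF i], rule that)
  have "tensor_map R M N g (\<lambda>x. x) (tensor_map R M' N f (\<lambda>x. x) X) = X"
    if "X \<in> carrier (tensor R M N)" for X
    using tensor_map_comp[OF M N M' N M N f module_hom_id g module_hom_id that]
      tensor_map_cong[OF M N M N module_hom_comp[OF f g] module_hom_id gf refl that]
      tensor_map_id[OF M N M N that] by simp
  moreover have "tensor_map R M' N f (\<lambda>x. x) (tensor_map R M N g (\<lambda>x. x) X) = X"
    if "X \<in> carrier (tensor R M' N)" for X
    using tensor_map_comp[OF M' N M N M' N g module_hom_id f module_hom_id that]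
      tensor_map_cong[OF M' N M' N module_hom_comp[OF g f] module_hom_id fg refl that]
      tensor_map_id[OF M' N M' N that] by simp
  ultimately show ?thesis
    by (intro module_isoI(2)[where g = "tensor_map R M N g (\<lambda>x. x)",
          OF tensor_map_hom[OF M N M' N f module_hom_id] module_tensor[OF M N]
          module_homD(1)[OF tensor_map_hom[OF M' N M N g module_hom_id]]])
qed

text \<open>The second factor is replaced by moving it to the left with a swap, so that one
  functoriality argument serves both sides.\<close>

lemma module_iso_tensor:
  assumes M: "module R M" and M': "module R M'" and N: "module R N" and N': "module R N'"
    and "module_iso R M M'" "module_iso R N N'"
  shows "module_iso R (tensor R M N) (tensor R M' N')"
proof -
  have "module_iso R (tensor R M N) (tensor R M' N)"
    by (rule module_iso_tensor_left[OF M M' N]) fact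
  moreover have "module_iso R (tensor R M' N) (tensor R N M')"
    by (rule module_iso_swap[OF M' N])
  moreover have "module_iso R (tensor R N M') (tensor R N' M')"
    by (rule module_iso_tensor_left[OF N N' M']) fact
  moreover have "module_iso R (tensor R N' M') (tensor R M' N')"
    by (rule module_iso_swap[OF N' M'])
  ultimately show ?thesis by (blast intro: module_iso_trans)
qed

text \<open>
  If \<open>\<phi> : M \<otimes> N \<cong> R\<close>, then finitely many of the functionals \<open>\<phi> (- \<otimes> n)\<close> separate the points of \<open>M\<close>:
  from \<open>m \<otimes> n = \<phi> (m \<otimes> n) X\<^sub>0\<close> with \<open>\<phi> X\<^sub>0 = 1\<close>, contraction with \<open>m'\<close> gives
  \<open>\<phi> (m' \<otimes> n) m = \<phi> (m \<otimes> n) t\<close> with \<open>t\<close> depending on \<open>m'\<close> only.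
\<close>

lemma invertible_module_embeds:
  fixes emb :: "'r list \<Rightarrow> 'u" and M :: "('r, 'm, 'm1) module_scheme"
  assumes M: "module R M" and N: "module R N"
    and iso: "module_iso R (tensor R M N) (regular_module R)"
    and emb: "inj_on emb (lists (carrier R))"
  shows "\<exists>e :: 'm \<Rightarrow> 'u. inj_on e (carrier M)"
proof -
  interpret M: module R M by (rule M)
  interpret N: module R N by (rule N)
  interpret T: module R "tensor R M N" by (rule module_tensor[OF M N])
  obtain \<phi> \<psi> where \<phi>: "\<phi> \<in> module_hom R (tensor R M N) (regular_module R)"
    and \<psi>: "\<psi> \<in> module_hom R (regular_module R) (tensor R M N)"
    and \<psi>\<phi>: "\<And>x. x \<in> carrier (tensor R M N) \<Longrightarrow> \<psi> (\<phi> x) = x"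
    and \<phi>\<psi>: "\<And>y. y \<in> carrier R \<Longrightarrow> \<phi> (\<psi> y) = y"
    by (rule module_isoE[OF iso, unfolded regular_module_simps], rule that)
  note \<phi>D = module_homD[OF \<phi>, unfolded regular_module_simps] and \<psi>D = module_homD[OF \<psi>, unfolded regular_module_simps]
  note pure = bilinear_mapD[OF bilinear_pure_tensor[OF M N]]
  define X\<^sub>0 where "X\<^sub>0 = \<psi> \<one>\<^bsub>R\<^esub>"
  have X\<^sub>0: "X\<^sub>0 \<in> carrier (tensor R M N)" "\<phi> X\<^sub>0 = \<one>\<^bsub>R\<^esub>"
    by (simp_all add: X\<^sub>0_def \<psi>D \<phi>\<psi>)
  define t where "t m' = tensor_lift M (\<lambda>m n. \<phi> (pure_tensor R M N m' n) \<odot>\<^bsub>M\<^esub> m)" for m'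
  have tb: "bilinear_map R M N M (\<lambda>m n. \<phi> (pure_tensor R M N m' n) \<odot>\<^bsub>M\<^esub> m)"
    if "m' \<in> carrier M" for m'
    unfolding bilinear_map_def using that
    by (simp add: pure \<phi>D M.smult_l_distr M.smult_r_distr M.smult_assoc1)
      (metis M.R.m_comm M.smult_assoc1 \<phi>D(1) pure(1))
  have t_pure: "t m' (pure_tensor R M N m n) = \<phi> (pure_tensor R M N m' n) \<odot>\<^bsub>M\<^esub> m"
    if "m' \<in> carrier M" "m \<in> carrier M" "n \<in> carrier N" for m' m n
    unfolding t_def by (rule tensor_lift_bilinear_pure[OF M N M tb]) fact+
  have t_smult: "t m' (r \<odot>\<^bsub>tensor R M N\<^esub> X) = r \<odot>\<^bsub>M\<^esub> t m' X"
    if "m' \<in> carrier M" "r \<in> carrier R" "X \<in> carrier (tensor R M N)" for m' r X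
    unfolding t_def using module_homD(3)[OF tensor_lift_linear[OF M N M tb]] that by blast
  have key: "\<phi> (pure_tensor R M N m' n) \<odot>\<^bsub>M\<^esub> m = \<phi> (pure_tensor R M N m n) \<odot>\<^bsub>M\<^esub> t m' X\<^sub>0"
    if m: "m' \<in> carrier M" "m \<in> carrier M" "n \<in> carrier N" for m' m n
  proof -
    let ?c = "\<phi> (pure_tensor R M N m n)"
    have c: "?c \<in> carrier R" using m by (simp add: pure \<phi>D)
    have "pure_tensor R M N m n = \<psi> (?c \<otimes>\<^bsub>R\<^esub> \<one>\<^bsub>R\<^esub>)" using m c by (simp add: \<psi>\<phi> pure)
    also have "\<dots> = ?c \<odot>\<^bsub>tensor R M N\<^esub> X\<^sub>0" unfolding X\<^sub>0_def using c by (rule \<psi>D(3)) simp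
    finally have eq: "pure_tensor R M N m n = ?c \<odot>\<^bsub>tensor R M N\<^esub> X\<^sub>0" .
    have "\<phi> (pure_tensor R M N m' n) \<odot>\<^bsub>M\<^esub> m = t m' (pure_tensor R M N m n)"
      using m by (simp add: t_pure)
    also have "\<dots> = t m' (?c \<odot>\<^bsub>tensor R M N\<^esub> X\<^sub>0)" by (simp flip: eq)
    also have "\<dots> = ?c \<odot>\<^bsub>M\<^esub> t m' X\<^sub>0" using m c X\<^sub>0 by (simp add: t_smult)
    finally show ?thesis .
  qed
  define val where "val ns x = map (\<lambda>n. \<phi> (pure_tensor R M N x n)) ns" for ns x
  \<comment> \<open>The values of the functionals \<phi> (- \<otimes> n), for n in
    \<open>ns\<close>, determine \<phi> (X) x. For X = m \<otimes> n the list \<open>[n]\<close>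
    suffices, because \<phi> (m \<otimes> n) x = \<phi> (x \<otimes> n) t with t depending on m
    only. Lists are concatenated along sums. At \<open>X\<^sub>0\<close>, where \<phi> takes the
    value 1, the points themselves are separated.\<close>
  define sep where "sep X ns \<longleftrightarrow> (\<forall>x \<in> carrier M. \<forall>y \<in> carrier M. val ns x = val ns y \<longrightarrow>
      \<phi> X \<odot>\<^bsub>M\<^esub> x = \<phi> X \<odot>\<^bsub>M\<^esub> y)" for X ns
  have "\<exists>ns \<in> lists (carrier N). sep X ns" if "X \<in> carrier (tensor R M N)" for X
    using M N that
  proof (induction X rule: tensor_induct)
    case (pure m n)
    then show ?case by (intro bexI[of _ "[n]"]) (simp_all add: sep_def val_def key)
  next
    case (add X Y)
    from add.IH obtain ns ns' where *: "ns \<in> lists (carrier N)" "ns' \<in> lists (carrier N)"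
      "sep X ns" "sep Y ns'"
      by blast
    have "sep (X \<oplus>\<^bsub>tensor R M N\<^esub> Y) (ns @ ns')"
      unfolding sep_def
    proof (intro ballI impI)
      fix x y assume xy: "x \<in> carrier M" "y \<in> carrier M" and eq: "val (ns @ ns') x = val (ns @ ns') y"
      from eq have "val ns x = val ns y" "val ns' x = val ns' y" by (simp_all add: val_def)
      with xy *(3,4) have "\<phi> X \<odot>\<^bsub>M\<^esub> x = \<phi> X \<odot>\<^bsub>M\<^esub> y" "\<phi> Y \<odot>\<^bsub>M\<^esub> x = \<phi> Y \<odot>\<^bsub>M\<^esub> y"
        unfolding sep_def by blast+
      then show "\<phi> (X \<oplus>\<^bsub>tensor R M N\<^esub> Y) \<odot>\<^bsub>M\<^esub> x = \<phi> (X \<oplus>\<^bsub>tensor R M N\<^esub> Y) \<odot>\<^bsub>M\<^esub> y"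
        using add.hyps xy by (simp add: \<phi>D M.smult_l_distr)
    qed
    moreover have "ns @ ns' \<in> lists (carrier N)" using * by simp
    ultimately show ?case by blast
  qed
  from this[OF X\<^sub>0(1)] obtain ns where ns: "ns \<in> lists (carrier N)" "sep X\<^sub>0 ns" by blast
  have "inj_on (\<lambda>x. emb (val ns x)) (carrier M)"
  proof (rule inj_onI)
    fix x y assume xy: "x \<in> carrier M" "y \<in> carrier M" and eq: "emb (val ns x) = emb (val ns y)"
    have "val ns z \<in> lists (carrier R)" if "z \<in> carrier M" for z
      using ns(1) that by (auto simp: val_def pure \<phi>D in_lists_conv_set)
    with eq xy have "val ns x = val ns y" using emb by (meson inj_onD)
    with ns(2) xy have "\<phi> X\<^sub>0 \<odot>\<^bsub>M\<^esub> x = \<phi> X\<^sub>0 \<odot>\<^bsub>M\<^esub> y" unfolding sep_def by blast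
    with xy show "x = y" by (simp add: X\<^sub>0)
  qed
  then show ?thesis by blast
qed

section \<open>Transport of a module structure along an injection\<close>

definition transport_module ::
  "('r, 'm, 'y) module_scheme \<Rightarrow> ('m \<Rightarrow> 'u) \<Rightarrow> ('r, 'u) module"
  where "transport_module M e = (let g = inv_into (carrier M) e in
    \<lparr>carrier = e ` carrier M, monoid.mult = undefined, one = undefined, ring.zero = e \<zero>\<^bsub>M\<^esub>,
     add = (\<lambda>x y. e (g x \<oplus>\<^bsub>M\<^esub> g y)), smult = (\<lambda>r x. e (r \<odot>\<^bsub>M\<^esub> g x))\<rparr>)"

lemma transport_module:
  assumes M: "module R M" and e: "inj_on e (carrier M)"
  shows "module R (transport_module M e)" "e \<in> module_hom R M (transport_module M e)"
    "module_iso R M (transport_module M e)"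
proof -
  interpret M: module R M by (rule M)
  note [simp] = inv_into_f_f[OF e]
  have s: "carrier (transport_module M e) = e ` carrier M"
    "\<zero>\<^bsub>transport_module M e\<^esub> = e \<zero>\<^bsub>M\<^esub>"
    "\<And>x y. x \<in> carrier M \<Longrightarrow> y \<in> carrier M \<Longrightarrow> e x \<oplus>\<^bsub>transport_module M e\<^esub> e y = e (x \<oplus>\<^bsub>M\<^esub> y)"
    "\<And>r x. x \<in> carrier M \<Longrightarrow> r \<odot>\<^bsub>transport_module M e\<^esub> e x = e (r \<odot>\<^bsub>M\<^esub> x)"
    by (simp_all add: transport_module_def Let_def)
  show "module R (transport_module M e)"
  proof (rule moduleI[OF M.R.is_cring])
    show "abelian_group (transport_module M e)"
    proof (rule abelian_groupI)
      fix x assume "x \<in> carrier (transport_module M e)"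
      then obtain y where "y \<in> carrier M" "x = e y" by (auto simp: s)
      then show "\<exists>y \<in> carrier (transport_module M e). y \<oplus>\<^bsub>transport_module M e\<^esub> x = \<zero>\<^bsub>transport_module M e\<^esub>"
        by (intro bexI[of _ "e (\<ominus>\<^bsub>M\<^esub> y)"]) (simp_all add: s M.M.l_neg)
    next
      fix x y assume "x \<in> carrier (transport_module M e)" "y \<in> carrier (transport_module M e)"
      then show "x \<oplus>\<^bsub>transport_module M e\<^esub> y = y \<oplus>\<^bsub>transport_module M e\<^esub> x"
        by (auto simp: s M.M.a_comm)
    qed (auto simp: s M.M.a_assoc)
  qed (auto simp: s M.smult_l_distr M.smult_r_distr M.smult_assoc1)
  show h: "e \<in> module_hom R M (transport_module M e)"
    by (rule module_homI) (simp_all add: s)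
  show "module_iso R M (transport_module M e)"
    by (rule module_isoI[OF h M, of "inv_into (carrier M) e"]) (auto simp: s)
qed

section \<open>Coactions\<close>

text \<open>Together with \<open>comult_snd\<close> and \<open>counit_snd\<close> this gives the
  sides of the coaction axioms as maps on all of V \<otimes> H, not only on values of \<rho>. They
  can then be treated as linear maps, and the grouplike condition, which applies
  \<open>coact_fst\<close> to X itself, is stated with the same maps.\<close>

definition coact_fst ::
  "'k ring \<Rightarrow> ('k, 'h) bialgebra \<Rightarrow> ('k, 'v, 'z) module_scheme \<Rightarrow> ('v \<Rightarrow> ('v, 'h) tensor) \<Rightarrow>
   ('v, 'h) tensor \<Rightarrow> ('v, ('h, 'h) tensor) tensor"
  where "coact_fst k H V \<rho> X =
    tensor_assoc k V H H (tensor_map k (tensor k V H) H \<rho> (\<lambda>h. h) X)"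

definition comult_snd ::
  "'k ring \<Rightarrow> ('k, 'h) bialgebra \<Rightarrow> ('k, 'v, 'z) module_scheme \<Rightarrow>
   ('v, 'h) tensor \<Rightarrow> ('v, ('h, 'h) tensor) tensor"
  where "comult_snd k H V X = tensor_map k V (tensor k H H) (\<lambda>v. v) (comult H) X"

definition counit_snd ::
  "('k, 'h) bialgebra \<Rightarrow> ('k, 'v, 'z) module_scheme \<Rightarrow> ('v, 'h) tensor \<Rightarrow> 'v"
  where "counit_snd H V X = tensor_lift V (\<lambda>v h. counit H h \<odot>\<^bsub>V\<^esub> v) X"

lemma right_coaction_iff:
  "right_coaction k H V \<rho> \<longleftrightarrow> \<rho> \<in> module_hom k V (tensor k V H) \<and>
    (\<forall>v \<in> carrier V. coact_fst k H V \<rho> (\<rho> v) = comult_snd k H V (\<rho> v)) \<and>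
    (\<forall>v \<in> carrier V. counit_snd H V (\<rho> v) = v)"
  unfolding right_coaction_def coact_fst_def comult_snd_def counit_snd_def ..

lemma right_coactionD:
  assumes "right_coaction k H V \<rho>"
  shows "\<rho> \<in> module_hom k V (tensor k V H)"
    and "\<And>v. v \<in> carrier V \<Longrightarrow> coact_fst k H V \<rho> (\<rho> v) = comult_snd k H V (\<rho> v)"
    and "\<And>v. v \<in> carrier V \<Longrightarrow> counit_snd H V (\<rho> v) = v"
  using assms unfolding right_coaction_iff by simp_all

context comm_bialgebra
begin

lemma module_H: "module k H" by (rule module)

lemma algebra_H: "algebra k H" by (rule algebra_axioms)

lemma module_HH: "module k (tensor k H H)" by (rule module_tensor[OF module_H module_H])

lemma algebra_HH: "algebra k (tensor_algebra k H H)"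
  by (rule algebra_tensor_algebra[OF algebra_H algebra_H])

abbreviation pairing :: "('k, 'w, 'y) module_scheme \<Rightarrow> ('u \<Rightarrow> 'v \<Rightarrow> 'w) \<Rightarrow> ('u, 'h) tensor \<Rightarrow>
    ('v, 'h) tensor \<Rightarrow> ('w, 'h) tensor"
  where "pairing W f \<equiv> tensor_pairing k W H f (monoid.mult H)"

text \<open>The algebra H \<otimes> H takes the place of H. Both sides of coassociativity have
  values in tensor products with H \<otimes> H, and this is the product there that they
  respect.\<close>

abbreviation pairing3 :: "('k, 'w, 'y) module_scheme \<Rightarrow> ('u \<Rightarrow> 'v \<Rightarrow> 'w) \<Rightarrow>
    ('u, ('h, 'h) tensor) tensor \<Rightarrow> ('v, ('h, 'h) tensor) tensor \<Rightarrow> ('w, ('h, 'h) tensor) tensor"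
  where "pairing3 W f \<equiv> tensor_pairing k W (tensor k H H) f (monoid.mult (tensor_algebra k H H))"

abbreviation map_fst :: "('k, 'w, 'y) module_scheme \<Rightarrow> ('v \<Rightarrow> 'w) \<Rightarrow> ('v, 'h) tensor \<Rightarrow> ('w, 'h) tensor"
  where "map_fst W f \<equiv> tensor_map k W H f (\<lambda>h. h)"

lemma H_mult_closed: "x \<in> carrier H \<Longrightarrow> y \<in> carrier H \<Longrightarrow> x \<otimes>\<^bsub>H\<^esub> y \<in> carrier H"
  by (rule cring.cring_simprules(5)[OF M_cring])

lemma H_one_closed: "\<one>\<^bsub>H\<^esub> \<in> carrier H"
  by (rule cring.cring_simprules(6)[OF M_cring])

lemma H_mult_comm: "x \<in> carrier H \<Longrightarrow> y \<in> carrier H \<Longrightarrow> x \<otimes>\<^bsub>H\<^esub> y = y \<otimes>\<^bsub>H\<^esub> x"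
  by (rule cring.cring_simprules(14)[OF M_cring])

lemma H_mult_assoc: "x \<in> carrier H \<Longrightarrow> y \<in> carrier H \<Longrightarrow> z \<in> carrier H \<Longrightarrow>
    x \<otimes>\<^bsub>H\<^esub> y \<otimes>\<^bsub>H\<^esub> z = x \<otimes>\<^bsub>H\<^esub> (y \<otimes>\<^bsub>H\<^esub> z)"
  by (rule cring.cring_simprules(11)[OF M_cring])

lemma H_one_mult: "x \<in> carrier H \<Longrightarrow> \<one>\<^bsub>H\<^esub> \<otimes>\<^bsub>H\<^esub> x = x"
  by (rule cring.cring_simprules(12)[OF M_cring])

lemma comult_closed: "h \<in> carrier H \<Longrightarrow> comult H h \<in> carrier (tensor k H H)"
  by (rule module_homD(1)[OF comult_linear])

lemma comult_mult: "x \<in> carrier H \<Longrightarrow> y \<in> carrier H \<Longrightarrow>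
    comult H (x \<otimes>\<^bsub>H\<^esub> y) = comult H x \<otimes>\<^bsub>tensor_algebra k H H\<^esub> comult H y"
  by (rule ring_hom_mult[OF comult_ring_hom])

lemma comult_one: "comult H \<one>\<^bsub>H\<^esub> = pure_tensor k H H \<one>\<^bsub>H\<^esub> \<one>\<^bsub>H\<^esub>"
  using ring_hom_one[OF comult_ring_hom] by (simp add: tensor_algebra_simps)

lemma counit_closed: "h \<in> carrier H \<Longrightarrow> counit H h \<in> carrier k"
  using module_homD(1)[OF counit_linear] by simp

lemma counit_mult: "x \<in> carrier H \<Longrightarrow> y \<in> carrier H \<Longrightarrow>
    counit H (x \<otimes>\<^bsub>H\<^esub> y) = counit H x \<otimes>\<^bsub>k\<^esub> counit H y"
  by (rule ring_hom_mult[OF counit_ring_hom])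

context
  fixes V :: "('k, 'v, 'v1) module_scheme"
  assumes V: "module k V"
begin

interpretation V: module k V by (rule V)

lemma comult_snd_hom:
  "comult_snd k H V \<in> module_hom k (tensor k V H) (tensor k V (tensor k H H))"
  using tensor_map_hom[OF V module_H V module_HH module_hom_id comult_linear]
  by (simp add: comult_snd_def[abs_def])

lemma comult_snd_pure: "v \<in> carrier V \<Longrightarrow> h \<in> carrier H \<Longrightarrow>
    comult_snd k H V (pure_tensor k V H v h) = pure_tensor k V (tensor k H H) v (comult H h)"
  unfolding comult_snd_def
  by (rule tensor_map_pure[OF V module_H V module_HH module_hom_id comult_linear])

private lemma counit_smult_bilinear: "bilinear_map k V H V (\<lambda>v h. counit H h \<odot>\<^bsub>V\<^esub> v)"
  unfolding bilinear_map_def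
  using module_homD[OF counit_linear]
  by (simp add: V.smult_r_distr V.smult_l_distr V.smult_assoc1) (metis R.m_comm V.smult_assoc1)

lemma counit_snd_hom: "counit_snd H V \<in> module_hom k (tensor k V H) V"
  using tensor_lift_linear[OF V module_H V counit_smult_bilinear] by (simp add: counit_snd_def[abs_def])

lemma counit_snd_pure: "v \<in> carrier V \<Longrightarrow> h \<in> carrier H \<Longrightarrow>
    counit_snd H V (pure_tensor k V H v h) = counit H h \<odot>\<^bsub>V\<^esub> v"
  unfolding counit_snd_def by (rule tensor_lift_bilinear_pure[OF V module_H V counit_smult_bilinear])

context
  fixes \<rho>
  assumes \<rho>: "\<rho> \<in> module_hom k V (tensor k V H)"
begin

lemma coact_fst_hom:
  "coact_fst k H V \<rho> \<in> module_hom k (tensor k V H) (tensor k V (tensor k H H))"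
  using module_hom_comp[OF tensor_map_hom[OF V module_H module_tensor[OF V module_H] module_H
        \<rho> module_hom_id] tensor_assoc_hom[OF V module_H module_H]]
  by (simp add: coact_fst_def[abs_def])

lemma coact_fst_pure: "v \<in> carrier V \<Longrightarrow> h \<in> carrier H \<Longrightarrow>
    coact_fst k H V \<rho> (pure_tensor k V H v h) =
    tensor_assoc k V H H (pure_tensor k (tensor k V H) H (\<rho> v) h)"
  by (simp add: coact_fst_def tensor_map_pure[OF V module_H module_tensor[OF V module_H] module_H
        \<rho> module_hom_id])

end

end

section \<open>Compatibility of comultiplication, counit and coactions with pairings\<close>

context
  fixes U :: "('k, 'u, 'u1) module_scheme" and V :: "('k, 'v, 'v1) module_scheme"
    and W :: "('k, 'w, 'w1) module_scheme" and f
  assumes U: "module k U" and V: "module k V" and W: "module k W"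
    and f: "bilinear_map k U V W f"
begin

interpretation W: module k W by (rule W)

lemma pairing_bilinear: "bilinear_map k (tensor k U H) (tensor k V H) (tensor k W H)
    (pairing W f)"
  by (rule tensor_pairing_bilinear[OF U module_H V module_H W module_H f bilinear_mult[OF algebra_H]])

lemma pairing_pure:
  "u \<in> carrier U \<Longrightarrow> h \<in> carrier H \<Longrightarrow> v \<in> carrier V \<Longrightarrow> l \<in> carrier H \<Longrightarrow>
    pairing W f (pure_tensor k U H u h) (pure_tensor k V H v l) =
    pure_tensor k W H (f u v) (h \<otimes>\<^bsub>H\<^esub> l)"
  by (rule tensor_pairing_pure[OF U module_H V module_H W module_H f bilinear_mult[OF algebra_H]])

private lemma mult_HH: "bilinear_map k (tensor k H H) (tensor k H H) (tensor k H H)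
    (monoid.mult (tensor_algebra k H H))"
  using pairing_bilinear bilinear_mult[OF algebra_HH]
  by (simp add: bilinear_map_def tensor_algebra_simps)

lemma pairing3_bilinear: "bilinear_map k (tensor k U (tensor k H H)) (tensor k V (tensor k H H))
    (tensor k W (tensor k H H))
    (pairing3 W f)"
  by (rule tensor_pairing_bilinear[OF U module_HH V module_HH W module_HH f mult_HH])

lemma pairing3_pure:
  "u \<in> carrier U \<Longrightarrow> x \<in> carrier (tensor k H H) \<Longrightarrow> v \<in> carrier V \<Longrightarrow> y \<in> carrier (tensor k H H) \<Longrightarrow>
    pairing3 W f
      (pure_tensor k U (tensor k H H) u x) (pure_tensor k V (tensor k H H) v y) =
    pure_tensor k W (tensor k H H) (f u v) (x \<otimes>\<^bsub>tensor_algebra k H H\<^esub> y)"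
  by (rule tensor_pairing_pure[OF U module_HH V module_HH W module_HH f mult_HH])

private lemmas pairing_simps = bilinear_mapD[OF pairing_bilinear] pairing_pure
  bilinear_mapD[OF pairing3_bilinear] pairing3_pure bilinear_mapD[OF f] H_mult_closed
  pure_tensor_closed[OF U module_H] pure_tensor_closed[OF V module_H] pure_tensor_closed[OF W module_H]
  pure_tensor_closed[OF U module_HH] pure_tensor_closed[OF V module_HH]

text \<open>Multiplicativity of \<Delta>, spread from pure tensors by additivity in both
  arguments.\<close>

lemma comult_snd_pairing:
  assumes X: "X \<in> carrier (tensor k U H)" and Y: "Y \<in> carrier (tensor k V H)"
  shows "comult_snd k H W (pairing W f X Y) =
    pairing3 W f
      (comult_snd k H U X) (comult_snd k H V Y)"
  using U module_H X
proof (induction X rule: tensor_induct)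
  case X: (pure u h)
  show ?case
    using V module_H Y
    by (induction Y rule: tensor_induct)
      (use X in \<open>simp_all add: pairing_simps comult_snd_pure[OF U] comult_snd_pure[OF V]
        comult_snd_pure[OF W] comult_closed comult_mult module_homD[OF comult_snd_hom[OF U]]
        module_homD[OF comult_snd_hom[OF V]] module_homD[OF comult_snd_hom[OF W]]\<close>)
qed (use Y in \<open>simp_all add: pairing_simps module_homD[OF comult_snd_hom[OF U]]
        module_homD[OF comult_snd_hom[OF V]] module_homD[OF comult_snd_hom[OF W]]\<close>)

text \<open>Multiplicativity of \<epsilon>: on pure tensors both sides are f u v scaled by the
  product of the two counit values.\<close>

lemma counit_snd_pairing:
  assumes X: "X \<in> carrier (tensor k U H)" and Y: "Y \<in> carrier (tensor k V H)"
  shows "counit_snd H W (pairing W f X Y) =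
    f (counit_snd H U X) (counit_snd H V Y)"
proof -
  interpret U: module k U by (rule U)
  interpret V: module k V by (rule V)
  have comm: "a \<odot>\<^bsub>W\<^esub> (b \<odot>\<^bsub>W\<^esub> w) = b \<odot>\<^bsub>W\<^esub> (a \<odot>\<^bsub>W\<^esub> w)"
    if "a \<in> carrier k" "b \<in> carrier k" "w \<in> carrier W" for a b w
    using that by (metis R.m_comm W.smult_assoc1)
  show ?thesis
    using U module_H X
  proof (induction X rule: tensor_induct)
    case X: (pure u h)
    show ?case
      using V module_H Y
      by (induction Y rule: tensor_induct)
        (use X in \<open>simp_all add: pairing_simps counit_snd_pure[OF U] counit_snd_pure[OF V]
          counit_snd_pure[OF W] counit_closed counit_mult module_homD[OF counit_snd_hom[OF U]]
          module_homD[OF counit_snd_hom[OF V]] module_homD[OF counit_snd_hom[OF W]] W.smult_assoc1 comm\<close>)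
  qed (use Y in \<open>simp_all add: pairing_simps module_homD[OF counit_snd_hom[OF U]]
          module_homD[OF counit_snd_hom[OF V]] module_homD[OF counit_snd_hom[OF W]]\<close>)
qed

text \<open>When \<rho> is applied to the first leg of u \<otimes> h, the result \<rho>(u) \<otimes>
  h has a first leg that is no longer pure. Rebracketing must therefore be shown multiplicative for
  arbitrary first legs \<open>X\<close> and \<open>Y\<close>.\<close>

lemma tensor_assoc_pairing:
  assumes X: "X \<in> carrier (tensor k U H)" and Y: "Y \<in> carrier (tensor k V H)"
    and hl: "h \<in> carrier H" "l \<in> carrier H"
  shows "tensor_assoc k W H H (pure_tensor k (tensor k W H) H
      (pairing W f X Y) (h \<otimes>\<^bsub>H\<^esub> l)) =
    pairing3 W f
      (tensor_assoc k U H H (pure_tensor k (tensor k U H) H X h))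
      (tensor_assoc k V H H (pure_tensor k (tensor k V H) H Y l))"
proof -
  note bil = pure_tensor_closed[OF module_tensor[OF U module_H] module_H]
    pure_tensor_closed[OF module_tensor[OF V module_H] module_H]
    pure_tensor_closed[OF module_tensor[OF W module_H] module_H]
    pure_tensor_add_left[OF module_tensor[OF U module_H] module_H]
    pure_tensor_add_left[OF module_tensor[OF V module_H] module_H]
    pure_tensor_add_left[OF module_tensor[OF W module_H] module_H]
    module_homD[OF tensor_assoc_hom[OF U module_H module_H]]
    module_homD[OF tensor_assoc_hom[OF V module_H module_H]]
    module_homD[OF tensor_assoc_hom[OF W module_H module_H]]
  have HH: "pure_tensor k H H a b \<otimes>\<^bsub>tensor_algebra k H H\<^esub> pure_tensor k H H c d =
      pure_tensor k H H (a \<otimes>\<^bsub>H\<^esub> c) (b \<otimes>\<^bsub>H\<^esub> d)"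
    if "a \<in> carrier H" "b \<in> carrier H" "c \<in> carrier H" "d \<in> carrier H" for a b c d
    unfolding tensor_algebra_simps
    by (rule tensor_pairing_pure[OF module_H module_H module_H module_H module_H module_H
          bilinear_mult[OF algebra_H] bilinear_mult[OF algebra_H]]) fact+
  show ?thesis
    using U module_H X
  proof (induction X rule: tensor_induct)
    case X: (pure u a)
    show ?case
      using V module_H Y
      by (induction Y rule: tensor_induct)
        (use X hl in \<open>simp_all add: pairing_simps bil HH tensor_assoc_pure[OF U module_H module_H]
          tensor_assoc_pure[OF V module_H module_H] tensor_assoc_pure[OF W module_H module_H]
          pure_tensor_closed[OF module_H module_H]\<close>)
  qed (use Y hl in \<open>simp_all add: pairing_simps bil\<close>)
qed

context
  fixes \<rho> \<sigma> \<tau>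
  assumes \<rho>: "\<rho> \<in> module_hom k U (tensor k U H)" and \<sigma>: "\<sigma> \<in> module_hom k V (tensor k V H)"
    and \<tau>: "\<tau> \<in> module_hom k W (tensor k W H)"
    and f_colinear: "\<And>u v. u \<in> carrier U \<Longrightarrow> v \<in> carrier V \<Longrightarrow>
      \<tau> (f u v) = pairing W f (\<rho> u) (\<sigma> v)"
begin

text \<open>On pure tensors, colinearity of \<open>f\<close> splits \<tau> (f u v) into a pairing of
  \<rho>(u) and \<sigma>(v), and \<open>tensor_assoc_pairing\<close> separates the two
  factors.\<close>

lemma coact_fst_pairing:
  assumes X: "X \<in> carrier (tensor k U H)" and Y: "Y \<in> carrier (tensor k V H)"
  shows "coact_fst k H W \<tau> (pairing W f X Y) =
    pairing3 W f
      (coact_fst k H U \<rho> X) (coact_fst k H V \<sigma> Y)"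
  using U module_H X
proof (induction X rule: tensor_induct)
  case X: (pure u h)
  show ?case
    using V module_H Y
    by (induction Y rule: tensor_induct)
      (use X in \<open>simp_all add: pairing_simps coact_fst_pure[OF U \<rho>] coact_fst_pure[OF V \<sigma>]
        coact_fst_pure[OF W \<tau>] f_colinear tensor_assoc_pairing module_homD[OF coact_fst_hom[OF U \<rho>]]
        module_homD[OF coact_fst_hom[OF V \<sigma>]] module_homD[OF coact_fst_hom[OF W \<tau>]]
        module_homD(1)[OF \<rho>] module_homD(1)[OF \<sigma>]
        module_homD(1)[OF tensor_assoc_hom[OF U module_H module_H]]
        pure_tensor_closed[OF module_tensor[OF U module_H] module_H]\<close>)
qed (use Y in \<open>simp_all add: pairing_simps module_homD[OF coact_fst_hom[OF U \<rho>]]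
        module_homD[OF coact_fst_hom[OF V \<sigma>]] module_homD[OF coact_fst_hom[OF W \<tau>]]\<close>)

lemma coassoc_bilinear:
  assumes uv: "u \<in> carrier U" "v \<in> carrier V"
    and "coact_fst k H U \<rho> (\<rho> u) = comult_snd k H U (\<rho> u)"
    and "coact_fst k H V \<sigma> (\<sigma> v) = comult_snd k H V (\<sigma> v)"
  shows "coact_fst k H W \<tau> (\<tau> (f u v)) = comult_snd k H W (\<tau> (f u v))"
  using assms by (simp add: f_colinear coact_fst_pairing comult_snd_pairing
      module_homD(1)[OF \<rho>] module_homD(1)[OF \<sigma>])

lemma counit_bilinear:
  assumes uv: "u \<in> carrier U" "v \<in> carrier V"
    and "counit_snd H U (\<rho> u) = u" and "counit_snd H V (\<sigma> v) = v"
  shows "counit_snd H W (\<tau> (f u v)) = f u v"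
  using assms by (simp add: f_colinear counit_snd_pairing module_homD(1)[OF \<rho>] module_homD(1)[OF \<sigma>])

end

end

text \<open>Naturality of the pairing. On pure tensors both sides are \<theta> (f u v) \<otimes> h
  l. Transport of structure, replacement of \<open>f\<close> by a map with the same values, and
  composition with a linear map are all special cases.\<close>

lemma tensor_map_pairing:
  assumes U: "module k U" and V: "module k V" and W: "module k W"
    and U': "module k U'" and V': "module k V'" and W': "module k W'"
    and f: "bilinear_map k U V W f" and f': "bilinear_map k U' V' W' f'"
    and \<phi>: "\<phi> \<in> module_hom k U U'" and \<psi>: "\<psi> \<in> module_hom k V V'" and \<theta>: "\<theta> \<in> module_hom k W W'"
    and eq: "\<And>u v. u \<in> carrier U \<Longrightarrow> v \<in> carrier V \<Longrightarrow> \<theta> (f u v) = f' (\<phi> u) (\<psi> v)"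
    and X: "X \<in> carrier (tensor k U H)" and Y: "Y \<in> carrier (tensor k V H)"
  shows "tensor_map k W' H \<theta> (\<lambda>h. h) (pairing W f X Y) =
    pairing W' f'
      (tensor_map k U' H \<phi> (\<lambda>h. h) X) (tensor_map k V' H \<psi> (\<lambda>h. h) Y)"
proof -
  note s = bilinear_mapD[OF pairing_bilinear[OF U V W f]] bilinear_mapD[OF pairing_bilinear[OF U' V' W' f']]
    pairing_pure[OF U V W f] pairing_pure[OF U' V' W' f'] H_mult_closed
    tensor_map_pure[OF U module_H U' module_H \<phi> module_hom_id]
    tensor_map_pure[OF V module_H V' module_H \<psi> module_hom_id]
    tensor_map_pure[OF W module_H W' module_H \<theta> module_hom_id]
    module_homD[OF tensor_map_hom[OF U module_H U' module_H \<phi> module_hom_id]]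
    module_homD[OF tensor_map_hom[OF V module_H V' module_H \<psi> module_hom_id]]
    module_homD[OF tensor_map_hom[OF W module_H W' module_H \<theta> module_hom_id]]
    pure_tensor_closed[OF U module_H] pure_tensor_closed[OF V module_H] pure_tensor_closed[OF W module_H]
    pure_tensor_closed[OF U' module_H] pure_tensor_closed[OF V' module_H]
    module_homD(1)[OF \<phi>] module_homD(1)[OF \<psi>] bilinear_mapD[OF f]
  show ?thesis
    using U module_H X
  proof (induction X rule: tensor_induct)
    case X: (pure u h)
    show ?case
      using V module_H Y
      by (induction Y rule: tensor_induct) (use X eq in \<open>simp_all add: s\<close>)
  qed (use Y in \<open>simp_all add: s\<close>)
qed

text \<open>The map F = f \<otimes> id intertwines \<open>comult_snd\<close>,
  \<open>counit_snd\<close> and, for the old and the new coaction, \<open>coact_fst\<close>.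
  Applying F or \<open>f\<close> to the axioms of \<rho> at \<open>g w\<close> therefore gives those
  of the new coaction at \<open>w\<close>.\<close>

lemma right_coaction_transport:
  assumes V: "module k V" and W: "module k W" and f: "f \<in> module_hom k V W" and g: "g \<in> module_hom k W V"
    and fg: "\<And>w. w \<in> carrier W \<Longrightarrow> f (g w) = w"
    and gf: "\<And>v. v \<in> carrier V \<Longrightarrow> g (f v) = v"
    and \<rho>: "right_coaction k H V \<rho>"
  shows "right_coaction k H W (\<lambda>w. map_fst W f (\<rho> (g w)))"
proof -
  define F where "F = map_fst W f"
  define \<sigma> where "\<sigma> w = F (\<rho> (g w))" for w
  note \<rho>D = right_coactionD[OF \<rho>]
  note F = tensor_map_hom[OF V module_H W module_H f module_hom_id, folded F_def]
  note F_pure = tensor_map_pure[OF V module_H W module_H f module_hom_id, folded F_def]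
  have \<sigma>: "\<sigma> \<in> module_hom k W (tensor k W H)"
    using module_hom_comp[OF g module_hom_comp[OF \<rho>D(1) F]] by (simp add: \<sigma>_def[abs_def])
  note F3 = tensor_map_hom[OF V module_HH W module_HH f module_hom_id]
  note F3_pure = tensor_map_pure[OF V module_HH W module_HH f module_hom_id]
  note s = module_homD[OF F] F_pure module_homD[OF F3] F3_pure module_homD(1)[OF f]
  have D: "comult_snd k H W (F X) = tensor_map k W (tensor k H H) f (\<lambda>h. h) (comult_snd k H V X)"
    if "X \<in> carrier (tensor k V H)" for X
    by (rule tensor_hom_eqI[OF V module_H module_hom_comp[OF F comult_snd_hom[OF W]]
          module_hom_comp[OF comult_snd_hom[OF V] F3] _ that])
      (simp add: s comult_snd_pure[OF V] comult_snd_pure[OF W] comult_closed)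
  have E: "counit_snd H W (F X) = f (counit_snd H V X)" if "X \<in> carrier (tensor k V H)" for X
    by (rule tensor_hom_eqI[OF V module_H module_hom_comp[OF F counit_snd_hom[OF W]]
          module_hom_comp[OF counit_snd_hom[OF V] f] _ that])
      (simp add: s counit_snd_pure[OF V] counit_snd_pure[OF W] counit_closed module_homD[OF f])
  have assoc: "tensor_assoc k W H H (pure_tensor k (tensor k W H) H (F X) h) =
      tensor_map k W (tensor k H H) f (\<lambda>h. h) (tensor_assoc k V H H (pure_tensor k (tensor k V H) H X h))"
    if X: "X \<in> carrier (tensor k V H)" and h: "h \<in> carrier H" for X h
    using V module_H X
    by (induction X rule: tensor_induct)
      (use h in \<open>simp_all add: s tensor_assoc_pure[OF V module_H module_H]
        tensor_assoc_pure[OF W module_H module_H] pure_tensor_closed[OF module_H module_H]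
        pure_tensor_add_left[OF module_tensor[OF V module_H] module_H]
        pure_tensor_add_left[OF module_tensor[OF W module_H] module_H]
        pure_tensor_closed[OF module_tensor[OF V module_H] module_H]
        pure_tensor_closed[OF module_tensor[OF W module_H] module_H]
        module_homD[OF tensor_assoc_hom[OF V module_H module_H]]
        module_homD[OF tensor_assoc_hom[OF W module_H module_H]]\<close>)
  \<comment> \<open>Here \<open>g (f v) = v\<close> is needed: the new coaction at
    \<open>f v\<close> is F applied to \<rho>(v).\<close>
  have L: "coact_fst k H W \<sigma> (F X) = tensor_map k W (tensor k H H) f (\<lambda>h. h) (coact_fst k H V \<rho> X)"
    if "X \<in> carrier (tensor k V H)" for X
    by (rule tensor_hom_eqI[OF V module_H module_hom_comp[OF F coact_fst_hom[OF W \<sigma>]]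
          module_hom_comp[OF coact_fst_hom[OF V \<rho>D(1)] F3] _ that])
      (simp add: s coact_fst_pure[OF V \<rho>D(1)] coact_fst_pure[OF W \<sigma>],
        simp add: \<sigma>_def gf assoc module_homD(1)[OF \<rho>D(1)])
  have "right_coaction k H W \<sigma>"
    unfolding right_coaction_iff
  proof (intro conjI ballI \<sigma>)
    fix w assume "w \<in> carrier W"
    then have w: "g w \<in> carrier V" "\<rho> (g w) \<in> carrier (tensor k V H)" "f (g w) = w"
      by (simp_all add: module_homD(1)[OF \<rho>D(1)] module_homD(1)[OF g] fg)
    show "coact_fst k H W \<sigma> (\<sigma> w) = comult_snd k H W (\<sigma> w)"
      unfolding \<sigma>_def[of w] using w by (simp add: L D \<rho>D)
    show "counit_snd H W (\<sigma> w) = w"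
      unfolding \<sigma>_def[of w] using w by (simp add: E \<rho>D)
  qed
  then show ?thesis by (simp add: \<sigma>_def[abs_def] F_def)
qed

end

section \<open>Tensor products and coactions of modules that agree on carriers\<close>

lemma lift_to_group_cong:
  assumes "carrier G' = carrier G" "monoid.mult G' = monoid.mult G" "\<one>\<^bsub>G'\<^esub> = \<one>\<^bsub>G\<^esub>"
  shows "lift_to_group G' f = lift_to_group G f"
  using assms
  by (intro ext) (simp add: lift_to_group_def finprod_def int_pow_def nat_pow_def m_inv_def Let_def cong: if_cong)

lemma tensor_lift_cong:
  assumes "carrier P' = carrier P" "add P' = add P" "\<zero>\<^bsub>P'\<^esub> = \<zero>\<^bsub>P\<^esub>"
  shows "tensor_lift P' = tensor_lift P"
  unfolding tensor_lift_def[abs_def] by (intro ext, subst lift_to_group_cong) (simp_all add: assms)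

context
  fixes R :: "('r, 'x) ring_scheme" and V :: "('r, 'v, 'v1) module_scheme"
    and V' :: "('r, 'v, 'v2) module_scheme"
  assumes V: "module R V"
    and eq: "carrier V' = carrier V" "add V' = add V" "\<zero>\<^bsub>V'\<^esub> = \<zero>\<^bsub>V\<^esub>"
    and smult: "\<forall>r \<in> carrier R. \<forall>x \<in> carrier V. r \<odot>\<^bsub>V'\<^esub> x = r \<odot>\<^bsub>V\<^esub> x"
begin

private lemma V': "module R V'"
  by (rule module_cong[OF V eq]) (simp add: smult)

text \<open>All of these are equalities of the objects themselves, so they can be used for
  rewriting. For scalar multiplication, agreement is obtained only over the carriers; see
  \<open>tensor_cong_smult\<close>.\<close>

lemma tensor_cong:
  shows "carrier (tensor R V' N) = carrier (tensor R V N)"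
    and "add (tensor R V' N) = add (tensor R V N)"
    and "\<zero>\<^bsub>tensor R V' N\<^esub> = \<zero>\<^bsub>tensor R V N\<^esub>"
    and "pure_tensor R V' N = pure_tensor R V N"
    and "tensor_lift (tensor R V' N) = tensor_lift (tensor R V N)"
    and "tensor_map R V' N = tensor_map R V N"
    and "tensor_pairing R V' N = tensor_pairing R V N"
proof -
  have "tensor_free V' N = tensor_free V N"
    by (rule tensor_kernel_cong(1)[where R = R]) (simp_all add: eq smult)
  moreover have "tensor_kernel R V' N = tensor_kernel R V N"
    by (rule tensor_kernel_cong(2)) (simp_all add: eq smult)
  ultimately have k: "tensor_free V' N = tensor_free V N" "tensor_kernel R V' N = tensor_kernel R V N"
    by blast+
  have g: "tensor_group R V' N = tensor_group R V N" using k by (simp add: tensor_group_def)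
  show pure: "pure_tensor R V' N = pure_tensor R V N"
    using k by (simp add: pure_tensor_def[abs_def])
  show c: "carrier (tensor R V' N) = carrier (tensor R V N)"
    and a: "add (tensor R V' N) = add (tensor R V N)"
    and z: "\<zero>\<^bsub>tensor R V' N\<^esub> = \<zero>\<^bsub>tensor R V N\<^esub>"
    using k by (simp_all add: tensor_def Let_def)
  show lift: "tensor_lift (tensor R V' N) = tensor_lift (tensor R V N)"
    using c a z by (rule tensor_lift_cong)
  show "tensor_map R V' N = tensor_map R V N"
    by (intro ext) (simp add: tensor_map_def lift pure)
  show "tensor_pairing R V' N = tensor_pairing R V N"
    by (intro ext) (simp add: tensor_pairing_def lift pure)
qed

lemma tensor_cong_smult:
  assumes N: "module R N" and "r \<in> carrier R" "X \<in> carrier (tensor R V N)"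
  shows "r \<odot>\<^bsub>tensor R V' N\<^esub> X = r \<odot>\<^bsub>tensor R V N\<^esub> X"
proof -
  interpret T: module R "tensor R V N" by (rule module_tensor[OF V N])
  interpret T': module R "tensor R V' N" by (rule module_tensor[OF V' N])
  note d = T'.smult_r_distr[unfolded tensor_cong]
  show ?thesis
    using V N assms(3)
  proof (induction X rule: tensor_induct)
    case (pure v n)
    then show ?case
      using smult_pure_tensor[OF V' N, of r v n] smult_pure_tensor[OF V N, of r v n] assms(2)
      by (simp add: tensor_cong eq smult)
  next
    case (add X Y)
    then show ?case using d[of r X Y] T.smult_r_distr[of r X Y] assms(2) by simp
  qed
qed

end

context comm_bialgebra
begin

context
  fixes V :: "('k, 'v, 'v1) module_scheme" and V' :: "('k, 'v, 'v2) module_scheme"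
  assumes V: "module k V"
    and eq: "carrier V' = carrier V" "add V' = add V" "\<zero>\<^bsub>V'\<^esub> = \<zero>\<^bsub>V\<^esub>"
    and smult: "\<forall>r \<in> carrier k. \<forall>x \<in> carrier V. r \<odot>\<^bsub>V'\<^esub> x = r \<odot>\<^bsub>V\<^esub> x"
begin

private lemma V': "module k V'"
  by (rule module_cong[OF V eq]) (simp add: smult)

lemma coact_fst_cong: "coact_fst k H V' \<rho> = coact_fst k H V \<rho>"
proof -
  note c = tensor_cong[OF V eq smult]
  \<comment> \<open>The congruence for tensor maps is applied one level up, with V' \<otimes> H and
    V \<otimes> H as the two modules that agree on carriers.\<close>
  have "tensor_map k (tensor k V' H) H \<rho> (\<lambda>h. h) X = tensor_map k (tensor k V H) H \<rho> (\<lambda>h. h) X" for X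
    by (subst tensor_cong(6)[OF module_tensor[OF V module_H] c(1-3)])
      (simp_all add: tensor_cong_smult[OF V eq smult module_H])
  moreover have "tensor_assoc k V' H H X = tensor_assoc k V H H X" for X
    by (simp add: tensor_assoc_def Let_def c)
  ultimately show ?thesis by (intro ext) (simp add: coact_fst_def)
qed

lemma comult_snd_cong: "comult_snd k H V' = comult_snd k H V"
  by (intro ext) (simp add: comult_snd_def tensor_cong[OF V eq smult])

lemma counit_snd_cong:
  assumes "X \<in> carrier (tensor k V H)"
  shows "counit_snd H V' X = counit_snd H V X"
proof -
  note h = module_homD[OF counit_snd_hom[OF V']] counit_snd_pure[OF V']
  note h' = h[unfolded tensor_cong[OF V eq smult] eq]
  show ?thesis
    using V module_H assms
    by (induction X rule: tensor_induct)
      (simp_all add: h' counit_snd_pure[OF V] module_homD[OF counit_snd_hom[OF V]] smult counit_closed)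
qed

lemma right_coaction_cong: "right_coaction k H V' \<rho> \<longleftrightarrow> right_coaction k H V \<rho>"
proof -
  interpret V: module k V by (rule V)
  have "\<rho> \<in> module_hom k V' (tensor k V' H) \<longleftrightarrow> \<rho> \<in> module_hom k V (tensor k V H)"
    unfolding module_hom_def
    by (auto simp: tensor_cong[OF V eq smult] eq smult tensor_cong_smult[OF V eq smult module_H] Pi_iff)
  moreover have "counit_snd H V' (\<rho> v) = counit_snd H V (\<rho> v)"
    if "v \<in> carrier V" "\<rho> \<in> module_hom k V (tensor k V H)" for v
    using that by (intro counit_snd_cong) (rule module_homD(1))
  ultimately show ?thesis
    unfolding right_coaction_iff coact_fst_cong comult_snd_cong eq by auto
qed

end

section \<open>Formal rules for pairings\<close>

lemma pairing_cong:
  assumes U: "module k U" and V: "module k V" and W: "module k W"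
    and f: "bilinear_map k U V W f" and f': "bilinear_map k U V W f'"
    and eq: "\<And>u v. u \<in> carrier U \<Longrightarrow> v \<in> carrier V \<Longrightarrow> f u v = f' u v"
    and X: "X \<in> carrier (tensor k U H)" and Y: "Y \<in> carrier (tensor k V H)"
  shows "pairing W f X Y = pairing W f' X Y"
  using tensor_map_pairing[OF U V W U V W f f' module_hom_id module_hom_id module_hom_id eq X Y]
    bilinear_mapD(1)[OF pairing_bilinear[OF U V W f] X Y]
  by (simp add: tensor_map_id[OF U module_H U module_H X] tensor_map_id[OF V module_H V module_H Y]
      tensor_map_id[OF W module_H W module_H])

lemma tensor_map_pairing_comp:
  assumes U: "module k U" and V: "module k V" and W: "module k W" and W': "module k W'"
    and f: "bilinear_map k U V W f" and f': "bilinear_map k U V W' f'"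
    and \<theta>: "\<theta> \<in> module_hom k W W'"
    and eq: "\<And>u v. u \<in> carrier U \<Longrightarrow> v \<in> carrier V \<Longrightarrow> \<theta> (f u v) = f' u v"
    and X: "X \<in> carrier (tensor k U H)" and Y: "Y \<in> carrier (tensor k V H)"
  shows "tensor_map k W' H \<theta> (\<lambda>h. h) (pairing W f X Y) =
    pairing W' f' X Y"
  using tensor_map_pairing[OF U V W U V W' f f' module_hom_id module_hom_id \<theta> eq X Y]
  by (simp add: tensor_map_id[OF U module_H U module_H X] tensor_map_id[OF V module_H V module_H Y])

text \<open>This rests on commutativity of H. It is the source of the symmetry of the tensor product
  of relative Hopf modules.\<close>

lemma pairing_comm:
  assumes U: "module k U" and V: "module k V" and W: "module k W"
    and f: "bilinear_map k U V W f" and f': "bilinear_map k V U W f'"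
    and eq: "\<And>u v. u \<in> carrier U \<Longrightarrow> v \<in> carrier V \<Longrightarrow> f u v = f' v u"
    and X: "X \<in> carrier (tensor k U H)" and Y: "Y \<in> carrier (tensor k V H)"
  shows "pairing W f X Y = pairing W f' Y X"
proof -
  note s = bilinear_mapD[OF pairing_bilinear[OF U V W f]] bilinear_mapD[OF pairing_bilinear[OF V U W f']]
    pairing_pure[OF U V W f] pairing_pure[OF V U W f'] pure_tensor_closed[OF U module_H]
    pure_tensor_closed[OF V module_H]
  show ?thesis
    using U module_H X
  proof (induction X rule: tensor_induct)
    case X: (pure u h)
    show ?case
      using V module_H Y
      by (induction Y rule: tensor_induct) (use X in \<open>simp_all add: s eq H_mult_comm\<close>)
  qed (use Y in \<open>simp_all add: s\<close>)
qed

text \<open>On pure tensors this is \<open>eq\<close> on the first legs and associativity of H on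
  the second ones. Different choices of the four maps give the balancedness over A, the
  A-compatibility and the associativity of the coaction on tensor products.\<close>

lemma pairing_assoc:
  assumes U: "module k U" and V: "module k V" and Z: "module k Z"
    and UV: "module k UV" and VZ: "module k VZ" and W: "module k W"
    and f: "bilinear_map k U V UV f" and g: "bilinear_map k UV Z W g"
    and f': "bilinear_map k V Z VZ f'" and g': "bilinear_map k U VZ W g'"
    and eq: "\<And>u v z. u \<in> carrier U \<Longrightarrow> v \<in> carrier V \<Longrightarrow> z \<in> carrier Z \<Longrightarrow> g (f u v) z = g' u (f' v z)"
    and X: "X \<in> carrier (tensor k U H)" and Y: "Y \<in> carrier (tensor k V H)"
    and T: "T \<in> carrier (tensor k Z H)"
  shows "pairing W g (pairing UV f X Y) T =
    pairing W g' X (pairing VZ f' Y T)"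
proof -
  note s = bilinear_mapD[OF pairing_bilinear[OF U V UV f]] bilinear_mapD[OF pairing_bilinear[OF UV Z W g]]
    bilinear_mapD[OF pairing_bilinear[OF V Z VZ f']] bilinear_mapD[OF pairing_bilinear[OF U VZ W g']]
    pairing_pure[OF U V UV f] pairing_pure[OF UV Z W g] pairing_pure[OF V Z VZ f'] pairing_pure[OF U VZ W g']
    pure_tensor_closed[OF U module_H] pure_tensor_closed[OF V module_H] pure_tensor_closed[OF Z module_H]
    pure_tensor_closed[OF UV module_H] pure_tensor_closed[OF VZ module_H]
    bilinear_mapD(1)[OF f] bilinear_mapD(1)[OF f'] H_mult_closed
  show ?thesis
    using U module_H X
  proof (induction X rule: tensor_induct)
    case X: (pure u h)
    show ?case
      using V module_H Y
    proof (induction Y rule: tensor_induct)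
      case Y: (pure v l)
      show ?case
        using Z module_H T
        by (induction T rule: tensor_induct) (use X Y in \<open>simp_all add: s eq H_mult_assoc\<close>)
    qed (use X T in \<open>simp_all add: s\<close>)
  qed (use Y T in \<open>simp_all add: s\<close>)
qed

end

section \<open>Relative Hopf modules\<close>

lemma restrict_scalars_simps [simp]:
  "carrier (restrict_scalars A M) = carrier M"
  "add (restrict_scalars A M) = add M"
  "\<zero>\<^bsub>restrict_scalars A M\<^esub> = \<zero>\<^bsub>M\<^esub>"
  "c \<odot>\<^bsub>restrict_scalars A M\<^esub> m = (c \<odot>\<^bsub>A\<^esub> \<one>\<^bsub>A\<^esub>) \<odot>\<^bsub>M\<^esub> m"
  by (simp_all add: restrict_scalars_def)

lemma with_coaction_simps [simp]:
  "carrier (with_coaction M \<rho>) = carrier M"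
  "add (with_coaction M \<rho>) = add M"
  "\<zero>\<^bsub>with_coaction M \<rho>\<^esub> = \<zero>\<^bsub>M\<^esub>"
  "smult (with_coaction M \<rho>) = smult M"
  "coact (with_coaction M \<rho>) = \<rho>"
  "restrict_scalars A (with_coaction M \<rho>) = restrict_scalars A M"
  by (simp_all add: with_coaction_def module.extend_def comod.fields_def restrict_scalars_def)

locale comodule_algebra_setting = comm_bialgebra k H
  for k :: "'k ring" and H :: "('k, 'h) bialgebra" +
  fixes A :: "('k, 'a, 'h) comod"
  assumes comodule_algebra: "comodule_algebra k H A"
begin

lemma algebra_A: "algebra k A"
  and right_coaction_A: "right_coaction k H A (coact A)"
  and coact_ring_hom: "coact A \<in> ring_hom A (tensor_algebra k A H)"
  using comodule_algebra by (auto simp: comodule_algebra_def)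

sublocale A: algebra k A by (rule algebra_A)

lemma module_A: "module k A" by (rule A.module)

lemma cring_A: "cring A" by (rule A.M_cring)

abbreviation mult_A (infixl \<open>\<cdot>\<close> 70) where "a \<cdot> b \<equiv> a \<otimes>\<^bsub>A\<^esub> b"

lemma A_mult_closed: "x \<in> carrier A \<Longrightarrow> y \<in> carrier A \<Longrightarrow> x \<cdot> y \<in> carrier A"
  by (rule cring.cring_simprules(5)[OF cring_A])

lemma A_one_closed: "\<one>\<^bsub>A\<^esub> \<in> carrier A"
  by (rule cring.cring_simprules(6)[OF cring_A])

lemma A_mult_comm: "x \<in> carrier A \<Longrightarrow> y \<in> carrier A \<Longrightarrow> x \<cdot> y = y \<cdot> x"
  by (rule cring.cring_simprules(14)[OF cring_A])

lemma A_mult_assoc: "x \<in> carrier A \<Longrightarrow> y \<in> carrier A \<Longrightarrow> z \<in> carrier A \<Longrightarrow>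
    x \<cdot> y \<cdot> z = x \<cdot> (y \<cdot> z)"
  by (rule cring.cring_simprules(11)[OF cring_A])

lemma A_one_mult: "x \<in> carrier A \<Longrightarrow> \<one>\<^bsub>A\<^esub> \<cdot> x = x"
  by (rule cring.cring_simprules(12)[OF cring_A])

lemma A_mult_one: "x \<in> carrier A \<Longrightarrow> x \<cdot> \<one>\<^bsub>A\<^esub> = x"
  using A_mult_comm[OF _ A_one_closed] A_one_mult by simp

abbreviation res :: "('a, 'm, 'y) module_scheme \<Rightarrow> ('k, 'm) module" where
  "res M \<equiv> restrict_scalars A M"

abbreviation act_pairing :: "('a, 'm, 'y) module_scheme \<Rightarrow> ('m, 'h) tensor \<Rightarrow> ('a, 'h) tensor \<Rightarrow> ('m, 'h) tensor"
  where "act_pairing M \<equiv> pairing (res M) (\<lambda>m a. a \<odot>\<^bsub>M\<^esub> m)"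

abbreviation pure_pairing :: "('a, 'm, 'y) module_scheme \<Rightarrow> ('a, 'n, 'z) module_scheme \<Rightarrow>
    ('m, 'h) tensor \<Rightarrow> ('n, 'h) tensor \<Rightarrow> (('m, 'n) tensor, 'h) tensor"
  where "pure_pairing M N \<equiv>
    pairing (res (tensor A M N)) (pure_tensor A M N)"

abbreviation Hopf :: "('a, 'm, 'h) comod \<Rightarrow> bool" where "Hopf M \<equiv> relative_Hopf_module k H A M"

abbreviation Hopf_hom :: "('a, 'm, 'h) comod \<Rightarrow> ('a, 'n, 'h) comod \<Rightarrow> ('m \<Rightarrow> 'n) set" where
  "Hopf_hom M N \<equiv> relative_Hopf_hom k H A M N"

abbreviation hiso :: "('a, 'm, 'h) comod \<Rightarrow> ('a, 'n, 'h) comod \<Rightarrow> bool" where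
  "hiso M N \<equiv> relative_Hopf_iso k H A M N"

abbreviation tens :: "('a, 'm, 'h) comod \<Rightarrow> ('a, 'n, 'h) comod \<Rightarrow> ('a, ('m, 'n) tensor, 'h) comod" where
  "tens M N \<equiv> relative_Hopf_tensor k H A M N"

lemma scalar_closed: "c \<in> carrier k \<Longrightarrow> c \<odot>\<^bsub>A\<^esub> \<one>\<^bsub>A\<^esub> \<in> carrier A"
  by (simp add: A_one_closed)

lemma module_res:
  assumes M: "module A M"
  shows "module k (res M)"
proof -
  interpret M: module A M by (rule M)
  show ?thesis
  proof (rule moduleI)
    show "cring k" by (rule A.R_cring)
    show "abelian_group (res M)"
    proof (rule abelian_groupI)
      fix x assume "x \<in> carrier (res M)"
      then show "\<exists>y \<in> carrier (res M). y \<oplus>\<^bsub>res M\<^esub> x = \<zero>\<^bsub>res M\<^esub>"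
        using M.M.l_neg by auto
    next
      fix x y assume "x \<in> carrier (res M)" "y \<in> carrier (res M)"
      then show "x \<oplus>\<^bsub>res M\<^esub> y = y \<oplus>\<^bsub>res M\<^esub> x"
        using M.M.a_comm by simp
    qed (simp_all add: M.M.a_assoc)
  next
    fix a b x assume "a \<in> carrier k" "b \<in> carrier k" "x \<in> carrier (res M)"
    moreover from this have "(a \<otimes>\<^bsub>k\<^esub> b) \<odot>\<^bsub>A\<^esub> \<one>\<^bsub>A\<^esub> = (a \<odot>\<^bsub>A\<^esub> \<one>\<^bsub>A\<^esub>) \<cdot> (b \<odot>\<^bsub>A\<^esub> \<one>\<^bsub>A\<^esub>)"
      by (simp add: A.smult_assoc1 A.smult_assoc2 A_one_closed A_one_mult)
    ultimately show "(a \<otimes>\<^bsub>k\<^esub> b) \<odot>\<^bsub>res M\<^esub> x = a \<odot>\<^bsub>res M\<^esub> (b \<odot>\<^bsub>res M\<^esub> x)"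
      by (simp add: M.smult_assoc1 scalar_closed)
  qed (simp_all add: scalar_closed M.smult_r_distr A.smult_l_distr M.smult_l_distr A_one_closed)
qed

lemma module_hom_res: "f \<in> module_hom A M N \<Longrightarrow> f \<in> module_hom k (res M) (res N)"
  by (rule module_homI) (simp_all add: module_homD scalar_closed)

context
  fixes M :: "('a, 'm, 'm1) module_scheme"
  assumes M: "module A M"
begin

interpretation M: module A M by (rule M)

lemma scalar_mult_smult:
  assumes "c \<in> carrier k" "a \<in> carrier A" "m \<in> carrier M"
  shows "(c \<odot>\<^bsub>A\<^esub> a) \<odot>\<^bsub>M\<^esub> m = (c \<odot>\<^bsub>A\<^esub> \<one>\<^bsub>A\<^esub>) \<odot>\<^bsub>M\<^esub> (a \<odot>\<^bsub>M\<^esub> m)"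
    and "(c \<odot>\<^bsub>A\<^esub> a) \<odot>\<^bsub>M\<^esub> m = a \<odot>\<^bsub>M\<^esub> ((c \<odot>\<^bsub>A\<^esub> \<one>\<^bsub>A\<^esub>) \<odot>\<^bsub>M\<^esub> m)"
proof -
  have 1: "(c \<odot>\<^bsub>A\<^esub> \<one>\<^bsub>A\<^esub>) \<cdot> a = c \<odot>\<^bsub>A\<^esub> a"
    using assms by (simp add: A.smult_assoc2 A_one_closed A_one_mult)
  then have 2: "a \<cdot> (c \<odot>\<^bsub>A\<^esub> \<one>\<^bsub>A\<^esub>) = c \<odot>\<^bsub>A\<^esub> a"
    using assms A_mult_comm scalar_closed by simp
  show "(c \<odot>\<^bsub>A\<^esub> a) \<odot>\<^bsub>M\<^esub> m = (c \<odot>\<^bsub>A\<^esub> \<one>\<^bsub>A\<^esub>) \<odot>\<^bsub>M\<^esub> (a \<odot>\<^bsub>M\<^esub> m)"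
    using assms scalar_closed by (simp flip: 1 M.smult_assoc1)
  show "(c \<odot>\<^bsub>A\<^esub> a) \<odot>\<^bsub>M\<^esub> m = a \<odot>\<^bsub>M\<^esub> ((c \<odot>\<^bsub>A\<^esub> \<one>\<^bsub>A\<^esub>) \<odot>\<^bsub>M\<^esub> m)"
    using assms scalar_closed by (simp flip: 2 M.smult_assoc1)
qed

private lemma smult_scalar_comm:
  "c \<in> carrier k \<Longrightarrow> a \<in> carrier A \<Longrightarrow> m \<in> carrier M \<Longrightarrow>
    a \<odot>\<^bsub>M\<^esub> ((c \<odot>\<^bsub>A\<^esub> \<one>\<^bsub>A\<^esub>) \<odot>\<^bsub>M\<^esub> m) = (c \<odot>\<^bsub>A\<^esub> \<one>\<^bsub>A\<^esub>) \<odot>\<^bsub>M\<^esub> (a \<odot>\<^bsub>M\<^esub> m)"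
  using scalar_mult_smult[of c a m] by simp

lemma action_bilinear: "bilinear_map k (res M) A (res M) (\<lambda>m a. a \<odot>\<^bsub>M\<^esub> m)"
  unfolding bilinear_map_def
  by (simp add: M.smult_l_distr M.smult_r_distr smult_scalar_comm) (blast intro: scalar_mult_smult(1))

lemma left_action_bilinear: "bilinear_map k A (res M) (res M) (\<lambda>a m. a \<odot>\<^bsub>M\<^esub> m)"
  unfolding bilinear_map_def
  by (simp add: M.smult_l_distr M.smult_r_distr smult_scalar_comm) (blast intro: scalar_mult_smult(1))

end

lemma pure_tensor_bilinear_res:
  assumes M: "module A M" and N: "module A N"
  shows "bilinear_map k (res M) (res N) (res (tensor A M N)) (pure_tensor A M N)"
  using bilinear_pure_tensor[OF M N] scalar_closed unfolding bilinear_map_def by simp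

lemma relative_Hopf_moduleD:
  assumes "Hopf M"
  shows "module A M" and "right_coaction k H (res M) (coact M)"
    and "\<And>m a. m \<in> carrier M \<Longrightarrow> a \<in> carrier A \<Longrightarrow>
      coact M (a \<odot>\<^bsub>M\<^esub> m) = act_pairing M (coact M m) (coact A a)"
    and "coact M \<in> module_hom k (res M) (tensor k (res M) H)"
    and "\<And>m. m \<in> carrier M \<Longrightarrow> coact M m \<in> carrier (tensor k (res M) H)"
    and "module k (res M)"
proof -
  show "module A M" and 1: "right_coaction k H (res M) (coact M)"
    and "\<And>m a. m \<in> carrier M \<Longrightarrow> a \<in> carrier A \<Longrightarrow>
      coact M (a \<odot>\<^bsub>M\<^esub> m) = act_pairing M (coact M m) (coact A a)"
    using assms unfolding relative_Hopf_module_def by blast+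
  then show "coact M \<in> module_hom k (res M) (tensor k (res M) H)" "module k (res M)"
    by (simp_all add: right_coactionD(1) module_res)
  then show "coact M m \<in> carrier (tensor k (res M) H)" if "m \<in> carrier M" for m
    using module_homD(1) that by fastforce
qed

lemma coact_A_closed: "a \<in> carrier A \<Longrightarrow> coact A a \<in> carrier (tensor k A H)"
  by (rule module_homD(1)[OF right_coactionD(1)[OF right_coaction_A]])

section \<open>Morphisms and isomorphisms of relative Hopf modules\<close>

lemma relative_Hopf_homD:
  assumes "f \<in> Hopf_hom M N"
  shows "f \<in> module_hom A M N"
    and "\<And>m. m \<in> carrier M \<Longrightarrow> coact N (f m) = map_fst (res N) f (coact M m)"
  using assms unfolding relative_Hopf_hom_def by auto

lemma relative_Hopf_homI:
  assumes "f \<in> module_hom A M N"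
    and "\<And>m. m \<in> carrier M \<Longrightarrow> coact N (f m) = map_fst (res N) f (coact M m)"
  shows "f \<in> Hopf_hom M N"
  using assms unfolding relative_Hopf_hom_def by auto

lemma relative_Hopf_hom_id:
  assumes "Hopf M"
  shows "(\<lambda>x. x) \<in> Hopf_hom M M"
  using relative_Hopf_moduleD(5)[OF assms]
  by (intro relative_Hopf_homI[OF module_hom_id])
    (simp add: tensor_map_id[OF relative_Hopf_moduleD(6)[OF assms] module_H
      relative_Hopf_moduleD(6)[OF assms] module_H])

lemma relative_Hopf_hom_comp:
  assumes L: "Hopf L" and M: "Hopf M"
    and N: "Hopf N"
    and f: "f \<in> Hopf_hom L M" and g: "g \<in> Hopf_hom M N"
  shows "(\<lambda>x. g (f x)) \<in> Hopf_hom L N"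
proof (rule relative_Hopf_homI)
  note fD = relative_Hopf_homD[OF f] and gD = relative_Hopf_homD[OF g]
  show "(\<lambda>x. g (f x)) \<in> module_hom A L N" by (rule module_hom_comp[OF fD(1) gD(1)])
  fix x assume x: "x \<in> carrier L"
  then have "coact N (g (f x)) = map_fst (res N) g
      (map_fst (res M) f (coact L x))"
    by (simp add: fD gD module_homD(1)[OF fD(1)])
  also have "\<dots> = map_fst (res N) (\<lambda>x. g (f x)) (coact L x)"
    by (rule tensor_map_comp[OF relative_Hopf_moduleD(6)[OF L] module_H relative_Hopf_moduleD(6)[OF M]
          module_H relative_Hopf_moduleD(6)[OF N] module_H module_hom_res[OF fD(1)] module_hom_id
          module_hom_res[OF gD(1)] module_hom_id relative_Hopf_moduleD(5)[OF L x]])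
  finally show "coact N (g (f x)) = map_fst (res N) (\<lambda>x. g (f x)) (coact L x)" .
qed

text \<open>The inverse is automatically colinear: apply g \<otimes> id to the identity \<rho>(y) =
  (f \<otimes> id)(\<rho>(g y)), which is colinearity of \<open>f\<close> at
  \<open>g y\<close>.\<close>

lemma relative_Hopf_isoI:
  assumes M: "Hopf M" and N: "module A N"
    and f: "f \<in> Hopf_hom M N"
    and g: "\<And>y. y \<in> carrier N \<Longrightarrow> g y \<in> carrier M"
    and gf: "\<And>x. x \<in> carrier M \<Longrightarrow> g (f x) = x" and fg: "\<And>y. y \<in> carrier N \<Longrightarrow> f (g y) = y"
  shows "hiso M N"
proof -
  note fD = relative_Hopf_homD[OF f] and MD = relative_Hopf_moduleD[OF M]
  have g_hom: "g \<in> module_hom A N M" by (rule module_isoI(1)[OF fD(1) MD(1) g gf fg])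
  have "g \<in> Hopf_hom N M"
  proof (rule relative_Hopf_homI[OF g_hom])
    fix y assume y: "y \<in> carrier N"
    have "coact N y = map_fst (res N) f (coact M (g y))"
      using fD(2)[OF g[OF y]] fg[OF y] by simp
    also have "map_fst (res M) g \<dots> =
        map_fst (res M) (\<lambda>x. g (f x)) (coact M (g y))"
      by (rule tensor_map_comp[OF MD(6) module_H module_res[OF N] module_H MD(6) module_H
            module_hom_res[OF fD(1)] module_hom_id module_hom_res[OF g_hom] module_hom_id
            MD(5)[OF g[OF y]]])
    also have "\<dots> = map_fst (res M) (\<lambda>x. x) (coact M (g y))"
      by (rule tensor_map_cong[OF MD(6) module_H MD(6) module_H
            module_hom_res[OF module_hom_comp[OF fD(1) g_hom]] module_hom_id])
        (simp_all add: gf MD(5) g y)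
    also have "\<dots> = coact M (g y)"
      by (rule tensor_map_id[OF MD(6) module_H MD(6) module_H MD(5)[OF g[OF y]]])
    finally show "coact M (g y) = map_fst (res M) g (coact N y)" by simp
  qed
  then show ?thesis
    unfolding relative_Hopf_iso_def using f gf fg by (intro bexI[of _ f] bexI[of _ g]) simp_all
qed

lemma relative_Hopf_isoE:
  assumes "hiso M N"
  obtains f g where "f \<in> Hopf_hom M N" "g \<in> Hopf_hom N M"
    "\<And>x. x \<in> carrier M \<Longrightarrow> g (f x) = x" "\<And>y. y \<in> carrier N \<Longrightarrow> f (g y) = y"
proof -
  from assms obtain f where f: "f \<in> Hopf_hom M N" and "\<exists>g \<in> Hopf_hom N M.
      (\<forall>x \<in> carrier M. g (f x) = x) \<and> (\<forall>y \<in> carrier N. f (g y) = y)"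
    unfolding relative_Hopf_iso_def ..
  then obtain g where "g \<in> Hopf_hom N M"
    and "(\<forall>x \<in> carrier M. g (f x) = x) \<and> (\<forall>y \<in> carrier N. f (g y) = y)" by (elim bexE)
  with f show ?thesis by (intro that[of f g]) simp_all
qed

lemma relative_Hopf_iso_imp_module_iso:
  assumes "hiso M N"
  shows "module_iso A M N"
proof -
  obtain f g where f: "f \<in> Hopf_hom M N" "g \<in> Hopf_hom N M"
    "\<And>x. x \<in> carrier M \<Longrightarrow> g (f x) = x" "\<And>x. x \<in> carrier N \<Longrightarrow> f (g x) = x"
    by (rule relative_Hopf_isoE[OF assms], rule that)
  show ?thesis
    unfolding module_iso_def
    using f(3,4) by (intro bexI[OF _ relative_Hopf_homD(1)[OF f(1)]]
      bexI[OF _ relative_Hopf_homD(1)[OF f(2)]]) simp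
qed

lemma relative_Hopf_iso_refl:
  "Hopf M \<Longrightarrow> hiso M M"
  unfolding relative_Hopf_iso_def by (intro bexI[OF _ relative_Hopf_hom_id]) simp_all

lemma relative_Hopf_iso_sym: "hiso M N \<Longrightarrow> hiso N M"
  unfolding relative_Hopf_iso_def by blast

lemma relative_Hopf_iso_trans:
  assumes L: "Hopf L" and M: "Hopf M"
    and N: "Hopf N"
    and 1: "hiso L M" and 2: "hiso M N"
  shows "hiso L N"
proof -
  obtain f g where f: "f \<in> Hopf_hom L M" "g \<in> Hopf_hom M L"
    "\<And>x. x \<in> carrier L \<Longrightarrow> g (f x) = x" "\<And>x. x \<in> carrier M \<Longrightarrow> f (g x) = x"
    by (rule relative_Hopf_isoE[OF 1], rule that)
  obtain f' g' where f': "f' \<in> Hopf_hom M N" "g' \<in> Hopf_hom N M"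
    "\<And>x. x \<in> carrier M \<Longrightarrow> g' (f' x) = x" "\<And>x. x \<in> carrier N \<Longrightarrow> f' (g' x) = x"
    by (rule relative_Hopf_isoE[OF 2], rule that)
  show ?thesis
    unfolding relative_Hopf_iso_def
    using module_homD(1)[OF relative_Hopf_homD(1)[OF f(1)]]
      module_homD(1)[OF relative_Hopf_homD(1)[OF f'(2)]] f(3,4) f'(3,4)
    by (intro bexI[OF _ relative_Hopf_hom_comp[OF L M N f(1) f'(1)]]
        bexI[OF _ relative_Hopf_hom_comp[OF N M L f'(2) f(2)]]) simp
qed

text \<open>Compatibility of the transported coaction with the action of A is naturality of the
  pairing with respect to \<open>f\<close>. The lemma serves two purposes: placing copies of objects
  on the universe, and moving coactions onto the regular module, where they become twists.\<close>

lemma relative_Hopf_module_transport: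
  fixes N :: "('a, 'n) module"
  assumes M: "Hopf M" and N: "module A N"
    and f: "f \<in> module_hom A M N" and g: "\<And>y. y \<in> carrier N \<Longrightarrow> g y \<in> carrier M"
    and gf: "\<And>x. x \<in> carrier M \<Longrightarrow> g (f x) = x" and fg: "\<And>y. y \<in> carrier N \<Longrightarrow> f (g y) = y"
  defines "\<rho> \<equiv> \<lambda>y. map_fst (res N) f (coact M (g y))"
  shows "Hopf (with_coaction N \<rho>)"
    and "f \<in> Hopf_hom M (with_coaction N \<rho>)"
    and "hiso M (with_coaction N \<rho>)"
proof -
  note MD = relative_Hopf_moduleD[OF M] and N' = module_res[OF N]
  note g_hom = module_isoI(1)[OF f MD(1) g gf fg]
  note f' = module_hom_res[OF f] and g' = module_hom_res[OF g_hom]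
  define F where "F = map_fst (res N) f"
  have \<rho>_eq: "\<rho> y = F (coact M (g y))" for y by (simp add: \<rho>_def F_def)
  have \<rho>: "right_coaction k H (res N) \<rho>"
    unfolding \<rho>_def
    by (rule right_coaction_transport[OF MD(6) N' f' g' _ _ MD(2)]) (simp_all add: fg gf)
  have "module A (with_coaction N \<rho>)"
    by (rule module_cong[OF N]) simp_all
  moreover have "\<rho> (a \<odot>\<^bsub>N\<^esub> y) = act_pairing N (\<rho> y) (coact A a)"
    if y: "y \<in> carrier N" and a: "a \<in> carrier A" for y a
  proof -
    have "\<rho> (a \<odot>\<^bsub>N\<^esub> y) = F (act_pairing M (coact M (g y)) (coact A a))"
      unfolding \<rho>_eq using y a g by (simp add: module_homD(3)[OF g_hom] MD(3))
    also have "\<dots> = act_pairing N (F (coact M (g y))) (map_fst A (\<lambda>a. a) (coact A a))"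
      unfolding F_def
      by (rule tensor_map_pairing[OF MD(6) module_A MD(6) N' module_A N' action_bilinear[OF MD(1)]
            action_bilinear[OF N] f' module_hom_id f' _ MD(5)[OF g[OF y]] coact_A_closed[OF a]])
        (simp add: module_homD(3)[OF f])
    also have "map_fst A (\<lambda>a. a) (coact A a) = coact A a"
      by (rule tensor_map_id[OF module_A module_H module_A module_H coact_A_closed[OF a]])
    finally show ?thesis by (simp add: \<rho>_eq)
  qed
  ultimately show Hopf: "Hopf (with_coaction N \<rho>)"
    unfolding relative_Hopf_module_def using \<rho> by simp
  show hom: "f \<in> Hopf_hom M (with_coaction N \<rho>)"
    by (rule relative_Hopf_homI)
      (use f in \<open>simp_all add: module_hom_def \<rho>_def gf\<close>)
  show "hiso M (with_coaction N \<rho>)"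
    by (rule relative_Hopf_isoI[OF M relative_Hopf_moduleD(1)[OF Hopf] hom, where g = g])
      (simp_all add: g gf fg)
qed

end

lemma tensor_with_coaction [simp]:
  "tensor A (with_coaction M \<rho>) N = tensor A M N"
  "pure_tensor A (with_coaction M \<rho>) N = pure_tensor A M N"
  "tensor A P (with_coaction Q \<sigma>) = tensor A P Q"
  "pure_tensor A P (with_coaction Q \<sigma>) = pure_tensor A P Q"
  by (simp_all add: tensor_def Let_def pure_tensor_def[abs_def] tensor_free_def tensor_kernel_def
      tensor_relations_def)

lemma module_with_coaction: "module A (with_coaction M \<rho>) \<longleftrightarrow> module A M"
  using module_cong[of A M "with_coaction M \<rho>"] module_cong[of A "with_coaction M \<rho>" M] by auto

lemma module_hom_with_coaction [simp]:
  "module_hom A (with_coaction M \<rho>) N = module_hom A M N"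
  "module_hom A P (with_coaction Q \<sigma>) = module_hom A P Q"
  by (simp_all add: module_hom_def)

context comodule_algebra_setting
begin

subsection \<open>The tensor product of relative Hopf modules\<close>

text \<open>With \<open>Z = coact A a\<close> this moves a coacted scalar from the product onto the
  second factor. It is half of the A-compatibility of the coaction on M \<otimes>_A N.\<close>

lemma act_pure_pairing:
  assumes M: "module A M" and N: "module A N"
    and X: "X \<in> carrier (tensor k (res M) H)" and Y: "Y \<in> carrier (tensor k (res N) H)"
    and Z: "Z \<in> carrier (tensor k A H)"
  shows "act_pairing (tensor A M N) (pure_pairing M N X Y) Z = pure_pairing M N X (act_pairing N Y Z)"
proof -
  note T = module_tensor[OF M N]
  show ?thesis
    by (rule pairing_assoc[OF module_res[OF M] module_res[OF N] module_A module_res[OF T]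
          module_res[OF N] module_res[OF T] pure_tensor_bilinear_res[OF M N] action_bilinear[OF T]
          action_bilinear[OF N] pure_tensor_bilinear_res[OF M N] _ X Y Z])
      (simp add: smult_pure_tensor[OF M N] pure_tensor_balanced[OF M N])
qed

text \<open>With \<open>Z = coact A a\<close> this says that (m, n) \<mapsto> \<rho>(m) \<rho>(n)
  does not distinguish (a m, n) from (m, a n), so that it descends to the tensor product over A. The
  factor Z passes from X to Y by associativity and commutativity of H.\<close>

lemma pure_pairing_balanced:
  assumes M: "module A M" and N: "module A N"
    and X: "X \<in> carrier (tensor k (res M) H)" and Y: "Y \<in> carrier (tensor k (res N) H)"
    and Z: "Z \<in> carrier (tensor k A H)"
  shows "pure_pairing M N (act_pairing M X Z) Y = pure_pairing M N X (act_pairing N Y Z)"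
proof -
  note T = module_tensor[OF M N]
  have "pure_pairing M N (act_pairing M X Z) Y =
      pure_pairing M N X (pairing (res N) (\<lambda>a n. a \<odot>\<^bsub>N\<^esub> n) Z Y)"
    by (rule pairing_assoc[OF module_res[OF M] module_A module_res[OF N] module_res[OF M]
          module_res[OF N] module_res[OF T] action_bilinear[OF M] pure_tensor_bilinear_res[OF M N]
          left_action_bilinear[OF N] pure_tensor_bilinear_res[OF M N] _ X Z Y])
      (simp add: pure_tensor_balanced[OF M N])
  also have "pairing (res N) (\<lambda>a n. a \<odot>\<^bsub>N\<^esub> n) Z Y = act_pairing N Y Z"
    by (rule pairing_comm[OF module_A module_res[OF N] module_res[OF N] left_action_bilinear[OF N]
          action_bilinear[OF N] refl Z Y])
  finally show ?thesis .
qed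

context
  fixes M :: "('a, 'm, 'h) comod" and N :: "('a, 'n, 'h) comod"
  assumes M: "Hopf M" and N: "Hopf N"
begin

private lemmas MD = relative_Hopf_moduleD[OF M]
private lemmas ND = relative_Hopf_moduleD[OF N]
private lemmas T = module_tensor[OF MD(1) ND(1)]
private lemmas T' = module_res[OF T]
private lemmas TH = module_tensor[OF T' module_H]
private lemmas pure_bil = pure_tensor_bilinear_res[OF MD(1) ND(1)]
private lemmas pb = bilinear_mapD[OF pairing_bilinear[OF MD(6) ND(6) T' pure_bil]]

lemma relative_Hopf_tensor_simps:
  "carrier (tens M N) = carrier (tensor A M N)"
  "add (tens M N) = add (tensor A M N)"
  "smult (tens M N) = smult (tensor A M N)"
  "res (tens M N) = res (tensor A M N)"
  "module_hom A (tens M N) Q = module_hom A (tensor A M N) Q"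
  "module_hom A Q' (tens M N) = module_hom A Q' (tensor A M N)"
  by (simp_all add: relative_Hopf_tensor_def Let_def)

private lemma coact_tensor_def: "coact (tens M N) =
    tensor_lift (tensor k (res (tensor A M N)) H) (\<lambda>m n. pure_pairing M N (coact M m) (coact N n))"
  by (simp add: relative_Hopf_tensor_def Let_def)

text \<open>A scalar a of A becomes multiplication by \<rho>(a) in a target that is a module over k
  only. Balancedness over A, with additivity, is therefore the property to establish.\<close>

private lemma coact_balanced: "balanced_map A M N (tensor k (res (tensor A M N)) H)
    (\<lambda>m n. pure_pairing M N (coact M m) (coact N n))"
  unfolding balanced_map_def
  using module_homD(2)[OF MD(4)] module_homD(2)[OF ND(4)]
  by (simp add: MD(3,5) ND(3,5) pb pure_pairing_balanced[OF MD(1) ND(1)] coact_A_closed)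

private lemmas lift = tensor_lift_pure[OF MD(1) ND(1) module_imp_abelian_group[OF TH] coact_balanced]
  tensor_lift_closed[OF MD(1) ND(1) module_imp_abelian_group[OF TH] coact_balanced]
  tensor_lift_add[OF MD(1) ND(1) module_imp_abelian_group[OF TH] coact_balanced]

lemma coact_tensor_pure: "m \<in> carrier M \<Longrightarrow> n \<in> carrier N \<Longrightarrow>
    coact (tens M N) (pure_tensor A M N m n) =
    pure_pairing M N (coact M m) (coact N n)"
  unfolding coact_tensor_def by (rule lift(1))

text \<open>The lift is taken over A into an abelian group and yields additivity alone. Linearity
  over k is checked on pure tensors, where c 1 acts through the first factor and the coaction of
  \<open>M\<close> is k-linear.\<close>

lemma coact_tensor_hom: "coact (tens M N) \<in>
    module_hom k (res (tensor A M N)) (tensor k (res (tensor A M N)) H)"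
proof (rule module_homI)
  interpret TH: module k "tensor k (res (tensor A M N)) H" by (rule TH)
  interpret T: module A "tensor A M N" by (rule T)
  fix c x assume c: "c \<in> carrier k" and x: "x \<in> carrier (res (tensor A M N))"
  then have "x \<in> carrier (tensor A M N)" by simp
  with MD(1) ND(1) show "coact (tens M N) (c \<odot>\<^bsub>res (tensor A M N)\<^esub> x) =
      c \<odot>\<^bsub>tensor k (res (tensor A M N)) H\<^esub> coact (tens M N) x"
  proof (induction x rule: tensor_induct)
    case (pure m n)
    have "coact M ((c \<odot>\<^bsub>A\<^esub> \<one>\<^bsub>A\<^esub>) \<odot>\<^bsub>M\<^esub> m) = c \<odot>\<^bsub>tensor k (res M) H\<^esub> coact M m"
      using module_homD(3)[OF MD(4) c, of m] pure by simp
    moreover have "(c \<odot>\<^bsub>A\<^esub> \<one>\<^bsub>A\<^esub>) \<odot>\<^bsub>M\<^esub> m \<in> carrier M"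
      using module.smult_closed[OF MD(1) scalar_closed[OF c] pure(1)] .
    ultimately show ?case
      using pure c
      by (simp add: smult_pure_tensor[OF MD(1) ND(1)] scalar_closed coact_tensor_pure pb MD(5) ND(5))
  next
    case (add x y)
    then show ?case
      using c by (simp add: coact_tensor_def lift scalar_closed T.smult_r_distr TH.smult_r_distr)
  qed
qed (simp_all add: coact_tensor_def lift)

text \<open>All axioms are additive in the element, so pure tensors suffice. There coassociativity
  and counit come from the bilinear principle for the map \<open>pure_tensor A M N\<close>, and
  A-compatibility from the two rules on pairings above.\<close>

lemma relative_Hopf_module_tensor: "Hopf (tens M N)"
proof -
  let ?\<tau> = "coact (tens M N)"
  note \<tau> = coact_tensor_hom and \<tau>D = module_homD[OF coact_tensor_hom, simplified]
  note L = coact_fst_hom[OF T' \<tau>] and D = comult_snd_hom[OF T'] and E = counit_snd_hom[OF T']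
  note LD = module_homD[OF L] module_homD[OF D] module_homD[OF E]
  have colinear: "?\<tau> (pure_tensor A M N m n) = pure_pairing M N (coact M m) (coact N n)"
    if "m \<in> carrier (res M)" "n \<in> carrier (res N)" for m n
    using that by (simp add: coact_tensor_pure)
  have "coact_fst k H (res (tensor A M N)) ?\<tau> (?\<tau> x) = comult_snd k H (res (tensor A M N)) (?\<tau> x)
      \<and> counit_snd H (res (tensor A M N)) (?\<tau> x) = x"
    if "x \<in> carrier (tensor A M N)" for x
    using MD(1) ND(1) that
  proof (induction x rule: tensor_induct)
    case (pure m n)
    then show ?case
      using coassoc_bilinear[OF MD(6) ND(6) T' pure_bil MD(4) ND(4) \<tau> colinear, of m n]
        counit_bilinear[OF MD(6) ND(6) T' pure_bil MD(4) ND(4) \<tau> colinear, of m n]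
        right_coactionD(2,3)[OF MD(2)] right_coactionD(2,3)[OF ND(2)]
      by simp
  next
    case (add x y)
    then show ?case by (simp add: \<tau>D LD)
  qed
  then have 1: "right_coaction k H (res (tensor A M N)) ?\<tau>"
    unfolding right_coaction_iff using \<tau> by simp
  interpret T: module A "tensor A M N" by (rule T)
  note act = bilinear_mapD[OF pairing_bilinear[OF T' module_A T' action_bilinear[OF T]]]
  have 2: "?\<tau> (a \<odot>\<^bsub>tensor A M N\<^esub> x) = act_pairing (tensor A M N) (?\<tau> x) (coact A a)"
    if x: "x \<in> carrier (tensor A M N)" and a: "a \<in> carrier A" for x a
    using MD(1) ND(1) x
  proof (induction x rule: tensor_induct)
    case (pure m n)
    have "a \<odot>\<^bsub>M\<^esub> m \<in> carrier M"
      using module.smult_closed[OF MD(1) a pure(1)] .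
    with pure a show ?case
      by (simp add: smult_pure_tensor[OF MD(1) ND(1)] coact_tensor_pure MD(3,5) ND(5) coact_A_closed
          act_pure_pairing[OF MD(1) ND(1)] pure_pairing_balanced[OF MD(1) ND(1)])
  next
    case (add x y)
    then show ?case
      using a by (simp add: \<tau>D act T.smult_r_distr coact_A_closed)
  qed
  have "module A (tens M N)"
    using T by (simp add: relative_Hopf_tensor_def Let_def module_with_coaction)
  with 1 2 show ?thesis
    unfolding relative_Hopf_module_def by (simp add: relative_Hopf_tensor_simps)
qed

text \<open>Reduces colinearity of a map out of M \<otimes>_A N to an identity between pairings of
  coactions. The formal rules for pairings then settle the structural isomorphisms.\<close>

lemma relative_Hopf_tensor_homI:
  assumes P: "Hopf P" and \<theta>: "\<theta> \<in> module_hom A (tensor A M N) P"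
    and eq: "\<And>m n. m \<in> carrier M \<Longrightarrow> n \<in> carrier N \<Longrightarrow> coact P (\<theta> (pure_tensor A M N m n)) =
      pairing (res P) (\<lambda>m n. \<theta> (pure_tensor A M N m n)) (coact M m) (coact N n)"
  shows "\<theta> \<in> Hopf_hom (tens M N) P"
proof (rule relative_Hopf_homI)
  show "\<theta> \<in> module_hom A (tens M N) P"
    using \<theta> by (simp add: relative_Hopf_tensor_simps)
  note PD = relative_Hopf_moduleD[OF P] and \<theta>' = module_hom_res[OF \<theta>]
  note \<tau>D = module_homD[OF coact_tensor_hom, simplified]
  note bil = bilinear_map_comp[OF pure_bil module_hom_id module_hom_id \<theta>']
  fix x assume "x \<in> carrier (tens M N)"
  then have "x \<in> carrier (tensor A M N)" by (simp add: relative_Hopf_tensor_simps)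
  with MD(1) ND(1) show "coact P (\<theta> x) =
      tensor_map k (res P) H \<theta> (\<lambda>h. h) (coact (tens M N) x)"
  proof (induction x rule: tensor_induct)
    case (pure m n)
    then show ?case
      using tensor_map_pairing_comp[OF MD(6) ND(6) T' PD(6) pure_bil bil \<theta>' refl MD(5) ND(5), of m n]
      by (simp add: eq coact_tensor_pure)
  next
    case (add x y)
    then show ?case
      using module_homD(2)[OF PD(4)]
      by (simp add: \<tau>D module_homD[OF \<theta>] module_homD[OF tensor_map_hom[OF T' module_H PD(6) module_H \<theta>' module_hom_id]])
  qed
qed

end

section \<open>Colinearity of the structural isomorphisms\<close>

lemma relative_Hopf_iso_swap:
  assumes M: "Hopf M" and N: "Hopf N"
  shows "hiso (tens M N) (tens N M)"
proof -
  note MD = relative_Hopf_moduleD[OF M] and ND = relative_Hopf_moduleD[OF N]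
  note NM = relative_Hopf_module_tensor[OF N M] and MN = relative_Hopf_module_tensor[OF M N]
  note swap = tensor_swap_hom[OF MD(1) ND(1)]
  note rs = relative_Hopf_tensor_simps[OF M N] relative_Hopf_tensor_simps[OF N M]
  note bil = bilinear_map_comp[OF pure_tensor_bilinear_res[OF MD(1) ND(1)] module_hom_id
      module_hom_id module_hom_res[OF swap]]
  have "tensor_swap A M N \<in>
      Hopf_hom (tens M N) (tens N M)"
  proof (rule relative_Hopf_tensor_homI[OF M N NM])
    show "tensor_swap A M N \<in> module_hom A (tensor A M N) (tens N M)"
      using swap by (simp add: rs)
    fix m n assume mn: "m \<in> carrier M" "n \<in> carrier N"
    show "coact (tens N M) (tensor_swap A M N (pure_tensor A M N m n)) =
      pairing (res (tens N M)) (\<lambda>m n. tensor_swap A M N (pure_tensor A M N m n)) (coact M m) (coact N n)"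
      using mn
      by (simp add: rs tensor_swap_pure[OF MD(1) ND(1)] coact_tensor_pure[OF N M])
        (rule pairing_comm[symmetric, OF MD(6) ND(6) module_res[OF module_tensor[OF ND(1) MD(1)]]
          bil pure_tensor_bilinear_res[OF ND(1) MD(1)] _ MD(5) ND(5)],
          simp_all add: tensor_swap_pure[OF MD(1) ND(1)])
  qed
  then show ?thesis
    by (rule relative_Hopf_isoI[OF MN relative_Hopf_moduleD(1)[OF NM], where g = "tensor_swap A N M"])
      (simp_all add: rs module_homD(1)[OF tensor_swap_hom[OF ND(1) MD(1)]] tensor_swap_swap[OF MD(1) ND(1)]
        tensor_swap_swap[OF ND(1) MD(1)])
qed

lemma relative_Hopf_iso_assoc:
  assumes L: "Hopf L" and M: "Hopf M"
    and N: "Hopf N"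
  shows "hiso (tens (tens L M) N)
    (tens L (tens M N))"
proof -
  note LD = relative_Hopf_moduleD[OF L] and MD = relative_Hopf_moduleD[OF M]
    and ND = relative_Hopf_moduleD[OF N]
  note LM = relative_Hopf_module_tensor[OF L M] and MN = relative_Hopf_module_tensor[OF M N]
  note LM_N = relative_Hopf_module_tensor[OF LM N] and L_MN = relative_Hopf_module_tensor[OF L MN]
  note tLM = module_tensor[OF LD(1) MD(1)] and tMN = module_tensor[OF MD(1) ND(1)]
  note tLM_N = module_tensor[OF tLM ND(1)] and tL_MN = module_tensor[OF LD(1) tMN]
  have t: "tensor A (tens L M) N = tensor A (tensor A L M) N"
    "tensor A L (tens M N) = tensor A L (tensor A M N)"
    "pure_tensor A (tens L M) N = pure_tensor A (tensor A L M) N"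
    "pure_tensor A L (tens M N) = pure_tensor A L (tensor A M N)"
    by (simp_all add: relative_Hopf_tensor_def Let_def)
  note rs = relative_Hopf_tensor_simps[OF L M] relative_Hopf_tensor_simps[OF M N]
    relative_Hopf_tensor_simps[OF LM N] relative_Hopf_tensor_simps[OF L MN] t
  let ?\<alpha> = "tensor_assoc A L M N"
  note assoc = tensor_assoc_hom[OF LD(1) MD(1) ND(1)]
  have bil: "bilinear_map k (res (tensor A L M)) (res N) (res (tensor A L (tensor A M N)))
      (\<lambda>u n. ?\<alpha> (pure_tensor A (tensor A L M) N u n))"
    by (rule bilinear_map_comp[OF pure_tensor_bilinear_res[OF tLM ND(1)] module_hom_id
          module_hom_id module_hom_res[OF assoc]])
  note pb = bilinear_mapD[OF pairing_bilinear[OF module_res[OF tLM] ND(6) module_res[OF tL_MN] bil]]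
  \<comment> \<open>\<open>relative_Hopf_tensor_homI\<close> resolves only the outer tensor product,
    so \<open>u\<close> ranges over all of L \<otimes>_A M and needs an induction of its
    own.\<close>
  have eq: "coact (tens L (tens M N))
        (?\<alpha> (pure_tensor A (tensor A L M) N u n)) =
      pairing (res (tensor A L (tensor A M N))) (\<lambda>u n. ?\<alpha> (pure_tensor A (tensor A L M) N u n)) (coact (tens L M) u) (coact N n)"
    if u: "u \<in> carrier (tensor A L M)" and n: "n \<in> carrier N" for u n
    using LD(1) MD(1) u
  proof (induction u rule: tensor_induct)
    case (pure l m)
    have "coact (tens L (tens M N))
        (?\<alpha> (pure_tensor A (tensor A L M) N (pure_tensor A L M l m) n)) =
      pure_pairing L (tensor A M N) (coact L l) (pure_pairing M N (coact M m) (coact N n))"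
      using pure n coact_tensor_pure[OF L MN, of l "pure_tensor A M N m n"]
      by (simp add: rs tensor_assoc_pure[OF LD(1) MD(1) ND(1)] coact_tensor_pure[OF M N]
          pure_tensor_closed[OF MD(1) ND(1)])
    also have "\<dots> = pairing (res (tensor A L (tensor A M N))) (\<lambda>u n. ?\<alpha> (pure_tensor A (tensor A L M) N u n))
        (pure_pairing L M (coact L l) (coact M m)) (coact N n)"
      by (rule pairing_assoc[symmetric, OF LD(6) MD(6) ND(6) module_res[OF tLM] module_res[OF tMN]
            module_res[OF tL_MN] pure_tensor_bilinear_res[OF LD(1) MD(1)] bil
            pure_tensor_bilinear_res[OF MD(1) ND(1)] pure_tensor_bilinear_res[OF LD(1) tMN] _
            LD(5)[OF pure(1)] MD(5)[OF pure(2)] ND(5)[OF n]])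
        (simp add: tensor_assoc_pure[OF LD(1) MD(1) ND(1)])
    finally show ?case using pure by (simp add: coact_tensor_pure[OF L M])
  next
    case (add u v)
    then show ?case
      using n module_homD[OF coact_tensor_hom[OF L MN]] module_homD[OF coact_tensor_hom[OF L M]]
        module_homD[OF assoc] bilinear_mapD[OF bilinear_pure_tensor[OF tLM ND(1)]]
      by (simp add: rs pb ND(5))
  qed
  have "?\<alpha> \<in> Hopf_hom (tens (tens L M) N)
      (tens L (tens M N))"
    by (rule relative_Hopf_tensor_homI[OF LM N L_MN]) (simp_all add: rs assoc eq)
  then show ?thesis
    by (rule relative_Hopf_isoI[OF LM_N relative_Hopf_moduleD(1)[OF L_MN], where g = "tensor_assoc_inv A L M N"])
      (simp_all add: rs module_homD(1)[OF tensor_assoc_inv_hom[OF LD(1) MD(1) ND(1)]]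
        tensor_assoc_inv_assoc[OF LD(1) MD(1) ND(1)] tensor_assoc_assoc_inv[OF LD(1) MD(1) ND(1)])
qed

lemma relative_Hopf_iso_tensor_left:
  assumes M: "Hopf M" and M': "Hopf M'"
    and N: "Hopf N" and iso: "hiso M M'"
  shows "hiso (tens M N) (tens M' N)"
proof -
  obtain f g where f: "f \<in> Hopf_hom M M'" and g: "g \<in> Hopf_hom M' M"
    and gf: "\<And>x. x \<in> carrier M \<Longrightarrow> g (f x) = x" and fg: "\<And>x. x \<in> carrier M' \<Longrightarrow> f (g x) = x"
    by (rule relative_Hopf_isoE[OF iso], rule that)
  note fD = relative_Hopf_homD[OF f] and gD = relative_Hopf_homD[OF g]
  note MD = relative_Hopf_moduleD[OF M] and M'D = relative_Hopf_moduleD[OF M']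
    and ND = relative_Hopf_moduleD[OF N]
  note MN = relative_Hopf_module_tensor[OF M N] and M'N = relative_Hopf_module_tensor[OF M' N]
  note rs = relative_Hopf_tensor_simps[OF M N] relative_Hopf_tensor_simps[OF M' N]
  note F = tensor_map_hom[OF MD(1) ND(1) M'D(1) ND(1) fD(1) module_hom_id]
  note F_pure = tensor_map_pure[OF MD(1) ND(1) M'D(1) ND(1) fD(1) module_hom_id]
  note G = tensor_map_hom[OF M'D(1) ND(1) MD(1) ND(1) gD(1) module_hom_id]
  let ?F = "tensor_map A M' N f (\<lambda>x. x)" and ?G = "tensor_map A M N g (\<lambda>x. x)"
  have "?F \<in> Hopf_hom (tens M N) (tens M' N)"
  proof (rule relative_Hopf_tensor_homI[OF M N M'N])
    show "?F \<in> module_hom A (tensor A M N) (tens M' N)"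
      using F by (simp add: rs)
    fix m n assume m: "m \<in> carrier M" and n: "n \<in> carrier N"
    have bil: "bilinear_map k (res M) (res N) (res (tensor A M' N)) (\<lambda>m n. ?F (pure_tensor A M N m n))"
      by (rule bilinear_map_comp[OF pure_tensor_bilinear_res[OF MD(1) ND(1)] module_hom_id
            module_hom_id module_hom_res[OF F]])
    let ?p = "pairing (res (tensor A M' N)) (\<lambda>m n. ?F (pure_tensor A M N m n)) (coact M m) (coact N n)"
    have T': "module k (res (tensor A M' N))" by (rule module_res[OF module_tensor[OF M'D(1) ND(1)]])
    have p: "?p \<in> carrier (tensor k (res (tensor A M' N)) H)"
      by (rule bilinear_mapD(1)[OF pairing_bilinear[OF MD(6) ND(6) T' bil] MD(5)[OF m] ND(5)[OF n]])
    \<comment> \<open>The identity of the target is inserted so that naturality of the pairing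
      applies and carries \<open>f\<close> to the first factor.\<close>
    have "?p = map_fst (res (tensor A M' N)) (\<lambda>x. x) ?p"
      by (rule tensor_map_id[symmetric, OF T' module_H T' module_H p])
    also have "\<dots> = pure_pairing M' N (map_fst (res M') f (coact M m))
        (map_fst (res N) (\<lambda>x. x) (coact N n))"
      by (rule tensor_map_pairing[OF MD(6) ND(6) T' M'D(6) ND(6) T' bil
            pure_tensor_bilinear_res[OF M'D(1) ND(1)] module_hom_res[OF fD(1)] module_hom_id
            module_hom_id _ MD(5)[OF m] ND(5)[OF n]])
        (simp add: F_pure)
    also have "\<dots> = pure_pairing M' N (coact M' (f m)) (coact N n)"
      using m n by (simp add: fD(2) tensor_map_id[OF ND(6) module_H ND(6) module_H] ND(5))
    also have "\<dots> = coact (tens M' N) (?F (pure_tensor A M N m n))"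
      using m n by (simp add: F_pure coact_tensor_pure[OF M' N] module_homD(1)[OF fD(1)])
    finally show "coact (tens M' N) (?F (pure_tensor A M N m n)) =
        pairing (res (tens M' N)) (\<lambda>m n. ?F (pure_tensor A M N m n)) (coact M m) (coact N n)"
      by (simp add: rs)
  qed
  moreover have "?G (?F X) = X" if "X \<in> carrier (tensor A M N)" for X
    using tensor_map_comp[OF MD(1) ND(1) M'D(1) ND(1) MD(1) ND(1) fD(1) module_hom_id gD(1) module_hom_id that]
      tensor_map_cong[OF MD(1) ND(1) MD(1) ND(1) module_hom_comp[OF fD(1) gD(1)] module_hom_id gf refl that]
      tensor_map_id[OF MD(1) ND(1) MD(1) ND(1) that] by simp
  moreover have "?F (?G X) = X" if "X \<in> carrier (tensor A M' N)" for X
    using tensor_map_comp[OF M'D(1) ND(1) MD(1) ND(1) M'D(1) ND(1) gD(1) module_hom_id fD(1) module_hom_id that]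
      tensor_map_cong[OF M'D(1) ND(1) M'D(1) ND(1) module_hom_comp[OF gD(1) fD(1)] module_hom_id fg refl that]
      tensor_map_id[OF M'D(1) ND(1) M'D(1) ND(1) that] by simp
  ultimately show ?thesis
    by (intro relative_Hopf_isoI[OF MN relative_Hopf_moduleD(1)[OF M'N], where f = ?F and g = ?G])
      (simp_all add: rs module_homD(1)[OF G])
qed

lemma relative_Hopf_iso_tensor:
  assumes M: "Hopf M" and M': "Hopf M'"
    and N: "Hopf N" and N': "Hopf N'"
    and "hiso M M'" "hiso N N'"
  shows "hiso (tens M N) (tens M' N')"
proof -
  note t = relative_Hopf_module_tensor
  note 1 = relative_Hopf_iso_tensor_left[OF M M' N assms(5)]
  note 2 = relative_Hopf_iso_swap[OF M' N]
  note 3 = relative_Hopf_iso_tensor_left[OF N N' M' assms(6)]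
  note 4 = relative_Hopf_iso_swap[OF N' M']
  show ?thesis
    by (rule relative_Hopf_iso_trans[OF t[OF M N] t[OF M' N] t[OF M' N'] 1
          relative_Hopf_iso_trans[OF t[OF M' N] t[OF N M'] t[OF M' N'] 2
            relative_Hopf_iso_trans[OF t[OF N M'] t[OF N' M'] t[OF M' N'] 3 4]]])
qed

end

section \<open>Grouplike elements\<close>

text \<open>A tensor product does not see the ring fields of its factors. This lets A \<otimes> (H
  \<otimes> H), where coassociativity lives, be used as an algebra as well.\<close>

lemma tensor_tensor_algebra:
  "tensor k V (tensor_algebra k M N) = tensor k V (tensor k M N)"
  "pure_tensor k V (tensor_algebra k M N) = pure_tensor k V (tensor k M N)"
proof -
  have f: "tensor_free V (tensor_algebra k M N) = tensor_free V (tensor k M N)"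
    by (simp add: tensor_free_def tensor_algebra_simps)
  have r: "tensor_relations k V (tensor_algebra k M N) = tensor_relations k V (tensor k M N)"
    by (simp add: tensor_relations_def tensor_algebra_simps)
  show p: "pure_tensor k V (tensor_algebra k M N) = pure_tensor k V (tensor k M N)"
    by (simp add: pure_tensor_def[abs_def] tensor_kernel_def f r)
  show "tensor k V (tensor_algebra k M N) = tensor k V (tensor k M N)"
    by (simp add: tensor_def tensor_kernel_def f r p)
qed

context comodule_algebra_setting
begin

section \<open>The commutative algebra A \<otimes> H\<close>

abbreviation AH where "AH \<equiv> tensor_algebra k A H"

abbreviation mult_AH (infixl \<open>\<star>\<close> 70) where "X \<star> Y \<equiv> X \<otimes>\<^bsub>AH\<^esub> Y"

lemma algebra_AH: "algebra k AH"
  by (rule algebra_tensor_algebra[OF algebra_A algebra_H])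

sublocale AH: cring AH
  by (rule algebra.M_cring[OF algebra_AH])

lemma carrier_AH: "carrier AH = carrier (tensor k A H)"
  by (simp add: tensor_algebra_simps)

lemma AH_mult: "X \<star> Y = pairing A (monoid.mult A) X Y"
  by (simp add: tensor_algebra_simps)

lemma AH_one: "\<one>\<^bsub>AH\<^esub> = pure_tensor k A H \<one>\<^bsub>A\<^esub> \<one>\<^bsub>H\<^esub>"
  by (simp add: tensor_algebra_simps)

lemma coact_closed: "a \<in> carrier A \<Longrightarrow> coact A a \<in> carrier AH"
  by (simp add: carrier_AH coact_A_closed)

lemma coact_mult: "a \<in> carrier A \<Longrightarrow> b \<in> carrier A \<Longrightarrow>
    coact A (a \<cdot> b) = coact A a \<star> coact A b"
  by (rule ring_hom_mult[OF coact_ring_hom])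

lemma coact_one: "coact A \<one>\<^bsub>A\<^esub> = \<one>\<^bsub>AH\<^esub>"
  by (rule ring_hom_one[OF coact_ring_hom])

lemma coact_hom: "coact A \<in> module_hom k A (tensor k A H)"
  by (rule right_coactionD(1)[OF right_coaction_A])

lemma pure_one_mult: "a \<in> carrier A \<Longrightarrow> b \<in> carrier A \<Longrightarrow>
    pure_tensor k A H a \<one>\<^bsub>H\<^esub> \<star> pure_tensor k A H b \<one>\<^bsub>H\<^esub> = pure_tensor k A H (a \<cdot> b) \<one>\<^bsub>H\<^esub>"
  by (simp add: AH_mult H_one_closed H_one_mult
      pairing_pure[OF module_A module_A module_A bilinear_mult[OF algebra_A]])

lemma pure_one_closed: "a \<in> carrier A \<Longrightarrow> pure_tensor k A H a \<one>\<^bsub>H\<^esub> \<in> carrier AH"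
  by (simp add: carrier_AH pure_tensor_closed[OF module_A module_H] H_one_closed)

lemma tensor_map_mult:
  assumes u: "u \<in> carrier A" and X: "X \<in> carrier AH"
  shows "map_fst A (\<lambda>a. a \<cdot> u) X = X \<star> pure_tensor k A H u \<one>\<^bsub>H\<^esub>"
proof -
  note f = bilinear_map_left[OF bilinear_mult[OF algebra_A] u]
  have g: "(\<lambda>X. X \<star> pure_tensor k A H u \<one>\<^bsub>H\<^esub>) \<in> module_hom k (tensor k A H) (tensor k A H)"
    using bilinear_map_left[OF bilinear_mult[OF algebra_AH] pure_one_closed[OF u]]
    by (simp add: module_hom_def tensor_algebra_simps)
  show ?thesis
    by (rule tensor_hom_eqI[OF module_A module_H
          tensor_map_hom[OF module_A module_H module_A module_H f module_hom_id] g])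
      (use u X in \<open>simp_all add: carrier_AH AH_mult H_one_closed H_mult_comm[OF _ H_one_closed] H_one_mult
        tensor_map_pure[OF module_A module_H module_A module_H f module_hom_id]
        pairing_pure[OF module_A module_A module_A bilinear_mult[OF algebra_A]]\<close>)
qed

text \<open>
  The regular module with scalars restricted to \<open>k\<close> agrees with \<open>A\<close> only up to the values of the
  scalar multiplication outside the carrier.
\<close>

lemma module_regular_A: "module A (regular_module A)"
  by (rule module_regular[OF cring_A])

lemma res_regular_smult: "\<forall>c \<in> carrier k. \<forall>a \<in> carrier A. c \<odot>\<^bsub>res (regular_module A)\<^esub> a = c \<odot>\<^bsub>A\<^esub> a"
  by (simp add: A.smult_assoc2 A_one_closed A_one_mult)

lemmas res_regular = tensor_cong[OF module_A _ _ _ res_regular_smult, simplified]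

lemma act_pairing_regular:
  assumes X: "X \<in> carrier AH" and Y: "Y \<in> carrier AH"
  shows "act_pairing (regular_module A) X Y = X \<star> Y"
proof -
  have bil: "bilinear_map k A A A (\<lambda>m a. a \<cdot> m)"
    using bilinear_mult[OF algebra_A] unfolding bilinear_map_def by blast
  have "act_pairing (regular_module A) X Y =
      pairing A (\<lambda>m a. a \<cdot> m) X Y"
    by (simp add: res_regular)
  also have "\<dots> = pairing A (monoid.mult A) X Y"
    by (rule pairing_cong[OF module_A module_A module_A bil bilinear_mult[OF algebra_A]])
      (use X Y in \<open>simp_all add: carrier_AH A_mult_comm\<close>)
  finally show ?thesis by (simp add: AH_mult)
qed

lemma relative_Hopf_module_regular_iff:
  "Hopf (with_coaction (regular_module A) \<rho>) \<longleftrightarrow>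
    right_coaction k H A \<rho> \<and>
    (\<forall>m \<in> carrier A. \<forall>a \<in> carrier A. \<rho> (a \<cdot> m) = \<rho> m \<star> coact A a)"
proof -
  have "right_coaction k H (res (regular_module A)) \<rho> \<longleftrightarrow> right_coaction k H A \<rho>"
    by (rule right_coaction_cong[OF module_A _ _ _ res_regular_smult]) simp_all
  moreover have "\<rho> m \<in> carrier AH" if "right_coaction k H A \<rho>" "m \<in> carrier A" for m
    using module_homD(1)[OF right_coactionD(1)[OF that(1)] that(2)] by (simp add: carrier_AH)
  moreover have "pairing (res (regular_module A)) (\<lambda>m a. a \<cdot> m) X Y =
      X \<star> Y" if "X \<in> carrier AH" "Y \<in> carrier AH" for X Y
    using act_pairing_regular[OF that] by simp
  ultimately show ?thesis
    unfolding relative_Hopf_module_def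
    using module_regular_A by (simp add: module_with_coaction coact_closed cong: conj_cong)
qed

lemma relative_Hopf_module_unit: "Hopf (relative_Hopf_unit A)"
  unfolding relative_Hopf_unit_def relative_Hopf_module_regular_iff
  using right_coaction_A
  by (auto simp: coact_mult AH.m_comm[OF coact_closed coact_closed])

section \<open>Grouplike elements and twists of the regular module\<close>

definition twist_coact :: "('a, 'h) tensor \<Rightarrow> 'a \<Rightarrow> ('a, 'h) tensor" where
  "twist_coact X = (\<lambda>a. X \<star> coact A a)"

abbreviation tw :: "('a, 'h) tensor \<Rightarrow> ('a, 'a, 'h) comod" where "tw X \<equiv> twist k H A X"

lemma twist_eq: "tw X = with_coaction (regular_module A) (twist_coact X)"
  by (simp add: twist_def twist_coact_def)

lemma twist_coact_one: "X \<in> carrier AH \<Longrightarrow> twist_coact X \<one>\<^bsub>A\<^esub> = X"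
  by (simp add: twist_coact_def coact_one)

lemma twist_coact_closed: "X \<in> carrier AH \<Longrightarrow> a \<in> carrier A \<Longrightarrow> twist_coact X a \<in> carrier AH"
  by (simp add: twist_coact_def coact_closed)

lemma twist_coact_hom:
  assumes "X \<in> carrier AH"
  shows "twist_coact X \<in> module_hom k A (tensor k A H)"
proof -
  have "monoid.mult AH X \<in> module_hom k (tensor k A H) (tensor k A H)"
    using bilinear_map_right[OF bilinear_mult[OF algebra_AH] assms]
    by (simp add: module_hom_def tensor_algebra_simps)
  from module_hom_comp[OF coact_hom this] show ?thesis
    by (simp add: twist_coact_def)
qed

lemma twist_coact_mult:
  assumes "X \<in> carrier AH" "Y \<in> carrier AH" "a \<in> carrier A" "b \<in> carrier A"
  shows "twist_coact (X \<star> Y) (a \<cdot> b) = twist_coact X a \<star> twist_coact Y b"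
  using assms coact_closed[OF assms(3)] coact_closed[OF assms(4)]
  by (simp add: twist_coact_def coact_mult AH.m_ac)

lemma twist_coact_mult_coact:
  assumes "X \<in> carrier AH" "a \<in> carrier A" "b \<in> carrier A"
  shows "twist_coact X (a \<cdot> b) = twist_coact X a \<star> coact A b"
  using assms coact_closed[OF assms(2)] coact_closed[OF assms(3)]
  by (simp add: twist_coact_def coact_mult AH.m_ac)

lemma grouplike_iff:
  "grouplike k H A X \<longleftrightarrow> X \<in> carrier AH \<and>
    coact_fst k H A (twist_coact X) X = comult_snd k H A X \<and> counit_snd H A X = \<one>\<^bsub>A\<^esub>"
  unfolding grouplike_def coact_fst_def comult_snd_def counit_snd_def twist_coact_def
  by (auto simp: eq_commute)

lemma grouplikeD:
  assumes "grouplike k H A X"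
  shows "X \<in> carrier AH" "coact_fst k H A (twist_coact X) X = comult_snd k H A X"
    "counit_snd H A X = \<one>\<^bsub>A\<^esub>"
  using assms by (simp_all add: grouplike_iff)

lemma right_coaction_twist:
  assumes X: "grouplike k H A X"
  shows "right_coaction k H A (twist_coact X)"
proof -
  note XD = grouplikeD[OF X] and hom = twist_coact_hom[OF grouplikeD(1)[OF X]]
  have colinear: "twist_coact X (u \<cdot> v) =
      pairing A (monoid.mult A) (twist_coact X u) (coact A v)"
    if "u \<in> carrier A" "v \<in> carrier A" for u v
    using twist_coact_mult_coact[OF XD(1) that] by (simp add: AH_mult)
  note co = right_coactionD(2,3)[OF right_coaction_A]
  have "coact_fst k H A (twist_coact X) (twist_coact X a) = comult_snd k H A (twist_coact X a)"
    and "counit_snd H A (twist_coact X a) = a" if a: "a \<in> carrier A" for a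
    using coassoc_bilinear[OF module_A module_A module_A bilinear_mult[OF algebra_A] hom coact_hom hom
        colinear A_one_closed a]
      counit_bilinear[OF module_A module_A module_A bilinear_mult[OF algebra_A] hom coact_hom hom
        colinear A_one_closed a]
      XD co[OF a] a
    by (simp_all add: twist_coact_one A_one_mult)
  with hom show ?thesis by (simp add: right_coaction_iff)
qed

lemma relative_Hopf_module_twist:
  assumes X: "grouplike k H A X"
  shows "Hopf (tw X)"
proof -
  have "twist_coact X (a \<cdot> m) = twist_coact X m \<star> coact A a"
    if "m \<in> carrier A" "a \<in> carrier A" for m a
    using twist_coact_mult_coact[OF grouplikeD(1)[OF X] that] that by (simp add: A_mult_comm)
  then show ?thesis
    unfolding twist_eq relative_Hopf_module_regular_iff using right_coaction_twist[OF X] by simp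
qed

lemma relative_Hopf_module_regular:
  assumes Hopf: "Hopf (with_coaction (regular_module A) \<rho>)"
  shows "grouplike k H A (\<rho> \<one>\<^bsub>A\<^esub>)"
    and "\<And>a. a \<in> carrier A \<Longrightarrow> \<rho> a = twist_coact (\<rho> \<one>\<^bsub>A\<^esub>) a"
proof -
  from Hopf have \<rho>: "right_coaction k H A \<rho>"
    and mult: "\<And>m a. m \<in> carrier A \<Longrightarrow> a \<in> carrier A \<Longrightarrow> \<rho> (a \<cdot> m) = \<rho> m \<star> coact A a"
    unfolding relative_Hopf_module_regular_iff by blast+
  note \<rho>D = right_coactionD[OF \<rho>]
  show eq: "\<rho> a = twist_coact (\<rho> \<one>\<^bsub>A\<^esub>) a" if "a \<in> carrier A" for a
    using mult[OF A_one_closed that] that by (simp add: A_mult_one twist_coact_def)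
  have X: "\<rho> \<one>\<^bsub>A\<^esub> \<in> carrier (tensor k A H)" by (rule module_homD(1)[OF \<rho>D(1) A_one_closed])
  have "coact_fst k H A (twist_coact (\<rho> \<one>\<^bsub>A\<^esub>)) (\<rho> \<one>\<^bsub>A\<^esub>) = coact_fst k H A \<rho> (\<rho> \<one>\<^bsub>A\<^esub>)"
    unfolding coact_fst_def
    by (subst tensor_map_cong[OF module_A module_H module_tensor[OF module_A module_H] module_H
          \<rho>D(1) module_hom_id eq refl X]) simp_all
  then show "grouplike k H A (\<rho> \<one>\<^bsub>A\<^esub>)"
    using \<rho>D A_one_closed X by (simp add: grouplike_iff carrier_AH)
qed

text \<open>The given coaction of A is itself a relative Hopf module structure on the regular
  module, and its value at 1 is 1.\<close>

lemma grouplike_one: "grouplike k H A \<one>\<^bsub>AH\<^esub>"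
  using relative_Hopf_module_regular(1)[of "coact A"] relative_Hopf_module_unit
  by (simp add: relative_Hopf_unit_def coact_one)

lemma grouplike_mult:
  assumes X: "grouplike k H A X" and Y: "grouplike k H A Y"
  shows "grouplike k H A (X \<star> Y)"
proof -
  note XD = grouplikeD[OF X] and YD = grouplikeD[OF Y]
  note hom = twist_coact_hom[OF XD(1)] twist_coact_hom[OF YD(1)] twist_coact_hom[OF AH.m_closed[OF XD(1) YD(1)]]
  have colinear: "twist_coact (X \<star> Y) (u \<cdot> v) =
      pairing A (monoid.mult A) (twist_coact X u) (twist_coact Y v)"
    if "u \<in> carrier A" "v \<in> carrier A" for u v
    using twist_coact_mult[OF XD(1) YD(1) that] by (simp add: AH_mult)
  show ?thesis
    using coassoc_bilinear[OF module_A module_A module_A bilinear_mult[OF algebra_A] hom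
        colinear A_one_closed A_one_closed]
      counit_bilinear[OF module_A module_A module_A bilinear_mult[OF algebra_A] hom
        colinear A_one_closed A_one_closed] XD YD
    by (simp add: grouplike_iff twist_coact_one A_one_mult A_one_closed)
qed

text \<open>Put C = (id \<otimes> \<Delta>)(X), which is also the other side of the grouplike
  condition for X. Both sides of that condition are multiplicative, so C times either side for Y is
  the value at X Y = 1, namely 1. The two sides for Y are thus inverses of the same element C and
  coincide. The counit condition is multiplicativity as well.\<close>

lemma grouplike_inv:
  assumes X: "grouplike k H A X" and Y: "Y \<in> carrier AH" and XY: "X \<star> Y = \<one>\<^bsub>AH\<^esub>"
  shows "grouplike k H A Y"
proof -
  note XD = grouplikeD[OF X]
  note hom = twist_coact_hom[OF XD(1)] twist_coact_hom[OF Y] twist_coact_hom[OF AH.one_closed]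
  note bil = bilinear_mult[OF algebra_A]
  \<comment> \<open>The cancellation takes place in this commutative ring; its product is
    \<open>pairing3\<close> for the multiplication of A.\<close>
  let ?AHH = "tensor_algebra k A (tensor_algebra k H H)"
  interpret AHH: cring ?AHH
    by (rule algebra.M_cring[OF algebra_tensor_algebra[OF algebra_A algebra_HH]])
  have AHH_mult: "pairing3 A (monoid.mult A) =
      monoid.mult ?AHH"
    by (simp add: tensor_algebra_simps tensor_pairing_def[abs_def] tensor_tensor_algebra)
  have AHH_carrier: "carrier ?AHH = carrier (tensor k A (tensor k H H))"
    by (simp add: tensor_algebra_simps tensor_tensor_algebra)
  have colinear: "twist_coact \<one>\<^bsub>AH\<^esub> (u \<cdot> v) =
      pairing A (monoid.mult A) (twist_coact X u) (twist_coact Y v)"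
    if "u \<in> carrier A" "v \<in> carrier A" for u v
    using twist_coact_mult[OF XD(1) Y that, unfolded XY] by (simp only: AH_mult)
  have cX: "X \<in> carrier (tensor k A H)" and cY: "Y \<in> carrier (tensor k A H)"
    using XD(1) Y by (simp_all add: carrier_AH)
  let ?C = "comult_snd k H A X" and ?a = "coact_fst k H A (twist_coact Y) Y" and ?b = "comult_snd k H A Y"
  have cl: "?C \<in> carrier ?AHH" "?a \<in> carrier ?AHH" "?b \<in> carrier ?AHH"
    using module_homD(1)[OF comult_snd_hom[OF module_A] cX] module_homD(1)[OF comult_snd_hom[OF module_A] cY]
      module_homD(1)[OF coact_fst_hom[OF module_A hom(2)] cY]
    by (simp_all add: AHH_carrier)
  have "?C \<otimes>\<^bsub>?AHH\<^esub> ?a = coact_fst k H A (twist_coact \<one>\<^bsub>AH\<^esub>) (X \<star> Y)"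
    using coact_fst_pairing[OF module_A module_A module_A bil hom colinear cX cY] XD(2)
    by (simp add: AH_mult AHH_mult)
  also have "\<dots> = comult_snd k H A \<one>\<^bsub>AH\<^esub>"
    using grouplikeD(2)[OF grouplike_one] by (simp add: XY)
  finally have Ca: "?C \<otimes>\<^bsub>?AHH\<^esub> ?a = comult_snd k H A \<one>\<^bsub>AH\<^esub>" .
  have Cb: "?C \<otimes>\<^bsub>?AHH\<^esub> ?b = comult_snd k H A \<one>\<^bsub>AH\<^esub>"
    using comult_snd_pairing[OF module_A module_A module_A bil cX cY] XY by (simp add: AH_mult AHH_mult)
  have one: "comult_snd k H A \<one>\<^bsub>AH\<^esub> = \<one>\<^bsub>?AHH\<^esub>"
    using comult_snd_pure[OF module_A A_one_closed H_one_closed]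
    by (simp add: AH_one comult_one tensor_algebra_simps tensor_tensor_algebra)
  \<comment> \<open>Uniqueness of inverses: a = a (C b) = (C a) b = b.\<close>
  have "?a = ?a \<otimes>\<^bsub>?AHH\<^esub> (?C \<otimes>\<^bsub>?AHH\<^esub> ?b)" using cl Cb one by simp
  also have "\<dots> = (?C \<otimes>\<^bsub>?AHH\<^esub> ?a) \<otimes>\<^bsub>?AHH\<^esub> ?b" using cl by (simp add: AHH.m_ac)
  also have "\<dots> = ?b" using cl Ca one by simp
  finally have "?a = ?b" .
  moreover have "counit_snd H A Y = \<one>\<^bsub>A\<^esub>"
  proof -
    have "counit_snd H A (X \<star> Y) = counit_snd H A X \<cdot> counit_snd H A Y"
      unfolding AH_mult by (rule counit_snd_pairing[OF module_A module_A module_A bil cX cY])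
    then show ?thesis
      using XY XD(3) grouplikeD(3)[OF grouplike_one] module_homD(1)[OF counit_snd_hom[OF module_A] cY]
      by (simp add: A_one_mult)
  qed
  ultimately show ?thesis using Y by (simp add: grouplike_iff)
qed

text \<open>The isomorphism is the multiplication A \<otimes>_A A \<cong> A. It is colinear because
  X Y \<rho>(m n) = (X \<rho>(m)) (Y \<rho>(n)).\<close>

lemma relative_Hopf_iso_twist_mult:
  assumes X: "grouplike k H A X" and Y: "grouplike k H A Y"
  shows "hiso (tens (tw X) (tw Y))
    (tw (X \<star> Y))"
proof -
  let ?R = "regular_module A"
  note XD = grouplikeD[OF X] and YD = grouplikeD[OF Y] and XY = grouplike_mult[OF X Y]
  note HX = relative_Hopf_module_twist[OF X] and HY = relative_Hopf_module_twist[OF Y]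
  note HXY = relative_Hopf_module_twist[OF XY]
  note R = module_regular_A
  have t: "tensor A (tw X) (tw Y) = tensor A ?R ?R"
    "pure_tensor A (tw X) (tw Y) = pure_tensor A ?R ?R"
    by (simp_all add: twist_eq)
  have carrier: "carrier (tw Z) = carrier A" "coact (tw Z) = twist_coact Z"
    "res (tw Z) = res ?R" for Z by (simp_all add: twist_eq)
  note u = tensor_unit_hom[OF R] and u_pure = tensor_unit_pure[OF R]
  have bil: "bilinear_map k A A A (\<lambda>m n. tensor_unit ?R (pure_tensor A ?R ?R m n))"
    by (rule bilinear_map_cong[OF module_A module_A bilinear_mult[OF algebra_A]]) (simp add: u_pure)
  have "tensor_unit ?R \<in> Hopf_hom
      (tens (tw X) (tw Y)) (tw (X \<star> Y))"
  proof (rule relative_Hopf_tensor_homI[OF HX HY HXY], unfold t)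
    show "tensor_unit ?R \<in> module_hom A (tensor A ?R ?R) (tw (X \<star> Y))"
      using u by (simp add: twist_eq)
    fix m n assume "m \<in> carrier (tw X)" "n \<in> carrier (tw Y)"
    then have mn: "m \<in> carrier A" "n \<in> carrier A" by (simp_all add: carrier)
    have "coact (tw (X \<star> Y)) (tensor_unit ?R (pure_tensor A ?R ?R m n)) =
        pairing A (monoid.mult A) (twist_coact X m) (twist_coact Y n)"
      using mn twist_coact_mult[OF XD(1) YD(1) mn] by (simp add: carrier u_pure AH_mult)
    also have "\<dots> = pairing A (\<lambda>m n. tensor_unit ?R (pure_tensor A ?R ?R m n))
        (twist_coact X m) (twist_coact Y n)"
      by (rule pairing_cong[OF module_A module_A module_A bilinear_mult[OF algebra_A] bil])
        (use mn twist_coact_closed[OF XD(1)] twist_coact_closed[OF YD(1)] in \<open>simp_all add: u_pure carrier_AH\<close>)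
    finally show "coact (tw (X \<star> Y)) (tensor_unit ?R (pure_tensor A ?R ?R m n)) =
        pairing (res (tw (X \<star> Y))) (\<lambda>m n. tensor_unit ?R (pure_tensor A ?R ?R m n))
          (coact (tw X) m) (coact (tw Y) n)"
      by (simp add: carrier res_regular)
  qed
  then show ?thesis
    by (rule relative_Hopf_isoI[OF relative_Hopf_module_tensor[OF HX HY] relative_Hopf_moduleD(1)[OF HXY],
          where g = "\<lambda>a. pure_tensor A ?R ?R \<one>\<^bsub>A\<^esub> a"])
      (simp_all add: relative_Hopf_tensor_simps[OF HX HY] t carrier pure_tensor_closed[OF R R] A_one_closed
        pure_tensor_one_tensor_unit[OF R] u_pure A_one_mult)
qed

text \<open>Colinearity of a \<otimes> m \<mapsto> a m is the compatibility axiom of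
  \<open>M\<close>, with the factors interchanged by commutativity of H.\<close>

lemma relative_Hopf_iso_unit:
  assumes M: "Hopf M"
  shows "hiso (tens (relative_Hopf_unit A) M) M"
proof -
  let ?R = "regular_module A"
  note MD = relative_Hopf_moduleD[OF M] and U = relative_Hopf_module_unit
  note R = module_regular_A
  have t: "tensor A (relative_Hopf_unit A) M = tensor A ?R M"
    "pure_tensor A (relative_Hopf_unit A) M = pure_tensor A ?R M"
    "carrier (relative_Hopf_unit A) = carrier A" "coact (relative_Hopf_unit A) = coact A"
    by (simp_all add: relative_Hopf_unit_def)
  note u = tensor_unit_hom[OF MD(1)] and u_pure = tensor_unit_pure[OF MD(1)]
  have bil: "bilinear_map k A (res M) (res M) (\<lambda>a m. tensor_unit M (pure_tensor A ?R M a m))"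
    by (rule bilinear_map_cong[OF module_A MD(6) left_action_bilinear[OF MD(1)]]) (simp add: u_pure)
  have "tensor_unit M \<in> Hopf_hom (tens (relative_Hopf_unit A) M) M"
  proof (rule relative_Hopf_tensor_homI[OF U M M], unfold t)
    show "tensor_unit M \<in> module_hom A (tensor A ?R M) M" by (rule u)
    fix a m assume am: "a \<in> carrier A" "m \<in> carrier M"
    have "act_pairing M (coact M m) (coact A a) = pairing (res M) (\<lambda>a m. tensor_unit M (pure_tensor A ?R M a m)) (coact A a) (coact M m)"
      by (rule pairing_comm[OF MD(6) module_A MD(6) action_bilinear[OF MD(1)] bil _
            MD(5)[OF am(2)] coact_A_closed[OF am(1)]])
        (simp add: u_pure)
    then show "coact M (tensor_unit M (pure_tensor A ?R M a m)) = pairing (res M) (\<lambda>a m. tensor_unit M (pure_tensor A ?R M a m)) (coact A a) (coact M m)"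
      using am by (simp add: u_pure MD(3))
  qed
  then show ?thesis
    by (rule relative_Hopf_isoI[OF relative_Hopf_module_tensor[OF U M] MD(1),
          where g = "\<lambda>m. pure_tensor A ?R M \<one>\<^bsub>A\<^esub> m"])
      (simp_all add: relative_Hopf_tensor_simps[OF U M] t pure_tensor_closed[OF R MD(1)] A_one_closed
        pure_tensor_one_tensor_unit[OF MD(1)] u_pure module.smult_one[OF MD(1)])
qed

section \<open>Units of A and trivial twists\<close>

lemma Units_A: "a \<in> Units A \<longleftrightarrow> a \<in> carrier A \<and> (\<exists>b \<in> carrier A. a \<cdot> b = \<one>\<^bsub>A\<^esub>)"
  unfolding Units_def using A_mult_comm by auto

lemma unit_to_grouplike_eq:
  assumes "v \<in> carrier A" "u \<in> carrier A" "v \<cdot> u = \<one>\<^bsub>A\<^esub>"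
  shows "unit_to_grouplike k H A v = pure_tensor k A H u \<one>\<^bsub>H\<^esub> \<star> coact A v"
proof -
  interpret cA: cring A by (rule cring_A)
  have "inv\<^bsub>A\<^esub> v = u"
    using assms A_mult_comm by (intro comm_monoid.comm_inv_char[OF cring.axioms(2)[OF cring_A]])
  then show ?thesis by (simp add: unit_to_grouplike_def)
qed

text \<open>For \<open>X = d (v)\<close> the isomorphism \<open>A \<rightarrow> A\<^sup>X\<close> is multiplication by \<open>v\<^sup>-\<^sup>1\<close>.\<close>

lemma unit_iso_twist_imp:
  assumes X: "X \<in> carrier AH"
    and iso: "hiso (relative_Hopf_unit A) (tw X)"
  shows "\<exists>v \<in> Units A. X = unit_to_grouplike k H A v"
proof -
  obtain f g where f: "f \<in> Hopf_hom (relative_Hopf_unit A) (tw X)"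
    and g: "g \<in> Hopf_hom (tw X) (relative_Hopf_unit A)"
    and gf: "\<And>x. x \<in> carrier (relative_Hopf_unit A) \<Longrightarrow> g (f x) = x"
    and fg: "\<And>x. x \<in> carrier (tw X) \<Longrightarrow> f (g x) = x"
    by (rule relative_Hopf_isoE[OF iso], rule that)
  note fD = relative_Hopf_homD[OF f, unfolded relative_Hopf_unit_def twist_eq, simplified]
  note gD = relative_Hopf_homD[OF g, unfolded relative_Hopf_unit_def twist_eq, simplified]
  note fm = module_homD[OF fD(1), simplified] and gm = module_homD[OF gD(1), simplified]
  define u v where "u = f \<one>\<^bsub>A\<^esub>" and "v = g \<one>\<^bsub>A\<^esub>"
  have uv: "u \<in> carrier A" "v \<in> carrier A" by (simp_all add: u_def v_def fm gm A_one_closed)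
  have f_eq: "f a = a \<cdot> u" if "a \<in> carrier A" for a
    using fm(3)[OF that A_one_closed] that by (simp add: u_def A_mult_one)
  have "v \<cdot> u = f v" using f_eq[OF uv(2)] by simp
  also have "\<dots> = \<one>\<^bsub>A\<^esub>" unfolding v_def by (rule fg) (simp add: twist_eq A_one_closed)
  finally have vu: "v \<cdot> u = \<one>\<^bsub>A\<^esub>" .
  have f_hom: "f \<in> module_hom k A A"
    by (rule module_homI) (use fm uv in \<open>simp_all add: f_eq A.smult_assoc2 A_mult_closed\<close>)
  \<comment> \<open>Colinearity of \<open>f\<close> at 1, where the coaction of A is 1 \<otimes>
    1.\<close>
  have "X \<star> coact A u = map_fst A f \<one>\<^bsub>AH\<^esub>"
    using fD(2)[OF A_one_closed] by (simp add: u_def twist_coact_def coact_one res_regular)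
  also have "\<dots> = pure_tensor k A H u \<one>\<^bsub>H\<^esub>"
    by (simp add: AH_one tensor_map_pure[OF module_A module_H module_A module_H f_hom module_hom_id]
        A_one_closed H_one_closed u_def)
  finally have *: "X \<star> coact A u = pure_tensor k A H u \<one>\<^bsub>H\<^esub>" .
  \<comment> \<open>Multiplying by \<rho>(v) cancels \<rho>(u), since \<rho>(u) \<rho>(v) = \<rho>(u
    v) = 1.\<close>
  have "X = X \<star> coact A (u \<cdot> v)"
    using X vu uv by (simp add: A_mult_comm coact_one)
  also have "\<dots> = X \<star> coact A u \<star> coact A v"
    using X uv by (simp add: coact_mult coact_closed AH.m_assoc)
  also have "\<dots> = unit_to_grouplike k H A v"
    using unit_to_grouplike_eq[OF uv(2,1) vu] * by simp
  finally show ?thesis using uv vu Units_A by blast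
qed

text \<open>The coaction of A is transported along multiplication by u = v^{-1}. The new coaction
  has the value \<rho>(v) (u \<otimes> 1) = d(v) at 1, so d(v) is grouplike because it comes from a
  relative Hopf module structure on A, with no computation of its comultiplication.\<close>

lemma unit_to_grouplike_twist:
  assumes v: "v \<in> Units A"
  shows "grouplike k H A (unit_to_grouplike k H A v)"
    and "hiso (relative_Hopf_unit A) (tw (unit_to_grouplike k H A v))"
proof -
  let ?R = "regular_module A"
  from v obtain u where uv: "u \<in> carrier A" "v \<in> carrier A" and vu: "v \<cdot> u = \<one>\<^bsub>A\<^esub>"
    by (auto simp: Units_A)
  then have uv': "u \<cdot> v = \<one>\<^bsub>A\<^esub>" by (simp add: A_mult_comm)
  let ?f = "\<lambda>a. a \<cdot> u" and ?g = "\<lambda>a. a \<cdot> v"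
  have inverse: "a \<cdot> v \<cdot> u = a" "a \<cdot> u \<cdot> v = a" if "a \<in> carrier A" for a
    using that uv vu uv' by (simp_all add: A_mult_assoc A_mult_one)
  have f: "?f \<in> module_hom A (relative_Hopf_unit A) ?R"
    using uv cring.cring_simprules(13)[OF cring_A]
    by (simp add: module_hom_def relative_Hopf_unit_def A_mult_closed A_mult_assoc)
  define \<rho> where "\<rho> = (\<lambda>y. tensor_map k (res ?R) H ?f (\<lambda>h. h) (coact (relative_Hopf_unit A) (?g y)))"
  note tr = relative_Hopf_module_transport[OF relative_Hopf_module_unit module_regular_A f, where g = ?g,
      folded \<rho>_def]
  have Hopf: "Hopf (with_coaction ?R \<rho>)"
    by (rule tr(1)) (simp_all add: relative_Hopf_unit_def A_mult_closed uv inverse)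
  have hom: "?f \<in> Hopf_hom (relative_Hopf_unit A) (with_coaction ?R \<rho>)"
    by (rule tr(2)) (simp_all add: relative_Hopf_unit_def A_mult_closed uv inverse)
  have "\<rho> \<one>\<^bsub>A\<^esub> = tensor_map k A H ?f (\<lambda>h. h) (coact A v)"
    using uv by (simp add: \<rho>_def res_regular relative_Hopf_unit_def A_one_mult)
  also have "\<dots> = coact A v \<star> pure_tensor k A H u \<one>\<^bsub>H\<^esub>"
    by (rule tensor_map_mult[OF uv(1) coact_closed[OF uv(2)]])
  also have "\<dots> = unit_to_grouplike k H A v"
    unfolding unit_to_grouplike_eq[OF uv(2,1) vu]
    using uv by (simp add: AH.m_comm coact_closed pure_one_closed)
  finally have one: "\<rho> \<one>\<^bsub>A\<^esub> = unit_to_grouplike k H A v" .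
  show gl: "grouplike k H A (unit_to_grouplike k H A v)"
    using relative_Hopf_module_regular(1)[OF Hopf] by (simp add: one)
  \<comment> \<open>The transported structure and the twist have coactions that are known to agree
    on the carrier only, so the colinearity of the map is restated for the twist.\<close>
  have "?f \<in> Hopf_hom (relative_Hopf_unit A) (tw (unit_to_grouplike k H A v))"
  proof (rule relative_Hopf_homI)
    show "?f \<in> module_hom A (relative_Hopf_unit A) (tw (unit_to_grouplike k H A v))"
      using f by (simp add: twist_eq)
    fix m assume "m \<in> carrier (relative_Hopf_unit A)"
    then show "coact (tw (unit_to_grouplike k H A v)) (?f m) =
        tensor_map k (res (tw (unit_to_grouplike k H A v))) H ?f (\<lambda>h. h)
          (coact (relative_Hopf_unit A) m)"
      using relative_Hopf_homD(2)[OF hom, of m] relative_Hopf_module_regular(2)[OF Hopf, of "?f m"] uv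
      by (simp add: twist_eq one relative_Hopf_unit_def A_mult_closed)
  qed
  then show "hiso (relative_Hopf_unit A) (tw (unit_to_grouplike k H A v))"
    by (rule relative_Hopf_isoI[OF relative_Hopf_module_unit
          relative_Hopf_moduleD(1)[OF relative_Hopf_module_twist[OF gl]], where g = ?g])
      (simp_all add: twist_eq relative_Hopf_unit_def A_mult_closed uv inverse)
qed

end

section \<open>Picard groups\<close>

lemma comm_group_cong:
  assumes G: "comm_group G" and c: "carrier G' = carrier G" and o: "\<one>\<^bsub>G'\<^esub> = \<one>\<^bsub>G\<^esub>"
    and m: "\<And>x y. x \<in> carrier G \<Longrightarrow> y \<in> carrier G \<Longrightarrow> x \<otimes>\<^bsub>G'\<^esub> y = x \<otimes>\<^bsub>G\<^esub> y"
  shows "comm_group G'"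
proof -
  interpret comm_group G by (rule G)
  show ?thesis
  proof (rule comm_groupI)
    fix x assume "x \<in> carrier G'"
    then show "\<exists>y \<in> carrier G'. y \<otimes>\<^bsub>G'\<^esub> x = \<one>\<^bsub>G'\<^esub>"
      by (intro bexI[of _ "inv\<^bsub>G\<^esub> x"]) (simp_all add: c o m)
  next
    fix x y assume "x \<in> carrier G'" "y \<in> carrier G'"
    then show "x \<otimes>\<^bsub>G'\<^esub> y = y \<otimes>\<^bsub>G'\<^esub> x" by (simp add: c m m_comm)
  qed (simp_all add: c o m m_assoc)
qed

text \<open>This works for modules on arbitrary types and does not need a copy of M \<otimes> N in
  the universe. It has to come first, since it is what shows that such a copy exists.\<close>

lemma module_iso_invertible_tensor:
  assumes M: "module R M" and M': "module R M'" and N: "module R N" and N': "module R N'"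
    and MM': "module_iso R (tensor R M M') (regular_module R)"
    and NN': "module_iso R (tensor R N N') (regular_module R)"
  shows "module_iso R (tensor R (tensor R M N) (tensor R N' M')) (regular_module R)"
proof -
  have R: "module R (regular_module R)"
    by (rule module_regular) (rule module.axioms(1)[OF M])
  note t = module_tensor
  have 1: "module_iso R (tensor R (tensor R M N) (tensor R N' M')) (tensor R M (tensor R N (tensor R N' M')))"
    by (rule module_iso_assoc[OF M N t[OF N' M']])
  have "module_iso R (tensor R N (tensor R N' M')) (tensor R (tensor R N N') M')"
    by (rule module_iso_sym[OF module_iso_assoc[OF N N' M']])
  also have "module_iso R (tensor R (tensor R N N') M') (tensor R (regular_module R) M')"
    by (rule module_iso_tensor_left[OF t[OF N N'] R M' NN'])
  also (module_iso_trans) have "module_iso R (tensor R (regular_module R) M') M'"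
    by (rule module_iso_unit[OF M'])
  finally (module_iso_trans) have 2: "module_iso R (tensor R N (tensor R N' M')) M'" .
  have 3: "module_iso R (tensor R M (tensor R N (tensor R N' M'))) (tensor R M M')"
    by (rule module_iso_tensor[OF M M t[OF N t[OF N' M']] M' module_iso_refl 2])
  show ?thesis
    by (rule module_iso_trans[OF 1 module_iso_trans[OF 3 MM']])
qed

section \<open>The Picard group of a commutative ring\<close>

context
  fixes R :: "('r, 'x) ring_scheme" and emb :: "'r list \<Rightarrow> 'u"
  assumes R: "cring R" and emb: "inj_on emb (lists (carrier R))"
begin

text \<open>Lists of length one place a copy of the ring, and with it the unit object, on the
  universe.\<close>

lemma inj_on_emb_singleton: "inj_on (\<lambda>a. emb [a]) (carrier R)"
  by (rule inj_onI) (use emb in \<open>auto dest: inj_onD\<close>)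

interpretation P: picard_data "{M :: ('r, 'u) module. module R M}" "module_iso R"
  "\<lambda>M N P. module R M \<and> module R N \<and> module R P \<and> module_iso R (tensor R M N) P"
  "\<lambda>u. module R u \<and> module_iso R (regular_module R) u"
proof (unfold_locales, unfold mem_Collect_eq)
  note reg = module_regular[OF R] and t = module_tensor
  show "module_iso R M M" for M :: "('r, 'u) module" by (rule module_iso_refl)
  fix M N P :: "('r, 'u) module"
  assume "module R M \<and> module R N \<and> module R P \<and> module_iso R (tensor R M N) P"
  then have M: "module R M" and N: "module R N" and P: "module R P"
    and MNP: "module_iso R (tensor R M N) P" by auto
  show "module R M \<and> module R N \<and> module R P" using M N P by simp
  show "module R M' \<and> module R N' \<and> module R P \<and> module_iso R (tensor R M' N') P"
    if "module R M'" "module R N'" "module_iso R M M'" "module_iso R N N'" for M' N' :: "('r, 'u) module"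
    using that P
      module_iso_trans[OF module_iso_sym[OF module_iso_tensor[OF M that(1) N that(2-4)]] MNP] by simp
  show "(module R M \<and> module R N \<and> module R P' \<and> module_iso R (tensor R M N) P') = module_iso R P P'"
    if "module R P'" for P' :: "('r, 'u) module"
    using M N that module_iso_trans[OF module_iso_sym[OF MNP]] module_iso_trans[OF MNP] by blast
  show "module R N \<and> module R M \<and> module R P \<and> module_iso R (tensor R N M) P"
    using M N P module_iso_trans[OF module_iso_swap[OF N M] MNP] by simp
  show "module R M \<and> module R S \<and> module R Q \<and> module_iso R (tensor R M S) Q"
    if "module R P \<and> module R L \<and> module R Q \<and> module_iso R (tensor R P L) Q"
      "module R N \<and> module R L \<and> module R S \<and> module_iso R (tensor R N L) S"
    for L Q S :: "('r, 'u) module"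
  proof -
    from that have L: "module R L" and Q: "module R Q" and S: "module R S"
      and PLQ: "module_iso R (tensor R P L) Q" and NLS: "module_iso R (tensor R N L) S" by auto
    have 1: "module_iso R (tensor R M S) (tensor R M (tensor R N L))"
      by (rule module_iso_tensor[OF M M S t[OF N L] module_iso_refl module_iso_sym[OF NLS]])
    have 2: "module_iso R (tensor R M (tensor R N L)) (tensor R (tensor R M N) L)"
      by (rule module_iso_sym[OF module_iso_assoc[OF M N L]])
    have 3: "module_iso R (tensor R (tensor R M N) L) (tensor R P L)"
      by (rule module_iso_tensor_left[OF t[OF M N] P L MNP])
    show ?thesis
      using M S Q module_iso_trans[OF 1 module_iso_trans[OF 2 module_iso_trans[OF 3 PLQ]]] by simp
  qed
  \<comment> \<open>M \<otimes> L has the inverse L' \<otimes> N, so it embeds into the universe by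
    way of finite lists, and its module structure is transported there.\<close>
  show "\<exists>Q :: ('r, 'u) module. module R M \<and> module R L \<and> module R Q \<and> module_iso R (tensor R M L) Q"
    if "module R P \<and> module_iso R (regular_module R) P"
      "module R L \<and> module R L' \<and> module R v \<and> module_iso R (tensor R L L') v"
      "module R v \<and> module_iso R (regular_module R) v"
    for L L' v :: "('r, 'u) module"
  proof -
    from that have L: "module R L" and L': "module R L'"
      and LL': "module_iso R (tensor R L L') (regular_module R)"
      and MN: "module_iso R (tensor R M N) (regular_module R)"
      using module_iso_trans[OF MNP module_iso_sym] module_iso_trans[OF _ module_iso_sym] by blast+
    obtain e :: "('u, 'u) tensor \<Rightarrow> 'u" where "inj_on e (carrier (tensor R M L))"
      using invertible_module_embeds[OF t[OF M L] t[OF L' N] module_iso_invertible_tensor[OF M N L L' MN LL'] emb]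
      by blast
    from transport_module[OF t[OF M L] this] show ?thesis using M L by blast
  qed
next
  show "\<exists>u :: ('r, 'u) module. module R u \<and> module_iso R (regular_module R) u"
    using transport_module[OF module_regular[OF R], of "\<lambda>a. emb [a]"] inj_on_emb_singleton by auto
next
  fix u M :: "('r, 'u) module"
  assume u: "module R u \<and> module_iso R (regular_module R) u"
  then show "module R u" by simp
  show "(module R M \<and> module_iso R (regular_module R) M) = module_iso R u M" if "module R M"
    using that u module_iso_trans[OF module_iso_sym, of R "regular_module R" u M]
      module_iso_trans[of R "regular_module R" u M] by blast
  show "module R u \<and> module R M \<and> module R M \<and> module_iso R (tensor R u M) M" if M: "module R M"
    using u M module_iso_trans[OF module_iso_tensor_left[OF _ module_regular[OF R] M
          module_iso_sym[of R "regular_module R" u]] module_iso_unit[OF M]] by blast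
qed

private lemma cls_eq: "module R M \<Longrightarrow> P.cls M = module_class R M"
  by (auto simp: P.cls_def module_class_def)

private lemma invertible_iff: "P.invertible M \<longleftrightarrow> module_invertible TYPE('u) R M"
proof
  assume "P.invertible M"
  then show "module_invertible TYPE('u) R M"
    unfolding P.invertible_def module_invertible_def
    by (meson module_iso_sym module_iso_trans)
next
  assume "module_invertible TYPE('u) R M"
  then obtain N :: "('r, 'u) module" where "module R M" "module R N"
    "module_iso R (tensor R M N) (regular_module R)"
    unfolding module_invertible_def by blast
  moreover obtain u :: "('r, 'u) module" where "module R u" "module_iso R (regular_module R) u"
    using P.unt_ex by blast
  ultimately show "P.invertible M"
    unfolding P.invertible_def by (meson module_iso_trans)
qed

lemma comm_group_Pic: "comm_group (Pic TYPE('u) R)"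
proof (rule comm_group_cong[OF P.comm_group_pic])
  have "{P.cls M | M. P.invertible M} = {module_class R M | M :: ('r, 'u) module. module_invertible TYPE('u) R M}"
    using cls_eq invertible_iff by (metis (no_types, lifting) module_invertible_def)
  then show c: "carrier (Pic TYPE('u) R) = carrier P.pic"
    by (simp add: Pic_def P.pic_def)
  show "\<one>\<^bsub>Pic TYPE('u) R\<^esub> = \<one>\<^bsub>P.pic\<^esub>"
    by (simp add: Pic_def P.pic_def module_class_def)
  fix C D assume "C \<in> carrier P.pic" "D \<in> carrier P.pic"
  \<comment> \<open>The product relation of \<open>P\<close> also requires its arguments to be
    modules, as the members of these classes are.\<close>
  then have "\<And>M. M \<in> C \<Longrightarrow> module R M" "\<And>M. M \<in> D \<Longrightarrow> module R M"
    by (auto simp: P.pic_def P.cls_def)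
  then show "C \<otimes>\<^bsub>Pic TYPE('u) R\<^esub> D = C \<otimes>\<^bsub>P.pic\<^esub> D"
    by (auto simp: Pic_def P.pic_def module_class_def)
qed

end

lemma module_class_eq: "module_iso R M N \<Longrightarrow> module_class R M = module_class R N"
  unfolding module_class_def by (auto intro: module_iso_trans module_iso_sym)

text \<open>All representatives give the same class of the tensor product, so the union is over a
  constant family. Nonemptiness is needed because \<open>M\<close> and \<open>N\<close> may live on
  other types and have no representative, which would make the union empty.\<close>

lemma module_class_mult:
  assumes M: "module R M" and N: "module R N"
    and ne: "module_class R M \<noteq> ({} :: ('r, 'u) module set)" "module_class R N \<noteq> ({} :: ('r, 'u) module set)"
  shows "module_class R M \<otimes>\<^bsub>Pic TYPE('u) R\<^esub> module_class R N = module_class R (tensor R M N)"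
proof -
  have "module_class R (tensor R M' N') = (module_class R (tensor R M N) :: ('r, 'u) module set)"
    if "M' \<in> module_class R M" "N' \<in> module_class R N" for M' N' :: "('r, 'u) module"
    using that unfolding module_class_def[of R M] module_class_def[of R N]
    by (intro module_class_eq module_iso_tensor) (auto intro: module_iso_sym M N)
  with ne show ?thesis by (simp add: Pic_def)
qed

lemma module_iso_with_coaction [simp]:
  "module_iso A (with_coaction M \<rho>) N \<longleftrightarrow> module_iso A M N"
  "module_iso A P (with_coaction Q \<sigma>) \<longleftrightarrow> module_iso A P Q"
  by (simp_all add: module_iso_def)

text \<open>Members of a class are bare module records. Dropping additional fields such as a
  coaction makes a module on \<open>'u\<close> a representative of its own class.\<close>

definition underlying_module :: "('r, 'm, 'y) module_scheme \<Rightarrow> ('r, 'm) module"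
  where "underlying_module M = \<lparr>carrier = carrier M, monoid.mult = monoid.mult M, one = one M,
    ring.zero = ring.zero M, add = add M, smult = smult M\<rparr>"

lemma underlying_module:
  assumes M: "module R M"
  shows "module R (underlying_module M)" and "module_iso R M (underlying_module M)"
proof -
  show "module R (underlying_module M)"
    by (rule module_cong[OF M]) (simp_all add: underlying_module_def)
  have "(\<lambda>x. x) \<in> module_hom R M (underlying_module M)"
    by (simp add: module_hom_def underlying_module_def)
  then show "module_iso R M (underlying_module M)"
    by (rule module_isoI[OF _ M, where g = "\<lambda>x. x"]) (simp_all add: underlying_module_def)
qed

text \<open>Since \<open>M\<close> is on \<open>'u\<close>, its class contains
  \<open>underlying_module M\<close>, which is then isomorphic to both. For modules on other types
  both classes could be empty and the equality would say nothing.\<close>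

lemma module_class_eqD:
  fixes M :: "('r, 'u, 'y) module_scheme"
  assumes M: "module R M" and eq: "module_class R M = (module_class R N :: ('r, 'u) module set)"
  shows "module_iso R M N"
proof -
  have "underlying_module M \<in> module_class R M"
    using underlying_module[OF M] by (simp add: module_class_def)
  with eq have "module_iso R N (underlying_module M)" by (simp add: module_class_def)
  then show ?thesis
    by (rule module_iso_trans[OF underlying_module(2)[OF M] module_iso_sym])
qed

lemma (in comodule_algebra_setting) module_iso_relative_Hopf_tensor:
  "module_iso A (tens M N) P \<longleftrightarrow> module_iso A (tensor A M N) P"
  by (simp add: relative_Hopf_tensor_def Let_def)

lemma (in comodule_algebra_setting) module_iso_relative_Hopf_unit:
  "module_iso A M (relative_Hopf_unit A) \<longleftrightarrow> module_iso A M (regular_module A)"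
  by (simp add: relative_Hopf_unit_def)

section \<open>The relative Picard group\<close>

locale comodule_algebra_universe = comodule_algebra_setting k H A
  for k :: "'k ring" and H :: "('k, 'h) bialgebra" and A :: "('k, 'a, 'h) comod" +
  fixes emb :: "'a list \<Rightarrow> 'u"
  assumes emb: "inj_on emb (lists (carrier A))"
begin

abbreviation PicH :: "('a, 'u, 'h) comod set monoid" where "PicH \<equiv> relative_Pic TYPE('u) k H A"

abbreviation PicA :: "('a, 'u) module set monoid" where "PicA \<equiv> Pic TYPE('u) A"

abbreviation hclass :: "('a, 'm, 'h) comod \<Rightarrow> ('a, 'u, 'h) comod set" where
  "hclass M \<equiv> relative_class k H A M"

abbreviation mclass :: "('a, 'm, 'y) module_scheme \<Rightarrow> ('a, 'u) module set" where
  "mclass M \<equiv> module_class A M"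

lemmas hiso_trans = relative_Hopf_iso_trans
lemmas hiso_sym = relative_Hopf_iso_sym
lemmas Hopf_tens = relative_Hopf_module_tensor

text \<open>Injectivity suffices, since the coaction is transported along with the module. The size
  question for relative Hopf modules is therefore that for modules.\<close>

lemma relative_Hopf_copy:
  fixes e :: "'m \<Rightarrow> 'u"
  assumes M: "Hopf M" and e: "inj_on e (carrier M)"
  shows "\<exists>P :: ('a, 'u, 'h) comod. Hopf P \<and> hiso M P"
proof -
  note N = transport_module[OF relative_Hopf_moduleD(1)[OF M] e]
  have c: "carrier (transport_module M e) = e ` carrier M"
    by (simp add: transport_module_def Let_def)
  note tr = relative_Hopf_module_transport[OF M N(1,2), where g = "inv_into (carrier M) e"]
  show ?thesis
    by (intro exI conjI; rule tr(1) tr(3)) (auto simp: c e)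
qed

lemma relative_Hopf_copy_regular:
  assumes "Hopf M" "carrier M = carrier A"
  shows "\<exists>P :: ('a, 'u, 'h) comod. Hopf P \<and> hiso M P"
  using relative_Hopf_copy[OF assms(1), of "\<lambda>a. emb [a]"] inj_on_emb_singleton[OF cring_A emb] assms(2) by simp

lemma carrier_unit: "carrier (relative_Hopf_unit A) = carrier A"
  by (simp add: relative_Hopf_unit_def)

lemma carrier_twist: "carrier (tw X) = carrier A"
  by (simp add: twist_eq)

interpretation P: picard_data "{M :: ('a, 'u, 'h) comod. Hopf M}" hiso
  "\<lambda>M N P. Hopf M \<and> Hopf N \<and> Hopf P \<and> hiso (tens M N) P"
  "\<lambda>u. Hopf u \<and> hiso (relative_Hopf_unit A) u"
proof (unfold_locales, unfold mem_Collect_eq)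
  note U = relative_Hopf_module_unit
  show "hiso M M" if "Hopf M" for M :: "('a, 'u, 'h) comod" by (rule relative_Hopf_iso_refl[OF that])
  fix M N P :: "('a, 'u, 'h) comod"
  assume "Hopf M \<and> Hopf N \<and> Hopf P \<and> hiso (tens M N) P"
  then have M: "Hopf M" and N: "Hopf N" and P: "Hopf P" and MNP: "hiso (tens M N) P" by auto
  note MN = Hopf_tens[OF M N]
  show "Hopf M \<and> Hopf N \<and> Hopf P" using M N P by simp
  show "Hopf M' \<and> Hopf N' \<and> Hopf P \<and> hiso (tens M' N') P"
    if "Hopf M'" "Hopf N'" "hiso M M'" "hiso N N'" for M' N' :: "('a, 'u, 'h) comod"
    using that P hiso_trans[OF Hopf_tens[OF that(1,2)] MN P
        hiso_sym[OF relative_Hopf_iso_tensor[OF M that(1) N that(2-4)]] MNP] by simp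
  show "(Hopf M \<and> Hopf N \<and> Hopf P' \<and> hiso (tens M N) P') = hiso P P'"
    if "Hopf P'" for P' :: "('a, 'u, 'h) comod"
    using M N that hiso_trans[OF P MN that hiso_sym[OF MNP]] hiso_trans[OF MN P that MNP] by blast
  show "Hopf N \<and> Hopf M \<and> Hopf P \<and> hiso (tens N M) P"
    using M N P hiso_trans[OF Hopf_tens[OF N M] MN P relative_Hopf_iso_swap[OF N M] MNP] by simp
  show "Hopf M \<and> Hopf S \<and> Hopf Q \<and> hiso (tens M S) Q"
    if "Hopf P \<and> Hopf L \<and> Hopf Q \<and> hiso (tens P L) Q" "Hopf N \<and> Hopf L \<and> Hopf S \<and> hiso (tens N L) S"
    for L Q S :: "('a, 'u, 'h) comod"
  proof -
    from that have L: "Hopf L" and Q: "Hopf Q" and S: "Hopf S"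
      and PLQ: "hiso (tens P L) Q" and NLS: "hiso (tens N L) S" by auto
    note NL = Hopf_tens[OF N L]
    have 1: "hiso (tens M S) (tens M (tens N L))"
      by (rule relative_Hopf_iso_tensor[OF M M S NL relative_Hopf_iso_refl[OF M] hiso_sym[OF NLS]])
    have 2: "hiso (tens M (tens N L)) (tens (tens M N) L)"
      by (rule hiso_sym[OF relative_Hopf_iso_assoc[OF M N L]])
    have 3: "hiso (tens (tens M N) L) (tens P L)"
      by (rule relative_Hopf_iso_tensor_left[OF MN P L MNP])
    have 4: "hiso (tens (tens M N) L) Q"
      by (rule hiso_trans[OF Hopf_tens[OF MN L] Hopf_tens[OF P L] Q 3 PLQ])
    have 5: "hiso (tens M (tens N L)) Q"
      by (rule hiso_trans[OF Hopf_tens[OF M NL] Hopf_tens[OF MN L] Q 2 4])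
    show ?thesis
      using M S Q hiso_trans[OF Hopf_tens[OF M S] Hopf_tens[OF M NL] Q 1 5] by simp
  qed
  \<comment> \<open>Existence of a copy depends only on the carrier, so the coactions are forgotten
    and the embedding is the one for invertible modules. The coaction is put back by
    \<open>relative_Hopf_copy\<close>.\<close>
  show "\<exists>Q :: ('a, 'u, 'h) comod. Hopf M \<and> Hopf L \<and> Hopf Q \<and> hiso (tens M L) Q"
    if "Hopf P \<and> hiso (relative_Hopf_unit A) P" "Hopf L \<and> Hopf L' \<and> Hopf v \<and> hiso (tens L L') v"
      "Hopf v \<and> hiso (relative_Hopf_unit A) v"
    for L L' v :: "('a, 'u, 'h) comod"
  proof -
    from that have L: "Hopf L" and L': "Hopf L'" and v: "Hopf v"
      and 1: "hiso (tens L L') v" "hiso (relative_Hopf_unit A) v" "hiso (relative_Hopf_unit A) P" by auto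
    have "hiso (tens L L') (relative_Hopf_unit A)" "hiso (tens M N) (relative_Hopf_unit A)"
      by (rule hiso_trans[OF Hopf_tens[OF L L'] v U 1(1) hiso_sym[OF 1(2)]],
          rule hiso_trans[OF MN P U MNP hiso_sym[OF 1(3)]])
    then have 2: "module_iso A (tensor A L L') (regular_module A)"
      "module_iso A (tensor A M N) (regular_module A)"
      by (auto dest!: relative_Hopf_iso_imp_module_iso
          simp: module_iso_relative_Hopf_tensor module_iso_relative_Hopf_unit)
    note m = relative_Hopf_moduleD(1)
    obtain e :: "('u, 'u) tensor \<Rightarrow> 'u" where "inj_on e (carrier (tensor A M L))"
      using invertible_module_embeds[OF module_tensor[OF m[OF M] m[OF L]] module_tensor[OF m[OF L'] m[OF N]]
          module_iso_invertible_tensor[OF m[OF M] m[OF N] m[OF L] m[OF L'] 2(2,1)] emb]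
      by blast
    then have "inj_on e (carrier (tens M L))" by (simp add: relative_Hopf_tensor_simps[OF M L])
    from relative_Hopf_copy[OF Hopf_tens[OF M L] this] show ?thesis using M L by blast
  qed
next
  show "\<exists>u :: ('a, 'u, 'h) comod. Hopf u \<and> hiso (relative_Hopf_unit A) u"
    by (rule relative_Hopf_copy_regular[OF relative_Hopf_module_unit carrier_unit])
next
  note U = relative_Hopf_module_unit
  fix u M :: "('a, 'u, 'h) comod"
  assume "Hopf u \<and> hiso (relative_Hopf_unit A) u"
  then have u: "Hopf u" "hiso (relative_Hopf_unit A) u" by auto
  show "Hopf u" by (rule u)
  show "(Hopf M \<and> hiso (relative_Hopf_unit A) M) = hiso u M" if M: "Hopf M"
    using M hiso_trans[OF u(1) U M hiso_sym[OF u(2)]] hiso_trans[OF U u(1) M u(2)] by blast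
  show "Hopf u \<and> Hopf M \<and> Hopf M \<and> hiso (tens u M) M" if M: "Hopf M"
    using u M hiso_trans[OF Hopf_tens[OF u(1) M] Hopf_tens[OF U M] M
        relative_Hopf_iso_tensor_left[OF u(1) U M hiso_sym[OF u(2)]] relative_Hopf_iso_unit[OF M]] by simp
qed

lemma pic_cls_eq: "P.cls M = hclass M"
  by (auto simp: P.cls_def relative_class_def)

lemma pic_invertible_iff: "P.invertible M \<longleftrightarrow> relative_invertible TYPE('u) k H A M"
proof
  assume "P.invertible M"
  then obtain N u :: "('a, 'u, 'h) comod" where M: "Hopf M" and N: "Hopf N" and u: "Hopf u"
    and 1: "hiso (relative_Hopf_unit A) u" "hiso (tens M N) u"
    unfolding P.invertible_def by blast
  have "hiso (tens M N) (relative_Hopf_unit A)"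
    by (rule hiso_trans[OF Hopf_tens[OF M N] u relative_Hopf_module_unit 1(2) hiso_sym[OF 1(1)]])
  with M N show "relative_invertible TYPE('u) k H A M"
    unfolding relative_invertible_def by blast
next
  assume "relative_invertible TYPE('u) k H A M"
  then obtain N :: "('a, 'u, 'h) comod" where MN: "Hopf M" "Hopf N" "hiso (tens M N) (relative_Hopf_unit A)"
    unfolding relative_invertible_def by blast
  moreover obtain u :: "('a, 'u, 'h) comod" where u: "Hopf u" "hiso (relative_Hopf_unit A) u"
    using P.unt_ex by blast
  moreover have "hiso (tens M N) u"
    by (rule hiso_trans[OF Hopf_tens[OF MN(1,2)] relative_Hopf_module_unit u(1) MN(3) u(2)])
  ultimately show "P.invertible M" unfolding P.invertible_def by blast
qed

lemma comm_group_relative_Pic: "comm_group (PicH)"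
proof (rule comm_group_cong[OF P.comm_group_pic])
  show "carrier (PicH) = carrier P.pic"
    by (simp add: relative_Pic_def P.pic_def pic_cls_eq pic_invertible_iff)
  show "\<one>\<^bsub>PicH\<^esub> = \<one>\<^bsub>P.pic\<^esub>"
    by (simp add: relative_Pic_def P.pic_def relative_class_def)
  fix C D assume "C \<in> carrier P.pic" "D \<in> carrier P.pic"
  then have "\<And>M. M \<in> C \<Longrightarrow> Hopf M" "\<And>M. M \<in> D \<Longrightarrow> Hopf M"
    by (auto simp: P.pic_def P.cls_def)
  then show "C \<otimes>\<^bsub>PicH\<^esub> D = C \<otimes>\<^bsub>P.pic\<^esub> D"
    by (auto simp: relative_Pic_def P.pic_def relative_class_def)
qed

lemma hclass_eq:
  assumes "Hopf M" "Hopf N" "hiso M N"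
  shows "hclass M = hclass N"
  using hiso_trans[OF assms(1,2) _ assms(3)] hiso_trans[OF assms(2,1) _ hiso_sym[OF assms(3)]]
  unfolding relative_class_def by blast

text \<open>A common representative links the two objects. Without one the classes could both be
  empty for objects that are not isomorphic.\<close>

lemma hclass_eqD:
  assumes M: "Hopf M" and N: "Hopf N" and eq: "hclass M = hclass N" and ne: "hclass M \<noteq> {}"
  shows "hiso M N"
proof -
  from ne obtain P :: "('a, 'u, 'h) comod" where "P \<in> hclass M" by blast
  with eq have P: "Hopf P" "hiso M P" "hiso N P" by (auto simp: relative_class_def)
  show ?thesis by (rule hiso_trans[OF M P(1) N P(2) hiso_sym[OF P(3)]])
qed

lemma hclass_self: "Hopf M \<Longrightarrow> M \<in> hclass M"
  using relative_Hopf_iso_refl by (simp add: relative_class_def)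

lemma hclass_regular_nonempty: "Hopf M \<Longrightarrow> carrier M = carrier A \<Longrightarrow> hclass M \<noteq> {}"
  using relative_Hopf_copy_regular by (auto simp: relative_class_def)

lemma hclass_mult:
  assumes M: "Hopf M" and N: "Hopf N" and ne: "hclass M \<noteq> {}" "hclass N \<noteq> {}"
  shows "hclass M \<otimes>\<^bsub>PicH\<^esub> hclass N = hclass (tens M N)"
proof -
  have "hclass (tens M' N') = hclass (tens M N)" if "M' \<in> hclass M" "N' \<in> hclass N" for M' N'
  proof -
    from that have M': "Hopf M'" "hiso M M'" and N': "Hopf N'" "hiso N N'"
      by (auto simp: relative_class_def)
    show ?thesis
      by (rule hclass_eq[OF Hopf_tens[OF M'(1) N'(1)] Hopf_tens[OF M N]
            hiso_sym[OF relative_Hopf_iso_tensor[OF M M'(1) N N'(1) M'(2) N'(2)]]])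
  qed
  with ne show ?thesis by (simp add: relative_Pic_def)
qed

lemma forget_hclass:
  assumes M: "Hopf M" and ne: "hclass M \<noteq> {}"
  shows "forget_coaction A (hclass M) = mclass M"
proof -
  have "mclass P = mclass M" if "P \<in> hclass M" for P
    using that relative_Hopf_iso_imp_module_iso[of M P]
    by (intro module_class_eq) (auto simp: relative_class_def intro: module_iso_sym)
  with ne show ?thesis by (simp add: forget_coaction_def)
qed

lemma relative_PicE:
  assumes "C \<in> carrier (PicH)"
  obtains M N :: "('a, 'u, 'h) comod" where "C = hclass M" "Hopf M" "Hopf N"
    "hiso (tens M N) (relative_Hopf_unit A)"
  using assms unfolding relative_Pic_def relative_invertible_def by auto

end

section \<open>The exact sequence\<close>

context comodule_algebra_setting
begin

section \<open>Unit groups, invertible grouplike elements and coinvariants\<close>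

lemma comm_monoid_A: "comm_monoid A"
  by (rule cring.axioms(2)[OF cring_A])

lemma Units_AI: "a \<in> carrier A \<Longrightarrow> b \<in> carrier A \<Longrightarrow> a \<cdot> b = \<one>\<^bsub>A\<^esub> \<Longrightarrow> a \<in> Units A"
  using Units_A by blast

lemma Units_AE:
  assumes "a \<in> Units A"
  obtains b where "a \<in> carrier A" "b \<in> carrier A" "a \<cdot> b = \<one>\<^bsub>A\<^esub>"
  using assms Units_A by blast

lemma comm_group_units_A: "comm_group (units_of A)"
  by (rule comm_monoid.units_comm_group[OF comm_monoid_A])

lemma Units_AHI:
  assumes "X \<in> carrier AH" "Y \<in> carrier AH" "X \<star> Y = \<one>\<^bsub>AH\<^esub>"
  shows "X \<in> Units AH"
  using assms AH.m_comm[OF assms(1,2)] unfolding Units_def by auto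

abbreviation Gi where "Gi \<equiv> invertible_grouplikes k H A"

lemma invertible_grouplikes_simps:
  "carrier (Gi) = {X \<in> Units AH. grouplike k H A X}"
  "monoid.mult (Gi) = monoid.mult AH"
  "\<one>\<^bsub>Gi\<^esub> = \<one>\<^bsub>AH\<^esub>"
  by (simp_all add: invertible_grouplikes_def units_of_def)

lemma grouplike_inverse:
  assumes "X \<in> Units AH" "grouplike k H A X"
  obtains Y where "Y \<in> Units AH" "grouplike k H A Y" "X \<star> Y = \<one>\<^bsub>AH\<^esub>" "Y \<star> X = \<one>\<^bsub>AH\<^esub>"
proof -
  from assms(1) have inv: "inv\<^bsub>AH\<^esub> X \<in> Units AH"
    "X \<star> inv\<^bsub>AH\<^esub> X = \<one>\<^bsub>AH\<^esub>" "inv\<^bsub>AH\<^esub> X \<star> X = \<one>\<^bsub>AH\<^esub>"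
    by (rule AH.Units_inv_Units AH.Units_r_inv AH.Units_l_inv)+
  moreover have "grouplike k H A (inv\<^bsub>AH\<^esub> X)"
    by (rule grouplike_inv[OF assms(2) AH.Units_inv_closed[OF assms(1)] inv(2)])
  ultimately show thesis using that by blast
qed

lemma comm_group_invertible_grouplikes: "comm_group (Gi)"
proof (rule comm_groupI)
  fix X assume "X \<in> carrier (Gi)"
  then have "X \<in> Units AH" "grouplike k H A X" by (simp_all add: invertible_grouplikes_simps)
  then obtain Y where "Y \<in> Units AH" "grouplike k H A Y" "Y \<star> X = \<one>\<^bsub>AH\<^esub>"
    by (rule grouplike_inverse)
  then show "\<exists>Y \<in> carrier (Gi).
      Y \<otimes>\<^bsub>Gi\<^esub> X = \<one>\<^bsub>Gi\<^esub>"
    by (auto simp: invertible_grouplikes_simps)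
next
  fix X Y assume "X \<in> carrier (Gi)" "Y \<in> carrier (Gi)"
  then show "X \<otimes>\<^bsub>Gi\<^esub> Y = Y \<otimes>\<^bsub>Gi\<^esub> X"
    unfolding invertible_grouplikes_simps by (intro AH.m_comm) (auto dest: grouplikeD)
qed (auto simp: invertible_grouplikes_simps grouplike_mult grouplike_one AH.m_assoc grouplikeD)

lemma unit_to_grouplike_unit:
  assumes "v \<in> Units A"
  shows "unit_to_grouplike k H A v \<in> Units AH"
proof -
  from assms obtain u where v: "v \<in> carrier A" and u: "u \<in> carrier A" and vu: "v \<cdot> u = \<one>\<^bsub>A\<^esub>"
    by (rule Units_AE)
  let ?p = "\<lambda>a. pure_tensor k A H a \<one>\<^bsub>H\<^esub>"
  \<comment> \<open>The inverse of d(v) is d(u) for u = v^{-1}.\<close>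
  have "?p u \<star> coact A v \<star> (?p v \<star> coact A u) =
      (?p v \<star> ?p u) \<star> (coact A v \<star> coact A u)"
    using u v by (simp add: AH.m_ac pure_one_closed coact_closed)
  also have "\<dots> = \<one>\<^bsub>AH\<^esub>"
    using u v by (simp add: pure_one_mult vu coact_one flip: coact_mult AH_one)
  finally show ?thesis
    unfolding unit_to_grouplike_eq[OF v u vu]
    by (rule Units_AHI[rotated 2]) (simp_all add: u v pure_one_closed coact_closed)
qed

lemma unit_to_grouplike_hom:
  "unit_to_grouplike k H A \<in> hom (units_of A) (Gi)"
proof (rule homI)
  fix v assume "v \<in> carrier (units_of A)"
  then show "unit_to_grouplike k H A v \<in> carrier (Gi)"
    using unit_to_grouplike_unit unit_to_grouplike_twist(1)
    by (simp add: invertible_grouplikes_simps units_of_def)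
next
  fix v w assume "v \<in> carrier (units_of A)" "w \<in> carrier (units_of A)"
  then have "v \<in> Units A" "w \<in> Units A" by (simp_all add: units_of_def)
  then obtain u x where v: "v \<in> carrier A" "u \<in> carrier A" "v \<cdot> u = \<one>\<^bsub>A\<^esub>"
    and w: "w \<in> carrier A" "x \<in> carrier A" "w \<cdot> x = \<one>\<^bsub>A\<^esub>"
    by (metis Units_AE)
  note ac = comm_monoid.m_ac[OF comm_monoid_A]
  have "(v \<cdot> w) \<cdot> (u \<cdot> x) = (v \<cdot> u) \<cdot> (w \<cdot> x)"
    using v w by (simp add: ac A_mult_closed)
  also have "\<dots> = \<one>\<^bsub>A\<^esub>" using v w by (simp add: A_one_mult A_one_closed)
  finally have vw: "(v \<cdot> w) \<cdot> (u \<cdot> x) = \<one>\<^bsub>A\<^esub>" .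
  have "unit_to_grouplike k H A (v \<cdot> w) =
      unit_to_grouplike k H A v \<star> unit_to_grouplike k H A w"
    unfolding unit_to_grouplike_eq[OF v] unit_to_grouplike_eq[OF w]
      unit_to_grouplike_eq[OF A_mult_closed[OF v(1) w(1)] A_mult_closed[OF v(2) w(2)] vw]
    using v w by (simp add: coact_mult AH.m_ac pure_one_closed coact_closed flip: pure_one_mult)
  then show "unit_to_grouplike k H A (v \<otimes>\<^bsub>units_of A\<^esub> w) =
      unit_to_grouplike k H A v \<otimes>\<^bsub>Gi\<^esub> unit_to_grouplike k H A w"
    by (simp add: invertible_grouplikes_simps units_of_def)
qed

abbreviation B where "B \<equiv> coinvariant_ring k H A"

lemma coinvariant_ring_simps:
  "carrier B = {a \<in> carrier A. coact A a = pure_tensor k A H a \<one>\<^bsub>H\<^esub>}"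
  "monoid.mult B = monoid.mult A" "\<one>\<^bsub>B\<^esub> = \<one>\<^bsub>A\<^esub>"
  by (simp_all add: coinvariant_ring_def)

lemma comm_monoid_B: "comm_monoid B"
proof (rule comm_monoidI)
  fix x y assume "x \<in> carrier B" "y \<in> carrier B"
  then show "x \<otimes>\<^bsub>B\<^esub> y = y \<otimes>\<^bsub>B\<^esub> x" by (simp add: coinvariant_ring_simps A_mult_comm)
qed (auto simp: coinvariant_ring_simps A_mult_closed coact_mult pure_one_mult A_one_closed coact_one AH_one
    A_mult_assoc A_one_mult)

lemma comm_group_units_B: "comm_group (units_of B)"
  by (rule comm_monoid.units_comm_group[OF comm_monoid_B])

text \<open>The inverse b in A of a coinvariant unit a is coinvariant: \<rho>(b) = \<rho>(b) (a
  \<otimes> 1) (b \<otimes> 1) = \<rho>(b a) (b \<otimes> 1) = b \<otimes> 1. Exactness at the units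
  of A depends on this, because the kernel of d is described inside A.\<close>

lemma Units_B: "Units B = {a \<in> Units A. coact A a = pure_tensor k A H a \<one>\<^bsub>H\<^esub>}"
proof (intro equalityI subsetI)
  fix a assume "a \<in> Units B"
  then show "a \<in> {a \<in> Units A. coact A a = pure_tensor k A H a \<one>\<^bsub>H\<^esub>}"
    by (auto simp: Units_def coinvariant_ring_simps)
next
  fix a assume "a \<in> {a \<in> Units A. coact A a = pure_tensor k A H a \<one>\<^bsub>H\<^esub>}"
  then have "a \<in> Units A" and coact: "coact A a = pure_tensor k A H a \<one>\<^bsub>H\<^esub>" by auto
  then obtain b where a: "a \<in> carrier A" and b: "b \<in> carrier A" and ab: "a \<cdot> b = \<one>\<^bsub>A\<^esub>"
    by (elim Units_AE)
  have ba: "b \<cdot> a = \<one>\<^bsub>A\<^esub>" using ab a b by (simp add: A_mult_comm)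
  have "coact A b = coact A b \<star> (pure_tensor k A H a \<one>\<^bsub>H\<^esub> \<star> pure_tensor k A H b \<one>\<^bsub>H\<^esub>)"
    using a b by (simp add: pure_one_mult ab coact_closed flip: AH_one)
  also have "\<dots> = coact A (b \<cdot> a) \<star> pure_tensor k A H b \<one>\<^bsub>H\<^esub>"
    using a b by (simp add: coact_mult AH.m_assoc pure_one_closed coact_closed flip: coact)
  also have "\<dots> = pure_tensor k A H b \<one>\<^bsub>H\<^esub>"
    using b by (simp add: ba coact_one pure_one_closed)
  finally show "a \<in> Units B"
    using a b ab ba coact by (auto simp: Units_def coinvariant_ring_simps)
qed

lemma exact_units:
  "(\<lambda>b. b) \<in> mon (units_of B) (units_of A)"
  "exact_at (units_of B) (\<lambda>b. b) (units_of A) (unit_to_grouplike k H A) (Gi)"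
proof -
  have hom: "(\<lambda>b. b) \<in> hom (units_of B) (units_of A)"
    by (rule homI) (auto simp: units_of_def Units_B coinvariant_ring_simps)
  then show "(\<lambda>b. b) \<in> mon (units_of B) (units_of A)" by (simp add: mon_def)
  have "unit_to_grouplike k H A v = \<one>\<^bsub>AH\<^esub> \<longleftrightarrow> coact A v = pure_tensor k A H v \<one>\<^bsub>H\<^esub>"
    if "v \<in> Units A" for v
  proof -
    from that obtain u where v: "v \<in> carrier A" and u: "u \<in> carrier A" and vu: "v \<cdot> u = \<one>\<^bsub>A\<^esub>"
      by (rule Units_AE)
    let ?p = "\<lambda>a. pure_tensor k A H a \<one>\<^bsub>H\<^esub>"
    have uv: "u \<cdot> v = \<one>\<^bsub>A\<^esub>" using vu u v by (simp add: A_mult_comm)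
    \<comment> \<open>This is \<rho>(v) = (v \<otimes> 1) d(v) with v \<otimes> 1 invertible, so
      d(v) = 1 means exactly that v is coinvariant.\<close>
    have "coact A v = ?p v \<star> (?p u \<star> coact A v)"
      using u v by (simp add: pure_one_closed coact_closed pure_one_mult vu flip: AH.m_assoc AH_one)
    moreover have "?p u \<star> ?p v = \<one>\<^bsub>AH\<^esub>" using u v by (simp add: pure_one_mult uv AH_one)
    ultimately show ?thesis
      unfolding unit_to_grouplike_eq[OF v u vu]
      using pure_one_closed[OF v] by auto
  qed
  then show "exact_at (units_of B) (\<lambda>b. b) (units_of A) (unit_to_grouplike k H A) (Gi)"
    unfolding exact_at_def using hom unit_to_grouplike_hom
    by (auto simp: kernel_def units_of_def Units_B invertible_grouplikes_simps)
qed

end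

section \<open>Exactness at the grouplike elements and at the relative Picard group\<close>

context comodule_algebra_universe
begin

text \<open>The inverse is the twist by X^{-1}, grouplike by \<open>grouplike_inv\<close>. Both
  twists live on the type of A, so they are replaced by copies \<open>M\<close> and \<open>N\<close>
  on \<open>'u\<close>, where invertibility is defined.\<close>

lemma relative_invertible_twist:
  assumes X: "X \<in> Units AH" "grouplike k H A X"
  shows "hclass (tw X) \<in> carrier (PicH)"
proof -
  note U = relative_Hopf_module_unit
  obtain Y where Y: "grouplike k H A Y" and XY: "X \<star> Y = \<one>\<^bsub>AH\<^esub>"
    using X by (rule grouplike_inverse)
  note HX = relative_Hopf_module_twist[OF X(2)] and HY = relative_Hopf_module_twist[OF Y]
  note H1 = relative_Hopf_module_twist[OF grouplike_one]
  \<comment> \<open>The twist by 1 and the unit object need not be equal records. Their isomorphism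
    is obtained from d(1) = 1.\<close>
  have "\<one>\<^bsub>A\<^esub> \<in> Units A" by (rule Units_AI[OF A_one_closed A_one_closed]) (simp add: A_one_closed A_one_mult)
  moreover have "unit_to_grouplike k H A \<one>\<^bsub>A\<^esub> = \<one>\<^bsub>AH\<^esub>"
    using unit_to_grouplike_eq[OF A_one_closed A_one_closed] by (simp add: A_one_closed A_one_mult coact_one flip: AH_one)
  ultimately have unit: "hiso (relative_Hopf_unit A) (tw \<one>\<^bsub>AH\<^esub>)"
    using unit_to_grouplike_twist(2)[of "\<one>\<^bsub>A\<^esub>"] by simp
  obtain M :: "('a, 'u, 'h) comod" where M: "Hopf M" "hiso (tw X) M"
    using relative_Hopf_copy_regular[OF HX carrier_twist] by blast
  obtain N :: "('a, 'u, 'h) comod" where N: "Hopf N" "hiso (tw Y) N"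
    using relative_Hopf_copy_regular[OF HY carrier_twist] by blast
  have 1: "hiso (tens M N) (tens (tw X) (tw Y))"
    by (rule hiso_sym[OF relative_Hopf_iso_tensor[OF HX M(1) HY N(1) M(2) N(2)]])
  have 2: "hiso (tens (tw X) (tw Y)) (tw \<one>\<^bsub>AH\<^esub>)"
    using relative_Hopf_iso_twist_mult[OF X(2) Y] by (simp add: XY)
  have 3: "hiso (tens (tw X) (tw Y)) (relative_Hopf_unit A)"
    by (rule hiso_trans[OF Hopf_tens[OF HX HY] H1 U 2 hiso_sym[OF unit]])
  have "hiso (tens M N) (relative_Hopf_unit A)"
    by (rule hiso_trans[OF Hopf_tens[OF M(1) N(1)] Hopf_tens[OF HX HY] U 1 3])
  with M(1) N(1) have "relative_invertible TYPE('u) k H A M"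
    unfolding relative_invertible_def by blast
  moreover have "hclass (tw X) = hclass M" by (rule hclass_eq[OF HX M])
  ultimately show ?thesis by (auto simp: relative_Pic_def)
qed

lemma relative_Pic_one: "\<one>\<^bsub>PicH\<^esub> = hclass (relative_Hopf_unit A)"
  by (simp add: relative_Pic_def)

lemma grouplike_to_Pic_hom:
  "grouplike_to_Pic k H A \<in> hom (Gi) (PicH)"
proof (rule homI)
  fix X assume "X \<in> carrier (Gi)"
  then show "grouplike_to_Pic k H A X \<in> carrier (PicH)"
    using relative_invertible_twist by (simp add: invertible_grouplikes_simps grouplike_to_Pic_def)
next
  fix X Y assume "X \<in> carrier (Gi)" "Y \<in> carrier (Gi)"
  then have X: "grouplike k H A X" and Y: "grouplike k H A Y" by (simp_all add: invertible_grouplikes_simps)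
  note H = relative_Hopf_module_twist
  have "hclass (tw X) \<otimes>\<^bsub>PicH\<^esub> hclass (tw Y) =
      hclass (tens (tw X) (tw Y))"
    by (rule hclass_mult[OF H[OF X] H[OF Y]]) (rule hclass_regular_nonempty[OF H carrier_twist], fact)+
  also have "\<dots> = hclass (tw (X \<star> Y))"
    by (rule hclass_eq[OF Hopf_tens[OF H[OF X] H[OF Y]] H[OF grouplike_mult[OF X Y]]
          relative_Hopf_iso_twist_mult[OF X Y]])
  finally show "grouplike_to_Pic k H A (X \<otimes>\<^bsub>Gi\<^esub> Y) =
      grouplike_to_Pic k H A X \<otimes>\<^bsub>PicH\<^esub> grouplike_to_Pic k H A Y"
    by (simp add: grouplike_to_Pic_def invertible_grouplikes_simps)
qed

lemma exact_grouplikes: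
  "exact_at (units_of A) (unit_to_grouplike k H A) (Gi)
    (grouplike_to_Pic k H A) (PicH)"
proof -
  note U = relative_Hopf_module_unit
  have "hclass (tw X) = hclass (relative_Hopf_unit A) \<longleftrightarrow>
      (\<exists>v \<in> Units A. X = unit_to_grouplike k H A v)" if X: "grouplike k H A X" for X
  proof
    note HX = relative_Hopf_module_twist[OF X]
    assume "hclass (tw X) = hclass (relative_Hopf_unit A)"
    then have "hiso (relative_Hopf_unit A) (tw X)"
      using hclass_eqD[OF U HX] hclass_regular_nonempty[OF U carrier_unit] by simp
    then show "\<exists>v \<in> Units A. X = unit_to_grouplike k H A v"
      by (rule unit_iso_twist_imp[OF grouplikeD(1)[OF X]])
  next
    assume "\<exists>v \<in> Units A. X = unit_to_grouplike k H A v"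
    then obtain v where v: "v \<in> Units A" and X': "X = unit_to_grouplike k H A v" by blast
    show "hclass (tw X) = hclass (relative_Hopf_unit A)"
      unfolding X'
      by (rule hclass_eq[OF relative_Hopf_module_twist[OF unit_to_grouplike_twist(1)[OF v]] U
            hiso_sym[OF unit_to_grouplike_twist(2)[OF v]]])
  qed
  then have "X \<in> unit_to_grouplike k H A ` carrier (units_of A) \<longleftrightarrow>
      X \<in> kernel (Gi) (PicH) (grouplike_to_Pic k H A)" for X
    using unit_to_grouplike_unit[of _] unit_to_grouplike_twist(1)
    by (auto simp: kernel_def grouplike_to_Pic_def relative_Pic_one invertible_grouplikes_simps units_of_def)
  then show ?thesis
    unfolding exact_at_def using unit_to_grouplike_hom grouplike_to_Pic_hom by (simp add: set_eq_iff)
qed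

lemma forget_coaction_hom:
  "forget_coaction A \<in> hom (PicH) (PicA)"
proof (rule homI)
  fix C assume "C \<in> carrier (PicH)"
  then obtain M N :: "('a, 'u, 'h) comod" where C: "C = hclass M" and M: "Hopf M" and N: "Hopf N"
    and MN: "hiso (tens M N) (relative_Hopf_unit A)"
    by (rule relative_PicE)
  note M' = relative_Hopf_moduleD(1)[OF M] and N' = relative_Hopf_moduleD(1)[OF N]
  note uM = underlying_module[OF M'] and uN = underlying_module[OF N']
  have "module_iso A (tensor A M N) (regular_module A)"
    using relative_Hopf_iso_imp_module_iso[OF MN]
    by (simp add: module_iso_relative_Hopf_tensor module_iso_relative_Hopf_unit)
  then have "module_iso A (tensor A (underlying_module M) (underlying_module N)) (regular_module A)"
    by (rule module_iso_trans[OF module_iso_sym[OF module_iso_tensor[OF M' uM(1) N' uN(1) uM(2) uN(2)]]])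
  then have "module_invertible TYPE('u) A (underlying_module M)"
    unfolding module_invertible_def using uM(1) uN(1) by blast
  moreover have "forget_coaction A C = mclass (underlying_module M)"
    using forget_hclass[OF M] hclass_self[OF M] module_class_eq[OF uM(2)] by (auto simp: C)
  ultimately show "forget_coaction A C \<in> carrier (PicA)"
    by (auto simp: Pic_def)
next
  fix C D assume CD: "C \<in> carrier (PicH)" "D \<in> carrier (PicH)"
  obtain M M' :: "('a, 'u, 'h) comod" where C: "C = hclass M" and M: "Hopf M"
    using CD(1) by (rule relative_PicE)
  obtain N N' :: "('a, 'u, 'h) comod" where D: "D = hclass N" and N: "Hopf N"
    using CD(2) by (rule relative_PicE)
  note ne = hclass_self[OF M] hclass_self[OF N]
  have mult: "C \<otimes>\<^bsub>PicH\<^esub> D = hclass (tens M N)"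
    unfolding C D by (rule hclass_mult[OF M N]) (use ne in auto)
  interpret rP: comm_group "PicH" by (rule comm_group_relative_Pic)
  \<comment> \<open>The class of M \<otimes>_A N must be nonempty before the coaction can be
    forgotten. This comes from closure of the relative Picard group under products, which rests on
    the embedding of invertible modules.\<close>
  have "hclass (tens M N) \<in> carrier (PicH)"
    using rP.m_closed[OF CD] mult by simp
  then have "hclass (tens M N) \<noteq> {}"
    by (metis hclass_self empty_iff relative_PicE)
  then have "forget_coaction A (C \<otimes>\<^bsub>PicH\<^esub> D) = mclass (tens M N)"
    unfolding mult by (rule forget_hclass[OF Hopf_tens[OF M N]])
  also have "\<dots> = mclass (tensor A M N)"
    by (rule module_class_eq) (simp add: module_iso_relative_Hopf_tensor module_iso_refl)
  \<comment> \<open>The underlying modules of \<open>M\<close> and \<open>N\<close> represent their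
    own classes, which are thus nonempty as \<open>module_class_mult\<close> requires.\<close>
  also have "\<dots> = mclass M \<otimes>\<^bsub>PicA\<^esub> mclass N"
    using underlying_module[OF relative_Hopf_moduleD(1)[OF M]] underlying_module[OF relative_Hopf_moduleD(1)[OF N]]
    by (intro module_class_mult[symmetric] relative_Hopf_moduleD(1) M N) (auto simp: module_class_def)
  also have "\<dots> = forget_coaction A C \<otimes>\<^bsub>PicA\<^esub> forget_coaction A D"
  proof -
    have "forget_coaction A (hclass M) = mclass M" by (rule forget_hclass[OF M]) (use ne in auto)
    moreover have "forget_coaction A (hclass N) = mclass N" by (rule forget_hclass[OF N]) (use ne in auto)
    ultimately show ?thesis by (simp add: C D)
  qed
  finally show "forget_coaction A (C \<otimes>\<^bsub>PicH\<^esub> D) =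
      forget_coaction A C \<otimes>\<^bsub>PicA\<^esub> forget_coaction A D" .
qed

text \<open>The coaction of \<open>M\<close> is carried to A along \<open>f\<close>, and X is its
  value at 1, that is, (f \<otimes> id) applied to the coaction of \<open>M\<close> at
  \<open>g\<close> 1. This makes X grouplike; invertibility of X is a separate matter that depends
  on an inverse of \<open>M\<close>.\<close>

lemma relative_Hopf_iso_twist_of_module_iso:
  assumes M: "Hopf M" and iso: "module_iso A M (regular_module A)"
  obtains X where "grouplike k H A X" "hiso M (tw X)"
proof -
  let ?R = "regular_module A"
  obtain f g where f: "f \<in> module_hom A M ?R" and g: "g \<in> module_hom A ?R M"
    and gf: "\<And>x. x \<in> carrier M \<Longrightarrow> g (f x) = x" and fg: "\<And>x. x \<in> carrier ?R \<Longrightarrow> f (g x) = x"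
    by (rule module_isoE[OF iso], rule that)
  define \<rho> where "\<rho> = (\<lambda>y. map_fst (res ?R) f (coact M (g y)))"
  note tr = relative_Hopf_module_transport[OF M module_regular_A f, where g = g, folded \<rho>_def]
  have Hopf: "Hopf (with_coaction ?R \<rho>)"
    by (rule tr(1)) (rule module_homD(1)[OF g] gf fg, assumption)+
  have hom: "f \<in> Hopf_hom M (with_coaction ?R \<rho>)"
    by (rule tr(2)) (rule module_homD(1)[OF g] gf fg, assumption)+
  note reg = relative_Hopf_module_regular[OF Hopf]
  note HX = relative_Hopf_module_twist[OF reg(1)]
  have "f \<in> Hopf_hom M (tw (\<rho> \<one>\<^bsub>A\<^esub>))"
  proof (rule relative_Hopf_homI)
    show "f \<in> module_hom A M (tw (\<rho> \<one>\<^bsub>A\<^esub>))" using f by (simp add: twist_eq)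
    fix m assume m: "m \<in> carrier M"
    then have "f m \<in> carrier A" using module_homD(1)[OF f] by simp
    then have "twist_coact (\<rho> \<one>\<^bsub>A\<^esub>) (f m) = \<rho> (f m)" by (rule reg(2)[symmetric])
    then show "coact (tw (\<rho> \<one>\<^bsub>A\<^esub>)) (f m) =
        map_fst (res (tw (\<rho> \<one>\<^bsub>A\<^esub>))) f (coact M m)"
      using relative_Hopf_homD(2)[OF hom m] by (simp add: twist_eq)
  qed
  then have "hiso M (tw (\<rho> \<one>\<^bsub>A\<^esub>))"
    by (rule relative_Hopf_isoI[OF M relative_Hopf_moduleD(1)[OF HX], where g = g])
      (use module_homD(1)[OF g] gf fg in \<open>simp_all add: carrier_twist\<close>)
  with reg(1) show thesis by (rule that)
qed

lemma exact_relative_Pic: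
  "exact_at (Gi) (grouplike_to_Pic k H A)
    (PicH) (forget_coaction A) (PicA)"
proof -
  note U = relative_Hopf_module_unit
  have Pic_one: "\<one>\<^bsub>PicA\<^esub> = mclass (regular_module A)" by (simp add: Pic_def)
  have "C \<in> kernel (PicH) (PicA) (forget_coaction A)"
    if C: "C \<in> grouplike_to_Pic k H A ` carrier (Gi)" for C
  proof -
    from C obtain X where X: "X \<in> Units AH" "grouplike k H A X" and C': "C = hclass (tw X)"
      by (auto simp: invertible_grouplikes_simps grouplike_to_Pic_def)
    have "forget_coaction A C = mclass (tw X)"
      unfolding C' by (rule forget_hclass[OF relative_Hopf_module_twist[OF X(2)]
            hclass_regular_nonempty[OF relative_Hopf_module_twist[OF X(2)] carrier_twist]])
    also have "\<dots> = mclass (regular_module A)"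
      by (rule module_class_eq) (simp add: twist_eq module_iso_refl)
    finally show ?thesis
      using relative_invertible_twist[OF X] by (simp add: kernel_def Pic_one C')
  qed
  moreover have "C \<in> grouplike_to_Pic k H A ` carrier (Gi)"
    if C: "C \<in> kernel (PicH) (PicA) (forget_coaction A)" for C
  proof -
    from C have 1: "C \<in> carrier (PicH)"
      and forget: "forget_coaction A C = mclass (regular_module A)"
      by (simp_all add: kernel_def Pic_one)
    from 1 obtain M N :: "('a, 'u, 'h) comod" where C': "C = hclass M" and M: "Hopf M" and N: "Hopf N"
      and MN: "hiso (tens M N) (relative_Hopf_unit A)"
      by (rule relative_PicE)
    note M' = relative_Hopf_moduleD(1)[OF M] and N' = relative_Hopf_moduleD(1)[OF N]
    have "mclass M = mclass (regular_module A)"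
      using forget forget_hclass[OF M] hclass_self[OF M] by (auto simp: C')
    then have isoM: "module_iso A M (regular_module A)" by (rule module_class_eqD[OF M'])
    \<comment> \<open>After forgetting coactions, N \<cong> A \<otimes> N \<cong> M \<otimes> N
      \<cong> A, so that \<open>N\<close> is isomorphic to a twist as well.\<close>
    have "module_iso A (tensor A M N) (regular_module A)"
      using relative_Hopf_iso_imp_module_iso[OF MN]
      by (simp add: module_iso_relative_Hopf_tensor module_iso_relative_Hopf_unit)
    then have "module_iso A (tensor A (regular_module A) N) (regular_module A)"
      by (rule module_iso_trans[OF module_iso_sym[OF module_iso_tensor_left[OF M' module_regular_A N' isoM]]])
    then have isoN: "module_iso A N (regular_module A)"
      by (rule module_iso_trans[OF module_iso_sym[OF module_iso_unit[OF N']]])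
    obtain X where X: "grouplike k H A X" and MX: "hiso M (tw X)"
      by (rule relative_Hopf_iso_twist_of_module_iso[OF M isoM])
    obtain Y where Y: "grouplike k H A Y" and NY: "hiso N (tw Y)"
      by (rule relative_Hopf_iso_twist_of_module_iso[OF N isoN])
    note HX = relative_Hopf_module_twist[OF X] and HY = relative_Hopf_module_twist[OF Y]
    note XY = grouplike_mult[OF X Y]
    have 2: "hiso (tens M N) (tw (X \<star> Y))"
      by (rule hiso_trans[OF Hopf_tens[OF M N] Hopf_tens[OF HX HY] relative_Hopf_module_twist[OF XY]
            relative_Hopf_iso_tensor[OF M HX N HY MX NY] relative_Hopf_iso_twist_mult[OF X Y]])
    have "hiso (relative_Hopf_unit A) (tw (X \<star> Y))"
      by (rule hiso_trans[OF U Hopf_tens[OF M N] relative_Hopf_module_twist[OF XY] hiso_sym[OF MN] 2])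
    then obtain v where "v \<in> Units A" "X \<star> Y = unit_to_grouplike k H A v"
      using unit_iso_twist_imp[OF grouplikeD(1)[OF XY]] by blast
    then have "X \<star> Y \<in> Units AH" using unit_to_grouplike_unit by simp
    \<comment> \<open>The inverse of X is Y (X Y)^{-1}.\<close>
    then have "X \<star> (Y \<star> inv\<^bsub>AH\<^esub> (X \<star> Y)) = \<one>\<^bsub>AH\<^esub>"
      "Y \<star> inv\<^bsub>AH\<^esub> (X \<star> Y) \<in> carrier AH"
      using grouplikeD(1)[OF X] grouplikeD(1)[OF Y] by (simp_all flip: AH.m_assoc)
    from Units_AHI[OF grouplikeD(1)[OF X] this(2,1)] have "X \<in> Units AH" .
    moreover have "C = hclass (tw X)" unfolding C' by (rule hclass_eq[OF M HX MX])
    ultimately show ?thesis using X by (auto simp: invertible_grouplikes_simps grouplike_to_Pic_def)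
  qed
  ultimately show ?thesis
    unfolding exact_at_def using grouplike_to_Pic_hom forget_coaction_hom by blast
qed

end

theorem proposition2p1:
  fixes k :: "'k ring" and H :: "('k, 'h) bialgebra" and A :: "('k, 'a, 'h) comod"
    and emb :: "'a list \<Rightarrow> 'u"
  assumes "comm_bialgebra k H"
    and "comodule_algebra k H A"
    and universe: "inj_on emb (lists (carrier A))"
  shows "comm_group (units_of (coinvariant_ring k H A)) \<and>
    comm_group (units_of A) \<and>
    comm_group (invertible_grouplikes k H A) \<and>
    comm_group (relative_Pic TYPE('u) k H A) \<and>
    comm_group (Pic TYPE('u) A) \<and>
    (\<lambda>b. b) \<in> mon (units_of (coinvariant_ring k H A)) (units_of A) \<and>
    exact_at (units_of (coinvariant_ring k H A)) (\<lambda>b. b)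
      (units_of A) (unit_to_grouplike k H A) (invertible_grouplikes k H A) \<and>
    exact_at (units_of A) (unit_to_grouplike k H A)
      (invertible_grouplikes k H A) (grouplike_to_Pic k H A) (relative_Pic TYPE('u) k H A) \<and>
    exact_at (invertible_grouplikes k H A) (grouplike_to_Pic k H A)
      (relative_Pic TYPE('u) k H A) (forget_coaction A) (Pic TYPE('u) A)"
proof -
  have S: "comodule_algebra_setting k H A"
    by (intro comodule_algebra_setting.intro comodule_algebra_setting_axioms.intro assms)
  have U: "comodule_algebra_universe k H A emb"
    by (intro comodule_algebra_universe.intro comodule_algebra_universe_axioms.intro S universe)
  show ?thesis
    by (intro conjI comodule_algebra_setting.comm_group_units_B[OF S]
        comodule_algebra_setting.comm_group_units_A[OF S]
        comodule_algebra_setting.comm_group_invertible_grouplikes[OF S]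
        comodule_algebra_universe.comm_group_relative_Pic[OF U]
        comm_group_Pic[OF comodule_algebra_setting.cring_A[OF S] universe]
        comodule_algebra_setting.exact_units[OF S] comodule_algebra_universe.exact_grouplikes[OF U]
        comodule_algebra_universe.exact_relative_Pic[OF U])
qed

end
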